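(* Let $G$ be either $\mathrm{Homeo}(2^\omega)$ (the homeomorphism group of the Cantor space) or the automorphism group of the countably-infinite-dimensional vector space over a finite field. Then $S(G)$ and $E(M(G))$ are not isomorphic as $G$-ambits.
   Context: For a topological group $G$: a $G$-flow is a compact Hausdorff space with continuous right $G$-action; a $G$-ambit is a flow with a distinguished point of dense orbit. $S(G)$ is the Samuel compactification of $G$ with its left uniformity, the greatest ambit (distinguished point $1_G$). $M(G)$ is the universal minimal flow. For a flow $X$, $E(X)$ is the enveloping semigroup: the closure in $X^X$ of $\{x\mapsto xg:g\in G\}$, an ambit with distinguished point the identity map. $\mathrm{Homeo}(2^\omega)$ carries the compact-open topology and the vector space automorphism group the pointwise convergence topology. *)

theory Defs
  imports "HOL-Analysis.Analysis"
begin

text \<open>A topological group is given by a carrier Gc, multiplication m, inverse i,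
  identity e and a topology T on Gc.  All constructions below are for right actions.\<close>

text \<open>Bounded real functions on G that are uniformly continuous for the left
  uniformity (entourages {(g,h). g^-1 h in U}, U a neighbourhood of e).
  They are normalised to be 0 outside the carrier.\<close>
definition LUC :: "'g set \<Rightarrow> ('g \<Rightarrow> 'g \<Rightarrow> 'g) \<Rightarrow> ('g \<Rightarrow> 'g) \<Rightarrow> 'g \<Rightarrow> 'g topology
                   \<Rightarrow> ('g \<Rightarrow> real) set" where
  "LUC Gc m i e T = {f. (\<forall>x. x \<notin> Gc \<longrightarrow> f x = 0) \<and> (\<exists>B. \<forall>x\<in>Gc. \<bar>f x\<bar> \<le> B) \<and>
      (\<forall>\<epsilon>>0. \<exists>U. openin T U \<and> e \<in> U \<and>
         (\<forall>g\<in>Gc. \<forall>h\<in>Gc. m (i g) h \<in> U \<longrightarrow> \<bar>f g - f h\<bar> < \<epsilon>))}"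

text \<open>Samuel compactification S(G): the Gelfand space (unital multiplicative linear
  functionals) of the algebra LUC, with the weak-star (pointwise) topology.\<close>
definition samuel_space :: "'g set \<Rightarrow> ('g \<Rightarrow> 'g \<Rightarrow> 'g) \<Rightarrow> ('g \<Rightarrow> 'g) \<Rightarrow> 'g \<Rightarrow> 'g topology
                   \<Rightarrow> (('g \<Rightarrow> real) \<Rightarrow> real) set" where
  "samuel_space Gc m i e T =
     {\<phi> \<in> PiE (LUC Gc m i e T) (\<lambda>_. UNIV).
        (\<forall>f\<in>LUC Gc m i e T. \<forall>g\<in>LUC Gc m i e T.
            \<phi> (\<lambda>x. f x + g x) = \<phi> f + \<phi> g \<and> \<phi> (\<lambda>x. f x * g x) = \<phi> f * \<phi> g) \<and>
        (\<forall>c. \<forall>f\<in>LUC Gc m i e T. \<phi> (\<lambda>x. c * f x) = c * \<phi> f) \<and>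
        \<phi> (\<lambda>x. if x \<in> Gc then 1 else 0) = 1}"

definition samuel_top :: "'g set \<Rightarrow> ('g \<Rightarrow> 'g \<Rightarrow> 'g) \<Rightarrow> ('g \<Rightarrow> 'g) \<Rightarrow> 'g \<Rightarrow> 'g topology
                   \<Rightarrow> (('g \<Rightarrow> real) \<Rightarrow> real) topology" where
  "samuel_top Gc m i e T =
     subtopology (product_topology (\<lambda>_. euclideanreal) (LUC Gc m i e T)) (samuel_space Gc m i e T)"

text \<open>Right action of G on S(G), extending right multiplication x g.\<close>
definition samuel_act :: "'g set \<Rightarrow> ('g \<Rightarrow> 'g \<Rightarrow> 'g) \<Rightarrow> ('g \<Rightarrow> 'g) \<Rightarrow> 'g \<Rightarrow> 'g topology
                   \<Rightarrow> (('g \<Rightarrow> real) \<Rightarrow> real) \<Rightarrow> 'g \<Rightarrow> (('g \<Rightarrow> real) \<Rightarrow> real)" where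
  "samuel_act Gc m i e T \<phi> g =
     restrict (\<lambda>f. \<phi> (\<lambda>y. if y \<in> Gc then f (m y g) else 0)) (LUC Gc m i e T)"

definition samuel_pt :: "'g set \<Rightarrow> ('g \<Rightarrow> 'g \<Rightarrow> 'g) \<Rightarrow> ('g \<Rightarrow> 'g) \<Rightarrow> 'g \<Rightarrow> 'g topology
                   \<Rightarrow> (('g \<Rightarrow> real) \<Rightarrow> real)" where
  "samuel_pt Gc m i e T = restrict (\<lambda>f. f e) (LUC Gc m i e T)"

definition minimal_subflow :: "'x topology \<Rightarrow> ('x \<Rightarrow> 'g \<Rightarrow> 'x) \<Rightarrow> 'g set \<Rightarrow> 'x set \<Rightarrow> bool" where
  "minimal_subflow X act Gc M \<longleftrightarrow>
     M \<noteq> {} \<and> M \<subseteq> topspace X \<and> closedin X M \<and> (\<forall>x\<in>M. \<forall>g\<in>Gc. act x g \<in> M) \<and>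
     (\<forall>N. N \<noteq> {} \<and> N \<subseteq> M \<and> closedin X N \<and> (\<forall>x\<in>N. \<forall>g\<in>Gc. act x g \<in> N) \<longrightarrow> N = M)"

definition env_space :: "'x topology \<Rightarrow> ('x \<Rightarrow> 'g \<Rightarrow> 'x) \<Rightarrow> 'g set \<Rightarrow> ('x \<Rightarrow> 'x) set" where
  "env_space X act Gc =
     (product_topology (\<lambda>_. X) (topspace X)) closure_of
        ((\<lambda>g. restrict (\<lambda>x. act x g) (topspace X)) ` Gc)"

definition env_top :: "'x topology \<Rightarrow> ('x \<Rightarrow> 'g \<Rightarrow> 'x) \<Rightarrow> 'g set \<Rightarrow> ('x \<Rightarrow> 'x) topology" where
  "env_top X act Gc = subtopology (product_topology (\<lambda>_. X) (topspace X)) (env_space X act Gc)"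

definition env_act :: "'x topology \<Rightarrow> ('x \<Rightarrow> 'g \<Rightarrow> 'x) \<Rightarrow> ('x \<Rightarrow> 'x) \<Rightarrow> 'g \<Rightarrow> ('x \<Rightarrow> 'x)" where
  "env_act X act p g = restrict (\<lambda>x. act (p x) g) (topspace X)"

definition env_pt :: "'x topology \<Rightarrow> ('x \<Rightarrow> 'x)" where
  "env_pt X = restrict (\<lambda>x. x) (topspace X)"

definition ambit_iso :: "'g set \<Rightarrow> 'x topology \<Rightarrow> ('x \<Rightarrow> 'g \<Rightarrow> 'x) \<Rightarrow> 'x
                         \<Rightarrow> 'y topology \<Rightarrow> ('y \<Rightarrow> 'g \<Rightarrow> 'y) \<Rightarrow> 'y \<Rightarrow> bool" where
  "ambit_iso Gc X actX x0 Y actY y0 \<longleftrightarrow>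
     (\<exists>h. homeomorphic_map X Y h \<and> h x0 = y0 \<and>
          (\<forall>x\<in>topspace X. \<forall>g\<in>Gc. h (actX x g) = actY (h x) g))"

text \<open>S(G) is not isomorphic to E(M(G)), with M(G) realised as a minimal subflow of S(G).\<close>
definition S_not_iso_EM :: "'g set \<Rightarrow> ('g \<Rightarrow> 'g \<Rightarrow> 'g) \<Rightarrow> ('g \<Rightarrow> 'g) \<Rightarrow> 'g \<Rightarrow> 'g topology \<Rightarrow> bool" where
  "S_not_iso_EM Gc m i e T \<longleftrightarrow>
     (\<forall>M. minimal_subflow (samuel_top Gc m i e T) (samuel_act Gc m i e T) Gc M \<longrightarrow>
        (let X = subtopology (samuel_top Gc m i e T) M; act = samuel_act Gc m i e T in
         \<not> ambit_iso Gc (samuel_top Gc m i e T) act (samuel_pt Gc m i e T)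
                        (env_top X act Gc) (env_act X act) (env_pt X)))"

definition cantor_top :: "(nat \<Rightarrow> bool) topology" where
  "cantor_top = product_topology (\<lambda>_. discrete_topology UNIV) UNIV"

definition compact_open :: "'a topology \<Rightarrow> 'b topology \<Rightarrow> ('a \<Rightarrow> 'b) topology" where
  "compact_open X Y = topology_generated_by {{f. f ` K \<subseteq> U} | K U. compactin X K \<and> openin Y U}"

definition homeo_cantor :: "((nat \<Rightarrow> bool) \<Rightarrow> (nat \<Rightarrow> bool)) set" where
  "homeo_cantor = {f. homeomorphic_map cantor_top cantor_top f}"

definition homeo_cantor_top :: "((nat \<Rightarrow> bool) \<Rightarrow> (nat \<Rightarrow> bool)) topology" where
  "homeo_cantor_top = subtopology (compact_open cantor_top cantor_top) homeo_cantor"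

text \<open>The countably-infinite-dimensional vector space over a finite field 'k:
  finitely supported sequences.  Automorphisms are linear bijections of V,
  normalised to be the identity outside V.\<close>
definition Vspace :: "(nat \<Rightarrow> 'k::{field,finite}) set" where
  "Vspace = {v. finite {n. v n \<noteq> 0}}"

definition GLV :: "((nat \<Rightarrow> 'k::{field,finite}) \<Rightarrow> (nat \<Rightarrow> 'k)) set" where
  "GLV = {f. bij_betw f Vspace Vspace \<and> (\<forall>x. x \<notin> Vspace \<longrightarrow> f x = x) \<and>
             (\<forall>u\<in>Vspace. \<forall>v\<in>Vspace. \<forall>a b. f (\<lambda>n. a * u n + b * v n) = (\<lambda>n. a * f u n + b * f v n))}"

definition GLV_top :: "((nat \<Rightarrow> 'k::{field,finite}) \<Rightarrow> (nat \<Rightarrow> 'k)) topology" where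
  "GLV_top = subtopology (product_topology (\<lambda>_. discrete_topology UNIV) UNIV) GLV"

end

theory Submission
  imports Defs
begin

text \<open>If \<open>S(G)\<close> and \<open>E(M)\<close> were isomorphic ambits, the coefficients \<open>g \<mapsto> x(f(\<cdot> g))\<close>, for \<open>x\<close> in the minimal
  flow \<open>M\<close> and \<open>f\<close> left uniformly continuous, would separate the points of \<open>S(G)\<close>; a counting argument
  shows that they do not. Let \<open>q\<close> be \<open>2\<close>, respectively the order of the field. In the orbit closure of
  \<open>x\<close> the dual Ramsey theorem yields a point whose coefficients are determined, up to \<open>\<epsilon>\<close> and on all
  translates \<open>h F\<^sub>n\<close> of a finite set \<open>F\<^sub>n \<subseteq> G\<close>, by the order in which \<open>q^n\<close> letters first occur in a
  word; by minimality the coefficients of \<open>x\<close> have at most \<open>(q^n)^(q^n)\<close> patterns on these translates.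
  On the other hand \<open>|F\<^sub>n| \<ge> q^(2(n-2))\<close>, and some \<open>S \<subseteq> G\<close> with uniformly continuous indicator meets the
  translates of \<open>F\<^sub>n\<close> in all \<open>2^|F\<^sub>n|\<close> possible ways. So finitely many coefficients never separate \<open>S\<close>
  from its complement, and compactness of \<open>S(G)\<close> gives two distinct points that none separates.\<close>

section \<open>Parameter words and the dual Ramsey theorem\<close>

text \<open>A coset \<open>g U s\<close> is recorded as a word. For homeomorphisms its letters are
  the first \<open>s\<close> coordinates of \<open>inv g\<close> on the cells of a partition, for
  linear maps they are the rows of a matrix. Left multiplication substitutes one word into another,
  whereas an element of \<open>F n\<close> only renames letters. So one choice of \<open>g\<close>
  serves all of \<open>F n\<close>, and the bound on the number of patterns does not grow with
  \<open>F n\<close>. To the base \<open>q\<close> the logarithm of that bound is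
  \<open>n q^n\<close>, so \<open>F n\<close> must outgrow every multiple of \<open>n q^n\<close>.
  Linear maps that move a single basis vector inside \<open>n\<close> coordinates give at most
  \<open>q^n\<close> images; moving two gives the exponent \<open>2 (n - 2)\<close>. The
  coefficients are uniformly continuous at levels \<open>s\<close> that are not known beforehand,
  and \<open>n\<close> has to exceed these levels and to beat the number of coefficients. The set
  \<open>S\<close> however must be invariant under one fixed \<open>U s0\<close>. Hence it is
  prescribed in advance on infinitely many translates, for every \<open>n\<close> and every subset
  of \<open>F n\<close>.\<close>

text \<open>In a parameter word over \<open>k\<close> constants the letters below \<open>k\<close> are the constants and \<open>k + i\<close> is the
  \<open>i\<close>-th variable; the map \<open>sub k v\<close> replaces that variable by \<open>v ! i\<close>. Variables first occur in
  increasing order.\<close>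

definition sub :: "nat \<Rightarrow> nat list \<Rightarrow> nat \<Rightarrow> nat" where
  "sub k v l = (if l < k then l else v ! (l - k))"

definition pw :: "nat \<Rightarrow> nat \<Rightarrow> nat list set" where
  "pw k m = {w. set w \<subseteq> {..<k+m} \<and> (\<forall>i<m. \<exists>a b. w = a @ (k+i) # b \<and> set a \<subseteq> {..<k+i})}"

text \<open>\<open>R y\<close> is a set of pairs that must agree in colour, not a set of words to be
  made monochromatic: the intermediate steps only make the colour insensitive to certain changes of
  a word. Words of every length are coloured because truncated words occur as well.\<close>

definition arr :: "nat list set \<Rightarrow> (nat list \<Rightarrow> (nat list \<times> nat list) set) \<Rightarrow> bool" where
  "arr Y R \<longleftrightarrow> (\<forall>r::nat. \<exists>N. \<forall>c. (\<forall>w. c w < r) \<longrightarrow>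
     (\<exists>y\<in>Y. length y = N \<and> (\<forall>(a,b)\<in>R y. c a = c b)))"

lemma arrD: "arr Y R \<Longrightarrow> \<exists>N. \<forall>c. (\<forall>w. c w < (r::nat)) \<longrightarrow> (\<exists>y\<in>Y. length y = N \<and> (\<forall>(a,b)\<in>R y. c a = c b))"
  unfolding arr_def by (erule spec)

text \<open>Applied below to colours that are themselves functions, recording the colour for every
  completion of a word; in this way several requirements are met at once.\<close>

lemma arr_finite_colours:
  assumes "arr Y R" "finite C"
  shows "\<exists>N. \<forall>c. (\<forall>w. c w \<in> C) \<longrightarrow> (\<exists>y\<in>Y. length y = N \<and> (\<forall>(a,b)\<in>R y. c a = c b))"
proof -
  obtain f :: "'a \<Rightarrow> nat" where f: "bij_betw f C {0..<card C}"
    using ex_bij_betw_finite_nat[OF assms(2)] by blast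
  from assms(1) obtain N where N: "\<And>c. (\<forall>w. c w < card C) \<Longrightarrow>
     (\<exists>y\<in>Y. length y = N \<and> (\<forall>(a,b)\<in>R y. c a = c b))"
    unfolding arr_def by blast
  show ?thesis
  proof (intro exI allI impI)
    fix c :: "nat list \<Rightarrow> 'a" assume c: "\<forall>w. c w \<in> C"
    have "\<forall>w. f (c w) < card C"
      using f c by (auto simp: bij_betw_def)
    from N[OF this] obtain y where y: "y\<in>Y" "length y = N" "\<forall>(a,b)\<in>R y. f (c a) = f (c b)" by blast
    moreover have "\<forall>(a,b)\<in>R y. c a = c b"
      using y(3) f c by (auto simp: bij_betw_def inj_on_def)
    ultimately show "\<exists>y\<in>Y. length y = N \<and> (\<forall>(a,b)\<in>R y. c a = c b)" by blast
  qed
qed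

lemma pw_set: "w \<in> pw k m \<Longrightarrow> l \<in> set w \<Longrightarrow> l < k + m"
  by (auto simp: pw_def)

lemma pw_first: "w \<in> pw k m \<Longrightarrow> i < m \<Longrightarrow> \<exists>a b. w = a @ (k+i) # b \<and> set a \<subseteq> {..<k+i}"
  by (auto simp: pw_def)

lemma pwI: "(\<And>l. l \<in> set w \<Longrightarrow> l < k+m) \<Longrightarrow>
    (\<And>i. i < m \<Longrightarrow> \<exists>a b. w = a @ (k+i) # b \<and> set a \<subseteq> {..<k+i}) \<Longrightarrow> w \<in> pw k m"
  by (auto simp: pw_def)

lemma subst_subst:
  assumes "\<And>l. l \<in> set w \<Longrightarrow> l < k + length v"
  shows "map (sub k u) (map (sub k v) w) = map (sub k (map (sub k u) v)) w"
  using assms by (force simp: sub_def)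

text \<open>The first occurrence of variable \<open>i\<close> in the composite comes from the
  variable of \<open>w\<close> whose index is the position where \<open>i\<close> first occurs in
  \<open>v\<close>. The case \<open>k < k'\<close> serves the induction in which a variable is
  turned into a new constant.\<close>

lemma subst_pw:
  assumes w: "w \<in> pw k n" and v: "v \<in> pw k' m" and "k \<le> k'" and len: "length v = n"
  shows "map (sub k v) w \<in> pw k' m"
proof (rule pwI)
  fix l assume "l \<in> set (map (sub k v) w)"
  then obtain j where j: "j \<in> set w" "l = sub k v j" by auto
  show "l < k' + m"
  proof (cases "j < k")
    case False
    then have "v ! (j - k) \<in> set v" using pw_set[OF w j(1)] len by (intro nth_mem) auto
    with False show ?thesis using j pw_set[OF v] by (auto simp: sub_def)
  qed (use j assms in \<open>auto simp: sub_def\<close>)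
next
  fix i assume "i < m"
  from pw_first[OF v this] obtain a b where ab: "v = a @ (k'+i) # b" "set a \<subseteq> {..<k'+i}" by blast
  with len have "length a < n" by auto
  from pw_first[OF w this] obtain \<alpha> \<beta> where
    \<alpha>: "w = \<alpha> @ (k + length a) # \<beta>" "set \<alpha> \<subseteq> {..<k + length a}" by blast
  have "sub k v (k + length a) = k' + i" by (simp add: sub_def ab)
  moreover have "sub k v l < k' + i" if "l \<in> set \<alpha>" for l
  proof (cases "l < k")
    case False
    with that \<alpha> have "l - k < length a" by auto
    then have "v ! (l-k) \<in> set a" by (simp add: ab nth_append)
    with False ab show ?thesis by (auto simp: sub_def)
  qed (use \<open>k \<le> k'\<close> in \<open>auto simp: sub_def\<close>)
  ultimately show "\<exists>a b. map (sub k v) w = a @ (k'+i) # b \<and> set a \<subseteq> {..<k'+i}"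
    using \<alpha> by (intro exI[of _ "map (sub k v) \<alpha>"] exI[of _ "map (sub k v) \<beta>"]) auto
qed

text \<open>Renumbers the variables of a word to make room for a new first variable \<open>k\<close>
  in front of it.\<close>

definition shift :: "nat \<Rightarrow> nat \<Rightarrow> nat" where
  "shift k l = (if l < k then l else Suc l)"

lemma sub_shift [simp]: "sub k (a # u) (shift k l) = sub k u l"
  by (auto simp: sub_def shift_def Suc_diff_le)

lemma append_shift_pw:
  assumes z: "z \<in> pw k 1" and y: "y \<in> pw k L"
  shows "z @ map (shift k) y \<in> pw k (Suc L)"
proof (rule pwI)
  fix l assume "l \<in> set (z @ map (shift k) y)"
  then show "l < k + Suc L" using pw_set[OF z] pw_set[OF y] by (fastforce simp: shift_def)
next
  fix i assume i: "i < Suc L"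
  show "\<exists>a b. z @ map (shift k) y = a @ (k+i) # b \<and> set a \<subseteq> {..<k+i}"
  proof (cases i)
    case 0
    from pw_first[OF z, of 0] show ?thesis unfolding 0 by fastforce
  next
    case (Suc j)
    with i pw_first[OF y, of j] obtain a b where ab: "y = a @ (k+j) # b" "set a \<subseteq> {..<k+j}" by auto
    have "set (z @ map (shift k) a) \<subseteq> {..<k+i}"
      using pw_set[OF z] ab(2) by (fastforce simp: shift_def Suc)
    moreover have "z @ map (shift k) y = (z @ map (shift k) a) @ (k+i) # map (shift k) b"
      by (simp add: ab Suc shift_def)
    ultimately show ?thesis by blast
  qed
qed

section \<open>Combinatorial lines and the Hales-Jewett theorem\<close>

lemma pw_1I:
  assumes "\<And>l. l \<in> set z \<Longrightarrow> l \<le> k" "k \<in> set z" shows "z \<in> pw k 1"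
proof (rule pwI)
  fix i :: nat assume "i < 1"
  moreover obtain a b where "z = a @ k # b" "k \<notin> set a" using assms(2) by (meson split_list_first)
  moreover have "set a \<subseteq> {..<k}" using calculation assms(1) by (force simp: order.order_iff_strict)
  ultimately show "\<exists>a b. z = a @ (k+i) # b \<and> set a \<subseteq> {..<k+i}" by auto
qed (use assms in \<open>force simp: le_imp_less_Suc\<close>)

text \<open>A word with one variable is a combinatorial line; its points arise by putting a constant
  for the variable.\<close>

definition HJ :: "nat \<Rightarrow> bool" where
  "HJ k \<longleftrightarrow> arr (pw k 1) (\<lambda>z. {(map (sub k [a]) z, map (sub k [b]) z) |a b. a < k \<and> b < k})"

text \<open>Constants below \<open>k\<close> may be exchanged for one another, letters from
  \<open>k\<close> to \<open>K - 1\<close> stay put. Hales-Jewett uses \<open>K = Suc k\<close>,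
  with the one fixed letter \<open>k\<close>; Graham-Rothschild uses \<open>K = k\<close>, where any
  two words of equal length over the constants are similar.\<close>

definition sim :: "nat \<Rightarrow> nat \<Rightarrow> nat list \<Rightarrow> nat list \<Rightarrow> bool" where
  "sim k K = list_all2 (\<lambda>a b. a < K \<and> b < K \<and> (a = b \<or> a < k \<and> b < k))"

text \<open>For a parameter word \<open>y\<close> the \<open>takeWhile\<close> below is the part of \<open>y\<close> before the variable of index
  \<open>length u\<close>, i.e. all of \<open>y\<close> if \<open>length u = L\<close>.\<close>
definition fusionR :: "nat \<Rightarrow> nat \<Rightarrow> nat \<Rightarrow> nat list \<Rightarrow> (nat list \<times> nat list) set" where
  "fusionR k K L y = {(map (sub k u) (takeWhile (\<lambda>l. l < k + length u) y),
       map (sub k v) (takeWhile (\<lambda>l. l < k + length v) y)) |u v. length u \<le> L \<and> sim k K u v}"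

text \<open>The word is a line \<open>z\<close> followed by a tail \<open>y\<close> with shifted
  variables. The length \<open>M\<close> of the tail is fixed first, so that the length of the line
  may depend on the set of all continuations up to length \<open>M\<close>; the line then makes its
  letter exchangeable in front of all of them. The tail itself is chosen after
  \<open>z\<close>.\<close>

lemma fusion:
  assumes HJ: "HJ k" and K: "k \<le> K"
  shows "arr (pw k L) (fusionR k K L)"
proof (induction L)
  case 0
  have "[] \<in> pw k 0" by (auto simp: pw_def)
  then show ?case unfolding arr_def fusionR_def sim_def by fastforce
next
  case (Suc L)
  show ?case unfolding arr_def
  proof
    fix r :: nat
    \<comment> \<open>The tail has to work for every letter \<open>a < K\<close> put into the line,
      so its colours are functions of \<open>a\<close>.\<close>
    let ?C = "{..<K} \<rightarrow>\<^sub>E {..<r}"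
    have "finite ?C" by (simp add: finite_PiE)
    from arr_finite_colours[OF Suc this] obtain M where
      M: "\<forall>c. (\<forall>w. c w \<in> ?C) \<longrightarrow> (\<exists>y\<in>pw k L. length y = M \<and> (\<forall>(a,b)\<in>fusionR k K L y. c a = c b))"
      ..
    \<comment> \<open>Contains everything that the tail can turn into, including truncations before
      a variable.\<close>
    let ?R = "{s. set s \<subseteq> {..<K} \<and> length s \<le> M}"
    let ?D = "?R \<rightarrow>\<^sub>E {..<r}"
    have "finite ?D" by (simp add: finite_PiE finite_lists_length_le)
    from arr_finite_colours[OF HJ[unfolded HJ_def] this] obtain N where
      N: "\<forall>c. (\<forall>w. c w \<in> ?D) \<longrightarrow> (\<exists>z\<in>pw k 1. length z = N \<and>
         (\<forall>(a,b)\<in>{(map (sub k [a]) z, map (sub k [b]) z) |a b. a < k \<and> b < k}. c a = c b))"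
      ..
    show "\<exists>N. \<forall>c. (\<forall>w. c w < r) \<longrightarrow>
      (\<exists>y\<in>pw k (Suc L). length y = N \<and> (\<forall>(a,b)\<in>fusionR k K (Suc L) y. c a = c b))"
    proof (intro exI[of _ "N + M"] allI impI)
      fix c :: "nat list \<Rightarrow> nat" assume c: "\<forall>w. c w < r"
      have "\<forall>w. (\<lambda>s\<in>?R. c (w @ s)) \<in> ?D" using c by auto
      from N[THEN spec, THEN mp, OF this] obtain z where z: "z \<in> pw k 1" "length z = N" and
        zc': "\<And>a b. a < k \<Longrightarrow> b < k \<Longrightarrow> (\<lambda>s\<in>?R. c (map (sub k [a]) z @ s)) = (\<lambda>s\<in>?R. c (map (sub k [b]) z @ s))"
        by blast
      have zc: "c (map (sub k [a]) z @ s) = c (map (sub k [b]) z @ s)"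
        if "a < k" "b < k" "s \<in> ?R" for a b s
        using fun_cong[OF zc'[OF that(1,2)], of s] that(3) by simp
      have "\<forall>w. (\<lambda>a\<in>{..<K}. c (map (sub k [a]) z @ w)) \<in> ?C" using c by auto
      from M[THEN spec, THEN mp, OF this] obtain y where y: "y \<in> pw k L" "length y = M" and
        yc': "\<And>u v. length u \<le> L \<Longrightarrow> sim k K u v \<Longrightarrow>
          (\<lambda>a\<in>{..<K}. c (map (sub k [a]) z @ map (sub k u) (takeWhile (\<lambda>l. l < k + length u) y))) =
          (\<lambda>a\<in>{..<K}. c (map (sub k [a]) z @ map (sub k v) (takeWhile (\<lambda>l. l < k + length v) y)))"
        unfolding fusionR_def by blast
      have yc: "c (map (sub k [a]) z @ map (sub k u) (takeWhile (\<lambda>l. l < k + length u) y)) =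
          c (map (sub k [a]) z @ map (sub k v) (takeWhile (\<lambda>l. l < k + length v) y))"
        if "length u \<le> L" "sim k K u v" "a < K" for a u v
        using fun_cong[OF yc'[OF that(1,2)], of a] that(3) by simp
      let ?y = "z @ map (shift k) y"
      have step: "map (sub k (a # u)) (takeWhile (\<lambda>l. l < k + length (a # u)) ?y) =
        map (sub k [a]) z @ map (sub k u) (takeWhile (\<lambda>l. l < k + length u) y)" for a u
      proof -
        have "takeWhile (\<lambda>l. l < k + length (a # u)) ?y =
          z @ map (shift k) (takeWhile (\<lambda>l. l < k + length u) y)"
        proof -
          have "takeWhile (\<lambda>l. l < k + length (a # u)) ?y =
            z @ takeWhile (\<lambda>l. l < k + length (a # u)) (map (shift k) y)"
            using pw_set[OF z(1)] by (intro takeWhile_append2) fastforce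
          also have "\<dots> = z @ map (shift k) (takeWhile ((\<lambda>l. l < k + length (a # u)) \<circ> shift k) y)"
            by (simp add: takeWhile_map)
          also have "(\<lambda>l. l < k + length (a # u)) \<circ> shift k = (\<lambda>l. l < k + length u)"
            by (auto simp: shift_def fun_eq_iff)
          finally show ?thesis .
        qed
        moreover have "map (sub k (a # u)) z = map (sub k [a]) z"
          using pw_set[OF z(1)] by (fastforce simp: sub_def)
        ultimately show ?thesis by (simp add: o_def)
      qed
      have "c (map (sub k u) (takeWhile (\<lambda>l. l < k + length u) ?y)) =
        c (map (sub k v) (takeWhile (\<lambda>l. l < k + length v) ?y))"
        if len: "length u \<le> Suc L" and uv: "sim k K u v" for u v
      proof (cases u)
        case Nil
        with uv show ?thesis by (simp add: sim_def)
      next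
        case (Cons a u')
        with uv obtain b v' where v: "v = b # v'" and s: "sim k K u' v'"
          and ab: "a < K" "b < K" "a = b \<or> a < k \<and> b < k"
          by (auto simp: sim_def list_all2_Cons1)
        let ?s = "map (sub k u') (takeWhile (\<lambda>l. l < k + length u') y)"
        have "set u' \<subseteq> {..<K}" using s by (auto simp: sim_def list_all2_conv_all_nth in_set_conv_nth)
        then have "sub k u' l < K" if "l < k + length u'" for l
        proof (cases "l < k")
          case False
          with that have "u' ! (l - k) \<in> set u'" by (intro nth_mem) auto
          with \<open>set u' \<subseteq> {..<K}\<close> False show ?thesis by (auto simp: sub_def)
        qed (use K in \<open>auto simp: sub_def\<close>)
        then have "?s \<in> ?R"
          using y(2) length_takeWhile_le[of _ y] by (auto dest!: set_takeWhileD)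
        \<comment> \<open>The line exchanges the first letter in front of the old tail; afterwards
          the induction hypothesis exchanges the tail behind the new letter.\<close>
        then have "c (map (sub k [a]) z @ ?s) = c (map (sub k [b]) z @ ?s)"
          using ab zc by blast
        also have "\<dots> = c (map (sub k [b]) z @ map (sub k v') (takeWhile (\<lambda>l. l < k + length v') y))"
          using len Cons by (intro yc[OF _ s ab(2)]) auto
        finally show ?thesis unfolding Cons v step .
      qed
      then have "\<forall>(a,b)\<in>fusionR k K (Suc L) ?y. c a = c b" by (auto simp: fusionR_def)
      then show "\<exists>y\<in>pw k (Suc L). length y = N + M \<and> (\<forall>(a,b)\<in>fusionR k K (Suc L) y. c a = c b)"
        using append_shift_pw[OF z(1) y(1)] z(2) y(2) by (intro bexI[of _ ?y]) auto
    qed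
  qed
qed

lemma fusionR_full:
  assumes "y \<in> pw k L" "length u = L" "sim k K u v"
  shows "(map (sub k u) y, map (sub k v) y) \<in> fusionR k K L y"
proof -
  have v: "length v = L" using assms by (auto simp: sim_def dest: list_all2_lengthD)
  have tw: "takeWhile (\<lambda>l. l < k + L) y = y" using pw_set[OF assms(1)] by simp
  show ?thesis unfolding fusionR_def mem_Collect_eq
    by (intro exI[of _ u] exI[of _ v]) (simp add: v tw assms(2,3))
qed

text \<open>The step uses as many variables as there are colours. Fusion makes the letters below
  \<open>k\<close> interchangeable, so a pigeonhole argument on words in \<open>k\<close> and
  \<open>0\<close> suffices: the block on which two words of one colour differ becomes the variable
  of the line.\<close>

lemma Hales_Jewett: "HJ k"
proof (induction k)
  case 0
  have "[0] \<in> pw 0 1" by (rule pw_1I) auto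
  then show ?case unfolding HJ_def arr_def by (intro allI exI[of _ 1]) force
next
  case (Suc k)
  show ?case
  \<comment> \<open>With a single constant a line has only one point. Otherwise \<open>0\<close>
    lies below \<open>k\<close> and is a legitimate filler among the interchangeable
    letters.\<close>
  proof (cases "k = 0")
    case True
    have "[1] \<in> pw 1 1" by (rule pw_1I) auto
    then show ?thesis unfolding HJ_def arr_def True by (intro allI exI[of _ 1]) force
  next
    case False
    show ?thesis unfolding HJ_def arr_def
    proof
      fix r :: nat
      from arrD[OF fusion[OF Suc le_SucI[OF order_refl], of r], of r] obtain N where
        N: "\<forall>c. (\<forall>w. c w < r) \<longrightarrow> (\<exists>y\<in>pw k r. length y = N \<and> (\<forall>(a,b)\<in>fusionR k (Suc k) r y. c a = c b))"
        ..
      show "\<exists>N. \<forall>c. (\<forall>w. c w < r) \<longrightarrow> (\<exists>z\<in>pw (Suc k) 1. length z = N \<and>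
         (\<forall>(a,b)\<in>{(map (sub (Suc k) [a]) z, map (sub (Suc k) [b]) z) |a b. a < Suc k \<and> b < Suc k}. c a = c b))"
      proof (intro exI[of _ N] allI impI)
        fix c :: "nat list \<Rightarrow> nat" assume c: "\<forall>w. c w < r"
        from N[THEN spec, THEN mp, OF this] obtain y where y: "y \<in> pw k r" "length y = N" and
          yc': "\<forall>(a,b)\<in>fusionR k (Suc k) r y. c a = c b" by blast
        have yc: "c (map (sub k u) y) = c (map (sub k v) y)" if "length u = r" "sim k (Suc k) u v" for u v
          using fusionR_full[OF y(1) that] yc' by blast
        \<comment> \<open>Two of the \<open>r + 1\<close> words \<open>k^i 0^(r-i)\<close> have the same colour, and below \<open>k\<close> the letters of
          a word are interchangeable.\<close>
        define t where "t = (\<lambda>i j a. replicate i k @ replicate (j - i) a @ replicate (r - j) (0::nat))"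
        let ?col = "\<lambda>i. c (map (sub k (t i i 0)) y)"
        have "\<not> inj_on ?col {..r}"
        proof
          assume "inj_on ?col {..r}"
          then have "card {..r} \<le> card {..<r}" using c by (intro card_inj_on_le[of ?col]) auto
          then show False by simp
        qed
        then obtain i j where ij: "i < j" "j \<le> r" "?col i = ?col j"
          unfolding inj_on_def by (metis atMost_iff linorder_neqE_nat)
        \<comment> \<open>Over \<open>Suc k\<close> constants the variable is the letter
          \<open>Suc k\<close>; it fills the block from \<open>i\<close> to
          \<open>j - 1\<close>.\<close>
        define z where "z = map (sub k (t i j (Suc k))) y"
        have tlen: "length (t i j a) = r" for a using ij by (simp add: t_def)
        have tset: "set (t i j a) \<subseteq> {0, k, a}" for a by (auto simp: t_def)
        have nth: "t i j a ! p = (if p < i then k else if p < j then a else 0)" if "p < r" for p a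
          using that ij by (auto simp: t_def nth_append)
        have "z \<in> pw (Suc k) 1"
        proof (rule pw_1I)
          fix l assume "l \<in> set z"
          then obtain e where e: "e \<in> set y" "l = sub k (t i j (Suc k)) e" by (auto simp: z_def)
          show "l \<le> Suc k"
            using e pw_set[OF y(1) e(1)] nth[of "e - k" "Suc k"] by (auto simp: sub_def)
        next
          obtain a b where "y = a @ (k + i) # b" using pw_first[OF y(1), of i] ij by auto
          moreover have "sub k (t i j (Suc k)) (k + i) = Suc k" using nth ij by (simp add: sub_def)
          ultimately show "Suc k \<in> set z" by (force simp: z_def)
        qed
        moreover have zsub: "map (sub (Suc k) [a]) z = map (sub k (t i j a)) y" if "a < Suc k" for a
          unfolding z_def map_map
        proof (rule map_cong[OF refl])
          fix e assume e: "e \<in> set y"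
          show "(sub (Suc k) [a] \<circ> sub k (t i j (Suc k))) e = sub k (t i j a) e"
            using pw_set[OF y(1) e] nth[of "e - k"] by (auto simp: sub_def)
        qed
        have key: "c (map (sub (Suc k) [a]) z) = ?col i" if "a < Suc k" for a
        proof (cases "a = k")
          case True
          have "t i j k = t j j 0" using ij by (simp add: t_def flip: append_assoc replicate_add)
          then show ?thesis using zsub[OF that] True ij(3) by simp
        next
          case False
          then have "a < k" using that by simp
          have "t i i 0 = t i j 0" using ij by (simp add: t_def flip: replicate_add)
          moreover have "sim k (Suc k) (t i j a) (t i j 0)"
            using tlen nth \<open>a < k\<close> \<open>k \<noteq> 0\<close> by (auto simp: sim_def list_all2_conv_all_nth)
          ultimately show ?thesis using zsub[OF that] yc tlen by simp
        qed
        ultimately show "\<exists>z\<in>pw (Suc k) 1. length z = N \<and>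
         (\<forall>(a,b)\<in>{(map (sub (Suc k) [a]) z, map (sub (Suc k) [b]) z) |a b. a < Suc k \<and> b < Suc k}. c a = c b)"
          using y(2) by (intro bexI[of _ z]) (auto simp: z_def key)
      qed
    qed
  qed
qed

section \<open>The Graham-Rothschild theorem\<close>

definition homR :: "nat \<Rightarrow> nat \<Rightarrow> nat \<Rightarrow> nat list \<Rightarrow> (nat list \<times> nat list) set" where
  "homR k m n y = {(map (sub k u) y, map (sub k v) y) |u v.
      u \<in> pw k m \<and> v \<in> pw k m \<and> length u = n \<and> length v = n}"

definition GR :: "nat \<Rightarrow> nat \<Rightarrow> nat \<Rightarrow> bool" where
  "GR k m n \<longleftrightarrow> arr (pw k n) (homR k m n)"

text \<open>An intermediate goal: subwords need to agree in colour only if they coincide before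
  their first variable.\<close>

definition prefR :: "nat \<Rightarrow> nat \<Rightarrow> nat \<Rightarrow> nat list \<Rightarrow> (nat list \<times> nat list) set" where
  "prefR k m n y = {(map (sub k u) y, map (sub k v) y) |u v.
      u \<in> pw k m \<and> v \<in> pw k m \<and> length u = n \<and> length v = n \<and>
      takeWhile (\<lambda>l. l < k) u = takeWhile (\<lambda>l. l < k) v}"

text \<open>Reading the constant \<open>k\<close> as the first variable trades a constant for a
  variable. In this way a result for \<open>m\<close> variables over \<open>Suc k\<close> constants
  feeds the one for \<open>Suc m\<close> variables over \<open>k\<close>.\<close>

lemma Cons_pw:
  assumes "y \<in> pw (Suc k) m" shows "k # y \<in> pw k (Suc m)"
proof (rule pwI)
  fix i assume i: "i < Suc m"
  show "\<exists>a b. k # y = a @ (k + i) # b \<and> set a \<subseteq> {..<k + i}"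
  proof (cases i)
    case (Suc j)
    with i pw_first[OF assms, of j] obtain a b where "y = a @ (Suc k + j) # b" "set a \<subseteq> {..<Suc k + j}" by auto
    then show ?thesis unfolding Suc by (intro exI[of _ "k # a"] exI[of _ b]) auto
  qed (auto intro: exI[of _ "[]"])
qed (use pw_set[OF assms] in auto)

lemma pw_Cons_const:
  assumes "a # s \<in> pw k m" "a < k" shows "s \<in> pw k m"
proof (rule pwI)
  fix i assume "i < m"
  from pw_first[OF assms(1) this] obtain a' b where ab: "a # s = a' @ (k+i) # b" "set a' \<subseteq> {..<k+i}" by blast
  with assms(2) obtain a'' where "a' = a # a''" by (cases a') auto
  with ab show "\<exists>a b. s = a @ (k+i) # b \<and> set a \<subseteq> {..<k+i}" by auto
qed (use pw_set[OF assms(1)] in auto)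

lemma pw_Cons_var:
  assumes "a # s \<in> pw k (Suc m)" "\<not> a < k" shows "a = k" "s \<in> pw (Suc k) m"
proof -
  from pw_first[OF assms(1), of 0] obtain a' b where "a # s = a' @ k # b" "set a' \<subseteq> {..<k}" by auto
  then show [simp]: "a = k" using assms(2) by (cases a') auto
  show "s \<in> pw (Suc k) m"
  proof (rule pwI)
    fix i assume "i < m"
    with pw_first[OF assms(1), of "Suc i"] obtain a' b
      where ab: "a # s = a' @ (k+Suc i) # b" "set a' \<subseteq> {..<k+Suc i}" by auto
    then obtain a'' where "a' = a # a''" by (cases a') auto
    with ab show "\<exists>a b. s = a @ (Suc k+i) # b \<and> set a \<subseteq> {..<Suc k+i}" by auto
  qed (use pw_set[OF assms(1)] in auto)
qed

lemma sub_Cons_var: "sub k (k # t) = sub (Suc k) t"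
  by (auto simp: sub_def fun_eq_iff less_Suc_eq Suc_diff_Suc dest!: not_less_iff_gr_or_eq[THEN iffD1])

text \<open>A word of \<open>pw k (Suc m)\<close> is \<open>u @ k # t\<close> with \<open>u\<close> constant and \<open>t \<in> pw (Suc k) m\<close>; the dependence
  on \<open>t\<close> is removed one position of the first variable at a time.\<close>
lemma prefix_homogeneous:
  assumes GR: "\<And>n. GR (Suc k) m n"
  shows "arr (pw k n) (prefR k (Suc m) n)"
proof (induction n)
  case 0
  have "[] \<in> pw k 0" by (auto simp: pw_def)
  then show ?case unfolding arr_def prefR_def by fastforce
next
  case (Suc n)
  show ?case unfolding arr_def
  proof
    fix r :: nat
    \<comment> \<open>A subword begins either with a constant \<open>a < k\<close>, and the
      induction hypothesis applies with \<open>a\<close> recorded in the colour, or with its first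
      variable, and \<open>GR\<close> applies with \<open>k\<close> regarded as a constant.\<close>
    let ?C = "{..<k} \<rightarrow>\<^sub>E {..<r}"
    have "finite ?C" by (simp add: finite_PiE)
    from arr_finite_colours[OF Suc this] obtain M where
      M: "\<forall>c. (\<forall>w. c w \<in> ?C) \<longrightarrow> (\<exists>y\<in>pw k n. length y = M \<and> (\<forall>(a,b)\<in>prefR k (Suc m) n y. c a = c b))"
      ..
    from arrD[OF GR[of M, unfolded GR_def], of r] obtain N where
      N: "\<forall>c. (\<forall>w. c w < r) \<longrightarrow> (\<exists>y\<in>pw (Suc k) M. length y = N \<and>
        (\<forall>(a,b)\<in>homR (Suc k) m M y. c a = c b))"
      ..
    show "\<exists>N. \<forall>c. (\<forall>w. c w < r) \<longrightarrow>
      (\<exists>y\<in>pw k (Suc n). length y = N \<and> (\<forall>(a,b)\<in>prefR k (Suc m) (Suc n) y. c a = c b))"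
    proof (intro exI[of _ "Suc N"] allI impI)
      fix c :: "nat list \<Rightarrow> nat" assume c: "\<forall>w. c w < r"
      then have "\<forall>w. c (k # w) < r" by blast
      from N[THEN spec, THEN mp, OF this] obtain y where y: "y \<in> pw (Suc k) M" "length y = N" and
        yc: "\<And>u v. u \<in> pw (Suc k) m \<Longrightarrow> v \<in> pw (Suc k) m \<Longrightarrow> length u = M \<Longrightarrow> length v = M \<Longrightarrow>
           c (k # map (sub (Suc k) u) y) = c (k # map (sub (Suc k) v) y)"
        unfolding homR_def by blast
      let ?Y = "k # y"
      have "\<forall>s. (\<lambda>a\<in>{..<k}. c (map (sub k (a # s)) ?Y)) \<in> ?C" using c by auto
      from M[THEN spec, THEN mp, OF this] obtain w where w: "w \<in> pw k n" "length w = M" and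
        wc': "\<And>u v. u \<in> pw k (Suc m) \<Longrightarrow> v \<in> pw k (Suc m) \<Longrightarrow> length u = n \<Longrightarrow> length v = n \<Longrightarrow>
          takeWhile (\<lambda>l. l < k) u = takeWhile (\<lambda>l. l < k) v \<Longrightarrow>
          (\<lambda>a\<in>{..<k}. c (map (sub k (a # map (sub k u) w)) ?Y)) = (\<lambda>a\<in>{..<k}. c (map (sub k (a # map (sub k v) w)) ?Y))"
        unfolding prefR_def by blast
      have wc: "c (map (sub k (a # map (sub k u) w)) ?Y) = c (map (sub k (a # map (sub k v) w)) ?Y)"
        if "u \<in> pw k (Suc m)" "v \<in> pw k (Suc m)" "length u = n" "length v = n"
          "takeWhile (\<lambda>l. l < k) u = takeWhile (\<lambda>l. l < k) v" "a < k" for a u v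
        using fun_cong[OF wc'[OF that(1-5)], of a] that(6) by simp
      \<comment> \<open>The leading variable of \<open>?Y\<close> is kept apart and the others are
        merged along \<open>w\<close>, so \<open>?W\<close> inherits the homogeneity of both
        \<open>y\<close> and \<open>w\<close>.\<close>
      let ?w = "k # map (shift k) w"
      let ?W = "map (sub k ?w) ?Y"
      have Yp: "?Y \<in> pw k (Suc M)" using Cons_pw y(1) .
      have "[k] \<in> pw k 1" by (rule pw_1I) auto
      from append_shift_pw[OF this w(1)] have wp: "?w \<in> pw k (Suc n)" by simp
      have Wp: "?W \<in> pw k (Suc n)"
        by (rule subst_pw[OF Yp wp]) (use w in auto)
      have step: "map (sub k (a # s)) ?W = map (sub k (a # map (sub k s) w)) ?Y" for a s
      proof -
        have "map (sub k (a # s)) ?W = map (sub k (map (sub k (a # s)) ?w)) ?Y"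
          using pw_set[OF Yp] w(2) by (intro subst_subst) auto
        also have "map (sub k (a # s)) ?w = a # map (sub k s) w" by (auto simp: sub_def[of _ _ k])
        finally show ?thesis .
      qed
      have "c (map (sub k u) ?W) = c (map (sub k v) ?W)"
        if uv: "u \<in> pw k (Suc m)" "v \<in> pw k (Suc m)" "length u = Suc n" "length v = Suc n"
          "takeWhile (\<lambda>l. l < k) u = takeWhile (\<lambda>l. l < k) v" for u v
      proof -
        obtain a u' where u: "u = a # u'" using uv by (cases u) auto
        obtain b v' where v: "v = b # v'" using uv by (cases v) auto
        show ?thesis
        proof (cases "a < k")
          case True
          with uv u v have "b = a" "takeWhile (\<lambda>l. l < k) u' = takeWhile (\<lambda>l. l < k) v'"
            by (auto split: if_splits)
          moreover have "u' \<in> pw k (Suc m)" "v' \<in> pw k (Suc m)"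
            using pw_Cons_const[OF uv(1)[unfolded u] True] pw_Cons_const[of b v'] uv(2) v True calculation(1) by auto
          ultimately show ?thesis unfolding u v step \<open>b = a\<close> using True uv(3,4) u v by (intro wc) auto
        next
          case False
          with uv u v have "\<not> b < k" by (auto split: if_splits)
          note ab = pw_Cons_var[OF uv(1)[unfolded u] False] pw_Cons_var[OF uv(2)[unfolded v] \<open>\<not> b < k\<close>]
          have *: "c (map (sub k (k # map (sub k s) w)) ?Y) = c (k # map (sub (Suc k) (map (sub k s) w)) y)" for s
            by (simp only: list.map sub_Cons_var) (simp add: sub_def)
          show ?thesis unfolding u v step ab(1,3) *
            using ab(2,4) u v uv(3,4) w by (intro yc subst_pw[OF w(1)]) auto
        qed
      qed
      then have "\<forall>(a,b)\<in>prefR k (Suc m) (Suc n) ?W. c a = c b" by (auto simp: prefR_def)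
      then show "\<exists>y\<in>pw k (Suc n). length y = Suc N \<and> (\<forall>(a,b)\<in>prefR k (Suc m) (Suc n) y. c a = c b)"
        using Wp y(2) by (intro bexI[of _ ?W]) auto
    qed
  qed
qed

text \<open>Substituting such a word keeps the variables with index in \<open>I\<close> and puts the
  constant \<open>0\<close> for the others; it serves to discard positions of the wrong
  colour.\<close>

lemma select_word:
  assumes "0 < k"
  shows "I \<subseteq> {..<L} \<Longrightarrow> \<exists>q\<in>pw k (card I). length q = L \<and> (\<forall>p<L. p \<notin> I \<longrightarrow> q ! p = 0)"
proof (induction L arbitrary: I)
  case 0
  then show ?case by (auto simp: pw_def)
next
  case (Suc L)
  let ?I = "I - {L}"
  have "?I \<subseteq> {..<L}" using Suc.prems by (auto simp: less_Suc_eq)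
  from Suc.IH[OF this] obtain q where q: "q\<in>pw k (card ?I)" "length q = L" "\<forall>p<L. p \<notin> ?I \<longrightarrow> q ! p = 0" by blast
  have fin: "finite I" by (rule finite_subset[OF Suc.prems]) simp
  show ?case
  proof (cases "L \<in> I")
    case True
    then have card: "card I = Suc (card ?I)" by (rule card.remove[OF fin])
    have "q @ [k + card ?I] \<in> pw k (card I)" unfolding card
    proof (rule pwI)
      fix i assume i: "i < Suc (card ?I)"
      show "\<exists>a b. q @ [k + card ?I] = a @ (k + i) # b \<and> set a \<subseteq> {..<k + i}"
      proof (cases "i < card ?I")
        case True
        from pw_first[OF q(1) this] obtain a b where "q = a @ (k + i) # b" "set a \<subseteq> {..<k + i}" by blast
        then show ?thesis by (intro exI[of _ a] exI[of _ "b @ [k + card ?I]"]) simp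
      next
        case False
        then have "i = card ?I" using i by simp
        then show ?thesis using pw_set[OF q(1)] by (intro exI[of _ q] exI[of _ "[]"]) auto
      qed
    qed (use pw_set[OF q(1)] in fastforce)
    then show ?thesis using q True
      by (intro bexI[of _ "q @ [k + card ?I]"]) (auto simp: nth_append less_Suc_eq)
  next
    case False
    then have [simp]: "?I = I" by auto
    have "q @ [0] \<in> pw k (card I)"
    proof (rule pwI)
      fix i assume "i < card I"
      with pw_first[OF q(1), of i] obtain a b where "q = a @ (k + i) # b" "set a \<subseteq> {..<k + i}" by auto
      then show "\<exists>a b. q @ [0] = a @ (k + i) # b \<and> set a \<subseteq> {..<k + i}"
        by (intro exI[of _ a] exI[of _ "b @ [0]"]) simp
    qed (use pw_set[OF q(1)] \<open>0 < k\<close> in fastforce)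
    then show ?thesis using q False
      by (intro bexI[of _ "q @ [0]"]) (auto simp: nth_append less_Suc_eq)
  qed
qed

lemma takeWhile_append_Cons:
  "(\<And>x. x \<in> set a \<Longrightarrow> P x) \<Longrightarrow> \<not> P x \<Longrightarrow> takeWhile P (a @ x # b) = a"
  by (simp add: takeWhile_append2)

text \<open>The first variable of the composite appears where \<open>y\<close> first uses the
  variable whose index is the position of the first \<open>k\<close> in \<open>v\<close>. So the
  constant prefix of the composite depends on \<open>v\<close> only through the constant prefix of
  \<open>v\<close>, and these are the words that \<open>fusionR\<close> compares.\<close>

lemma takeWhile_subst:
  assumes y: "y \<in> pw k L" and v: "v \<in> pw k (Suc m)" "length v = L"
  defines "u \<equiv> takeWhile (\<lambda>l. l < k) v"
  shows "takeWhile (\<lambda>l. l < k) (map (sub k v) y) = map (sub k u) (takeWhile (\<lambda>l. l < k + length u) y)"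
    and "length u < L" "v ! length u = k"
proof -
  obtain b where b: "v = u @ k # b" "set u \<subseteq> {..<k}"
  proof -
    from pw_first[OF v(1), of 0] obtain a b where ab: "v = a @ k # b" "set a \<subseteq> {..<k}" by auto
    have "u = a" unfolding u_def ab(1) by (rule takeWhile_append_Cons) (use ab in auto)
    with ab show ?thesis using that by blast
  qed
  then show len: "length u < L" and "v ! length u = k" using v(2) by auto
  from pw_first[OF y len] obtain \<alpha> \<beta> where
    \<alpha>: "y = \<alpha> @ (k + length u) # \<beta>" "set \<alpha> \<subseteq> {..<k + length u}" by blast
  have 1: "takeWhile (\<lambda>l. l < k + length u) y = \<alpha>" unfolding \<alpha>(1) by (rule takeWhile_append_Cons) (use \<alpha> in auto)
  have *: "sub k v l = sub k u l" "sub k u l < k" if "l \<in> set \<alpha>" for l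
  proof -
    from that \<alpha> have "l < k + length u" by auto
    then show "sub k v l = sub k u l" by (auto simp: sub_def b(1) nth_append)
    show "sub k u l < k"
    proof (cases "l < k")
      case False
      with \<open>l < k + length u\<close> have "u ! (l - k) \<in> set u" by (intro nth_mem) auto
      with b False show ?thesis by (auto simp: sub_def)
    qed (simp add: sub_def)
  qed
  have v_len: "sub k v (k + length u) = k" by (simp add: sub_def b(1))
  have "takeWhile (\<lambda>l. l < k) (map (sub k v) y) = map (sub k v) \<alpha>"
    unfolding \<alpha>(1) map_append list.map
    by (rule takeWhile_append_Cons) (use * v_len in auto)
  also have "\<dots> = map (sub k u) \<alpha>" using * by simp
  finally show "takeWhile (\<lambda>l. l < k) (map (sub k v) y) = map (sub k u) (takeWhile (\<lambda>l. l < k + length u) y)"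
    by (simp add: 1)
qed

lemma pigeonhole_many:
  fixes f :: "nat \<Rightarrow> nat"
  assumes "\<And>p. f p < r"
  shows "\<exists>I\<subseteq>{..<n*r}. card I = n \<and> (\<exists>col. \<forall>p\<in>I. f p = col)"
proof (cases "n = 0")
  case False
  have "\<exists>col<r. n \<le> card {p\<in>{..<n*r}. f p = col}"
  proof (rule ccontr)
    assume "\<not> ?thesis"
    then have less: "card {p\<in>{..<n*r}. f p = col} \<le> n - 1" if "col < r" for col using that by force
    have "n * r = card (\<Union>col<r. {p\<in>{..<n*r}. f p = col})"
      using assms by (subst card_lessThan[of "n*r", symmetric], intro arg_cong[of _ _ card]) auto
    also have "\<dots> \<le> (\<Sum>col<r. card {p\<in>{..<n*r}. f p = col})" by (rule card_UN_le) simp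
    also have "\<dots> \<le> (\<Sum>col<r. n - 1)" using less by (intro sum_mono) auto
    also have "\<dots> = r * (n - 1)" by simp
    finally have "n * r \<le> (n - 1) * r" by (simp add: mult.commute)
    moreover have "0 < r" using assms[of 0] by simp
    ultimately show False using False by (simp add: not_less)
  qed
  then obtain col where "n \<le> card {p\<in>{..<n*r}. f p = col}" by blast
  then obtain I where "I \<subseteq> {p\<in>{..<n*r}. f p = col}" "card I = n" by (meson obtain_subset_with_card_n)
  then show ?thesis by (intro exI[of _ I] conjI exI[of _ col]) auto
qed (intro exI[of _ "{}"], auto)

text \<open>In the step the colour is first made a function of the constant prefix, then of the
  length of that prefix alone, since constants are interchangeable after fusion. Finally a
  pigeonhole argument keeps \<open>n\<close> positions of one colour. For \<open>m = 0\<close> all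
  words in question are similar and fusion suffices.\<close>

theorem Graham_Rothschild: "0 < k \<Longrightarrow> GR k m n"
proof (induction m arbitrary: k n)
  case (0 k n)
  show ?case unfolding GR_def arr_def
  proof
    fix r :: nat
    from arrD[OF fusion[OF Hales_Jewett order_refl, of k n], of r] obtain N where
      N: "\<forall>c. (\<forall>w. c w < r) \<longrightarrow> (\<exists>y\<in>pw k n. length y = N \<and> (\<forall>(a,b)\<in>fusionR k k n y. c a = c b))"
      ..
    show "\<exists>N. \<forall>c. (\<forall>w. c w < r) \<longrightarrow> (\<exists>y\<in>pw k n. length y = N \<and>
      (\<forall>(a,b)\<in>homR k 0 n y. c a = c b))"
    proof (intro exI[of _ N] allI impI)
      fix c :: "nat list \<Rightarrow> nat" assume "\<forall>w. c w < r"
      from N[THEN spec, THEN mp, OF this] obtain y where y: "y \<in> pw k n" "length y = N" and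
        yc: "\<forall>(a,b)\<in>fusionR k k n y. c a = c b" by blast
      have "c (map (sub k u) y) = c (map (sub k v) y)"
        if "u \<in> pw k 0" "v \<in> pw k 0" "length u = n" "length v = n" for u v
      proof -
        have "u ! i < k" "v ! i < k" if "i < n" for i
          using pw_set[OF \<open>u \<in> pw k 0\<close>, of "u ! i"] pw_set[OF \<open>v \<in> pw k 0\<close>, of "v ! i"] that
            \<open>length u = n\<close> \<open>length v = n\<close> by auto
        then have "sim k k u v" using that by (simp add: sim_def list_all2_conv_all_nth)
        with fusionR_full[OF y(1)] that yc show ?thesis by blast
      qed
      then show "\<exists>y\<in>pw k n. length y = N \<and> (\<forall>(a,b)\<in>homR k 0 n y. c a = c b)"
        using y by (intro bexI[of _ y]) (auto simp: homR_def)
    qed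
  qed
next
  case (Suc m k n)
  show ?case unfolding GR_def arr_def
  proof
    fix r :: nat
    \<comment> \<open>Among so many positions, \<open>n\<close> have the same of \<open>r\<close>
      colours.\<close>
    let ?L = "n * r"
    from arrD[OF fusion[OF Hales_Jewett order_refl, of k ?L], of r] obtain M where
      M: "\<forall>c. (\<forall>w. c w < r) \<longrightarrow> (\<exists>y\<in>pw k ?L. length y = M \<and> (\<forall>(a,b)\<in>fusionR k k ?L y. c a = c b))"
      ..
    from arrD[OF prefix_homogeneous[OF Suc.IH[OF zero_less_Suc], of k M], of r] obtain N where
      N: "\<forall>c. (\<forall>w. c w < r) \<longrightarrow> (\<exists>y\<in>pw k M. length y = N \<and> (\<forall>(a,b)\<in>prefR k (Suc m) M y. c a = c b))"
      ..
    show "\<exists>N. \<forall>c. (\<forall>w. c w < r) \<longrightarrow> (\<exists>y\<in>pw k n. length y = N \<and>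
      (\<forall>(a,b)\<in>homR k (Suc m) n y. c a = c b))"
    proof (intro exI[of _ N] allI impI)
      fix c :: "nat list \<Rightarrow> nat" assume c: "\<forall>w. c w < r"
      from N[THEN spec, THEN mp, OF this] obtain w where w: "w \<in> pw k M" "length w = N" and
        wc: "\<And>s t. s \<in> pw k (Suc m) \<Longrightarrow> t \<in> pw k (Suc m) \<Longrightarrow> length s = M \<Longrightarrow> length t = M \<Longrightarrow>
          takeWhile (\<lambda>l. l < k) s = takeWhile (\<lambda>l. l < k) t \<Longrightarrow> c (map (sub k s) w) = c (map (sub k t) w)"
        unfolding prefR_def by blast
      \<comment> \<open>By \<open>wc\<close> the colour is the same for all completions of a
        constant prefix, so an arbitrary completion defines \<open>c'\<close>.\<close>
      define c' where "c' = (\<lambda>u. c (map (sub k (SOME s. s \<in> pw k (Suc m) \<and> length s = M \<and> takeWhile (\<lambda>l. l < k) s = u)) w))"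
      have c': "c (map (sub k s) w) = c' (takeWhile (\<lambda>l. l < k) s)" if "s \<in> pw k (Suc m)" "length s = M" for s
      proof -
        have "\<exists>t. t \<in> pw k (Suc m) \<and> length t = M \<and> takeWhile (\<lambda>l. l < k) t = takeWhile (\<lambda>l. l < k) s"
          using that by blast
        from someI_ex[OF this] show ?thesis unfolding c'_def using that by (intro wc) auto
      qed
      have c'r: "c' u < r" for u using c by (auto simp: c'_def)
      then obtain y where y: "y \<in> pw k ?L" "length y = M" and
        yc': "\<forall>(a,b)\<in>fusionR k k ?L y. c' a = c' b" using M[THEN spec, THEN mp, of c'] by blast
      have yc: "c' (map (sub k u) (takeWhile (\<lambda>l. l < k + length u) y)) =
        c' (map (sub k v) (takeWhile (\<lambda>l. l < k + length v) y))"
        if "length u \<le> ?L" "sim k k u v" for u v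
        using yc' that by (auto simp: fusionR_def)
      define col where "col p = c' (map (sub k (replicate p 0)) (takeWhile (\<lambda>l. l < k + p) y))" for p
      have "\<exists>I\<subseteq>{..<n*r}. card I = n \<and> (\<exists>d. \<forall>p\<in>I. col p = d)"
        using c'r by (intro pigeonhole_many) (auto simp: col_def)
      then obtain I d where I: "I \<subseteq> {..<?L}" "card I = n" "\<forall>p\<in>I. col p = d" by blast
      from select_word[OF Suc.prems I(1)] obtain q where
        q: "q \<in> pw k n" "length q = ?L" "\<forall>p<?L. p \<notin> I \<longrightarrow> q ! p = 0" unfolding I(2) by blast
      let ?y = "map (sub k q) y"
      let ?W = "map (sub k ?y) w"
      have yp: "?y \<in> pw k n" by (rule subst_pw[OF y(1) q(1) order_refl q(2)])
      have Wp: "?W \<in> pw k n" by (rule subst_pw[OF w(1) yp]) (simp_all add: y)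
      have "c (map (sub k s) ?W) = d" if s: "s \<in> pw k (Suc m)" "length s = n" for s
      proof -
        let ?v = "map (sub k s) q"
        have vp: "?v \<in> pw k (Suc m)" by (rule subst_pw[OF q(1) s(1) order_refl s(2)])
        have vl: "length ?v = ?L" by (simp add: q)
        define u where "u = takeWhile (\<lambda>l. l < k) ?v"
        note u = takeWhile_subst[OF y(1) vp vl, folded u_def]
        have "map (sub k s) ?W = map (sub k (map (sub k s) ?y)) w"
          using pw_set[OF w(1)] y(2) by (intro subst_subst) auto
        moreover have "map (sub k s) ?y = map (sub k ?v) y"
          using pw_set[OF y(1)] q(2) by (intro subst_subst) auto
        ultimately have "c (map (sub k s) ?W) = c (map (sub k (map (sub k ?v) y)) w)" by (simp only:)
        also have "\<dots> = c' (takeWhile (\<lambda>l. l < k) (map (sub k ?v) y))"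
          by (rule c'[OF subst_pw[OF y(1) vp order_refl vl]]) (simp add: y)
        also have "\<dots> = c' (map (sub k u) (takeWhile (\<lambda>l. l < k + length u) y))" using u by simp
        also have "\<dots> = col (length u)"
        proof -
          have "x < k" if "x \<in> set u" for x using set_takeWhileD[OF that[unfolded u_def]] by simp
          then have "sim k k u (replicate (length u) 0)"
            using Suc.prems by (auto simp: sim_def list_all2_conv_all_nth)
          from yc[OF _ this] u show ?thesis by (simp add: col_def)
        qed
        \<comment> \<open>At the other positions \<open>q\<close> has the constant \<open>0\<close>,
          so a first variable cannot sit there.\<close>
        also have "length u \<in> I"
        proof (rule ccontr)
          assume "length u \<notin> I"
          then have "q ! length u = 0" using q(3) u(2) by blast
          then have "?v ! length u = 0" using u(2) q(2) Suc.prems by (simp add: sub_def)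
          then show False using u(3) Suc.prems by simp
        qed
        then have "col (length u) = d" using I(3) by blast
        finally show ?thesis .
      qed
      then show "\<exists>y\<in>pw k n. length y = N \<and> (\<forall>(a,b)\<in>homR k (Suc m) n y. c a = c b)"
        using Wp w(2) by (intro bexI[of _ ?W]) (auto simp: homR_def)
    qed
  qed
qed

section \<open>Orders of first occurrence and rigid surjections\<close>

definition first_occ :: "'a list \<Rightarrow> 'a list" where
  "first_occ a = rev (remdups (rev a))"

lemma first_occ_Nil [simp]: "first_occ [] = []"
  by (simp add: first_occ_def)

lemma first_occ_snoc: "first_occ (a @ [x]) = (if x \<in> set a then first_occ a else first_occ a @ [x])"
  by (simp add: first_occ_def)

lemma set_first_occ [simp]: "set (first_occ a) = set a"
  by (simp add: first_occ_def)

lemma distinct_first_occ [simp]: "distinct (first_occ a)"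
  by (simp add: first_occ_def)

lemma length_first_occ: "length (first_occ a) = card (set a)"
  by (metis distinct_card distinct_first_occ set_first_occ)

text \<open>Words with the same order of first occurrence keep this property under any renaming of
  letters. Therefore one order controls the words of \<open>h \<phi>\<close> for all
  \<open>\<phi>\<close> at once.\<close>

lemma first_occ_map: "first_occ (map f a) = first_occ (map f (first_occ a))"
  by (induction a rule: rev_induct) (auto simp: first_occ_snoc)

text \<open>A word is a rigid surjection followed by the enumeration of its letters in order of
  first occurrence. The Ramsey theorem absorbs the rigid factor, and only the enumeration remains
  visible.\<close>

lemma rigid_word:
  "\<exists>v\<in>pw 0 (length (first_occ a)). length v = length a \<and> a = map ((!) (first_occ a)) v"
proof (induction a rule: rev_induct)
  case Nil
  then show ?case by (auto simp: pw_def)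
next
  case (snoc x a)
  let ?f = "first_occ a"
  from snoc obtain v where v: "v \<in> pw 0 (length ?f)" "length v = length a" "a = map ((!) ?f) v" by blast
  show ?case
  proof (cases "x \<in> set a")
    case True
    then have "x \<in> set ?f" by simp
    then obtain j where j: "j < length ?f" "?f ! j = x" unfolding in_set_conv_nth by blast
    have "v @ [j] \<in> pw 0 (length ?f)"
    proof (rule pwI)
      fix i assume "i < length ?f"
      from pw_first[OF v(1) this] obtain b c where "v = b @ (0 + i) # c" "set b \<subseteq> {..<0+i}" by blast
      then show "\<exists>b c. v @ [j] = b @ (0 + i) # c \<and> set b \<subseteq> {..<0+i}"
        by (intro exI[of _ b] exI[of _ "c @ [j]"]) simp
    qed (use pw_set[OF v(1)] j in auto)
    then show ?thesis using v j True by (intro bexI[of _ "v @ [j]"]) (auto simp: first_occ_snoc)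
  next
    case False
    let ?j = "length ?f"
    have "v @ [?j] \<in> pw 0 (Suc ?j)"
    proof (rule pwI)
      fix i assume i: "i < Suc ?j"
      show "\<exists>b c. v @ [?j] = b @ (0 + i) # c \<and> set b \<subseteq> {..<0+i}"
      proof (cases "i < ?j")
        case True
        from pw_first[OF v(1) this] obtain b c where "v = b @ (0 + i) # c" "set b \<subseteq> {..<0+i}" by blast
        then show ?thesis by (intro exI[of _ b] exI[of _ "c @ [?j]"]) simp
      next
        case False
        then have "i = ?j" using i by simp
        then show ?thesis using pw_set[OF v(1)] by (intro exI[of _ v] exI[of _ "[]"]) auto
      qed
    qed (use pw_set[OF v(1)] in \<open>auto simp: less_Suc_eq\<close>)
    moreover have "a = map (\<lambda>i. (?f @ [x]) ! i) v"
      using pw_set[OF v(1)] by (subst (1) v(3)) (auto simp: nth_append)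
    ultimately show ?thesis using v(2) False
      by (intro bexI[of _ "v @ [?j]"]) (auto simp: first_occ_snoc nth_append)
  qed
qed

text \<open>Graham-Rothschild asks for at least one constant. A nonempty rigid surjection begins
  with \<open>0\<close>, and behind this first letter \<open>0\<close> acts as a constant: the words
  of \<open>pw 0 (Suc m)\<close> are \<open>0 # u\<close> with \<open>u\<close> in
  \<open>pw 1 m\<close>.\<close>

lemma dual_Ramsey_rigid:
  "arr (pw 0 n) (homR 0 m n)"
proof (cases "m = 0 \<or> n = 0")
  case True
  have triv: "u = v" if "u \<in> pw 0 m" "v \<in> pw 0 m" "length u = n" "length v = n" for u v
  proof -
    have "u = []" "v = []" using that True by (auto simp: pw_def)
    then show ?thesis by simp
  qed
  have "[0..<n] \<in> pw 0 n"
  proof (rule pwI)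
    fix i assume "i < n"
    then have "[0..<n] = [0..<i] @ i # [Suc i..<n]"
      using upt_add_eq_append[of 0 i "n - i"] upt_conv_Cons[of i n] by simp
    then show "\<exists>a b. [0..<n] = a @ (0 + i) # b \<and> set a \<subseteq> {..<0+i}" by force
  qed auto
  moreover have "c (map (sub 0 u) y) = c (map (sub 0 v) y)"
    if "u \<in> pw 0 m" "v \<in> pw 0 m" "length u = n" "length v = n" for c :: "nat list \<Rightarrow> nat" and u v y
    using triv[OF that] by simp
  ultimately show ?thesis unfolding arr_def
    by (intro allI exI[of _ n] impI bexI[of _ "[0..<n]"]) (auto simp: homR_def)
next
  case False
  then obtain m' n' where m: "m = Suc m'" and n: "n = Suc n'" by (metis not0_implies_Suc)
  show ?thesis unfolding arr_def
  proof
    fix r :: nat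
    from arrD[OF Graham_Rothschild[OF zero_less_one, of m' n', unfolded GR_def], of r] obtain N where
      N: "\<forall>c. (\<forall>w. c w < r) \<longrightarrow> (\<exists>y\<in>pw 1 n'. length y = N \<and>
        (\<forall>(a,b)\<in>homR 1 m' n' y. c a = c b))" ..
    show "\<exists>N. \<forall>c. (\<forall>w. c w < r) \<longrightarrow> (\<exists>y\<in>pw 0 n. length y = N \<and>
        (\<forall>(a,b)\<in>homR 0 m n y. c a = c b))"
    proof (intro exI[of _ "Suc N"] allI impI)
      fix c :: "nat list \<Rightarrow> nat" assume "\<forall>w. c w < r"
      then have "\<forall>w. c (0 # w) < r" by blast
      from N[THEN spec, THEN mp, OF this] obtain y where y: "y \<in> pw 1 n'" "length y = N" and
        yc: "\<And>u v. u \<in> pw 1 m' \<Longrightarrow> v \<in> pw 1 m' \<Longrightarrow> length u = n' \<Longrightarrow> length v = n' \<Longrightarrow>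
           c (0 # map (sub 1 u) y) = c (0 # map (sub 1 v) y)"
        unfolding homR_def by blast
      have yp: "0 # y \<in> pw 0 n" unfolding n by (rule Cons_pw) (use y in simp)
      have "\<exists>u'\<in>pw 1 m'. length u' = n' \<and> map (sub 0 u) (0 # y) = 0 # map (sub 1 u') y"
        if u: "u \<in> pw 0 m" "length u = n" for u
      proof -
        obtain a u' where [simp]: "u = a # u'" using u n by (cases u) auto
        have "a = 0" "u' \<in> pw 1 m'" using pw_Cons_var[of a u' 0 m'] u m by auto
        moreover have "sub 0 (0 # u') = sub 1 u'" by (simp add: sub_Cons_var)
        ultimately show ?thesis using u n by (intro bexI[of _ u']) (auto simp: sub_def)
      qed
      then have "c (map (sub 0 u) (0 # y)) = c (map (sub 0 v) (0 # y))"
        if "u \<in> pw 0 m" "v \<in> pw 0 m" "length u = n" "length v = n" for u v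
        using that yc by metis
      then show "\<exists>y\<in>pw 0 n. length y = Suc N \<and> (\<forall>(a,b)\<in>homR 0 m n y. c a = c b)"
        using yp y(2) by (intro bexI[of _ "0 # y"]) (auto simp: homR_def)
    qed
  qed
qed

text \<open>A rigid word \<open>v\<close> is coloured by the whole function taking a list
  \<open>\<tau>\<close> to the colour of \<open>\<tau>\<close> composed with \<open>v\<close>; one
  homogeneous word then serves all orders of first occurrence.\<close>

theorem dual_Ramsey:
  assumes A: "finite A" and C: "finite C"
  shows "\<exists>N. \<forall>\<Gamma> :: 'a list \<Rightarrow> 'c. (\<forall>w. \<Gamma> w \<in> C) \<longrightarrow>
    (\<exists>w. length w = N \<and> set w = {..<n} \<and>
      (\<forall>a b. length a = n \<and> length b = n \<and> set a = A \<and> set b = A \<and> first_occ a = first_occ b \<longrightarrow>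
        \<Gamma> (map ((!) a) w) = \<Gamma> (map ((!) b) w)))"
proof -
  let ?T = "{\<tau>. set \<tau> \<subseteq> A \<and> length \<tau> = card A}"
  let ?C = "?T \<rightarrow>\<^sub>E C"
  have "finite ?C" using A C by (intro finite_PiE finite_lists_length_eq) auto
  from arr_finite_colours[OF dual_Ramsey_rigid[of n "card A"] this] obtain N where
    N: "\<forall>c. (\<forall>w. c w \<in> ?C) \<longrightarrow> (\<exists>y\<in>pw 0 n. length y = N \<and>
      (\<forall>(a,b)\<in>homR 0 (card A) n y. c a = c b))" ..
  show ?thesis
  proof (intro exI[of _ N] allI impI)
    fix \<Gamma> :: "'a list \<Rightarrow> 'c" assume "\<forall>w. \<Gamma> w \<in> C"
    then have "\<forall>v. (\<lambda>\<tau>\<in>?T. \<Gamma> (map ((!) \<tau>) v)) \<in> ?C" by auto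
    from N[THEN spec, THEN mp, OF this] obtain w where w: "w \<in> pw 0 n" "length w = N" and
      wc: "\<And>u v. u \<in> pw 0 (card A) \<Longrightarrow> v \<in> pw 0 (card A) \<Longrightarrow> length u = n \<Longrightarrow> length v = n \<Longrightarrow>
        (\<lambda>\<tau>\<in>?T. \<Gamma> (map ((!) \<tau>) (map (sub 0 u) w))) = (\<lambda>\<tau>\<in>?T. \<Gamma> (map ((!) \<tau>) (map (sub 0 v) w)))"
      unfolding homR_def by blast
    have "set w = {..<n}"
    proof
      show "{..<n} \<subseteq> set w" using pw_first[OF w(1)] by fastforce
    qed (use pw_set[OF w(1)] in auto)
    moreover have "\<Gamma> (map ((!) a) w) = \<Gamma> (map ((!) b) w)"
      if ab: "length a = n" "length b = n" "set a = A" "set b = A" "first_occ a = first_occ b" for a b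
    proof -
      let ?f = "first_occ a"
      have f: "?f \<in> ?T" using ab by (simp add: length_first_occ)
      obtain u where u: "u \<in> pw 0 (card A)" "length u = n" "a = map ((!) ?f) u"
        using rigid_word[of a] ab by (auto simp: length_first_occ)
      obtain v where v: "v \<in> pw 0 (card A)" "length v = n" "b = map ((!) ?f) v"
        using rigid_word[of b] ab by (auto simp: length_first_occ)
      have *: "map ((!) d) w = map ((!) ?f) (map (sub 0 s) w)"
        if "length s = n" "d = map ((!) ?f) s" for d s
        using that pw_set[OF w(1)] by (auto simp: sub_def)
      show ?thesis
        using fun_cong[OF wc[OF u(1) v(1) u(2) v(2)], of ?f]
        unfolding *[OF u(2,3)] *[OF v(2,3)] restrict_apply'[OF f] .
    qed
    ultimately show "\<exists>w. length w = N \<and> set w = {..<n} \<and>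
      (\<forall>a b. length a = n \<and> length b = n \<and> set a = A \<and> set b = A \<and> first_occ a = first_occ b \<longrightarrow>
        \<Gamma> (map ((!) a) w) = \<Gamma> (map ((!) b) w))"
      using w(2) by blast
  qed
qed

section \<open>Coefficients of minimal flows\<close>

lemma compact_space_INT_nonempty:
  assumes X: "compact_space X" and cl: "\<And>i. i \<in> I \<Longrightarrow> closedin X (K i)"
    and fin: "\<And>D. finite D \<Longrightarrow> D \<subseteq> I \<Longrightarrow> D \<noteq> {} \<Longrightarrow> \<Inter>(K ` D) \<noteq> {}"
  shows "\<Inter>(K ` I) \<noteq> {}"
proof -
  have "\<Inter>\<F> \<noteq> {}" if sub: "finite \<F>" "\<F> \<subseteq> K ` I" for \<F>
  proof (cases "\<F> = {}")
    case False
    obtain D where D: "D \<subseteq> I" "finite D" "\<F> = K ` D"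
      using finite_subset_image[OF sub] by blast
    with False have "D \<noteq> {}" by blast
    from fin[OF D(2,1) this] show ?thesis unfolding D(3) .
  qed auto
  moreover have "\<forall>C\<in>K ` I. closedin X C" using cl by blast
  ultimately show ?thesis using X[unfolded compact_space_fip, THEN spec, of "K ` I"] by blast
qed

text \<open>The \<open>U s\<close> form a neighbourhood basis of open subgroups, so left uniform
  continuity means being almost invariant under right multiplication by some \<open>U s\<close>.
  Axiom \<open>U_conj\<close> keeps right translates uniformly continuous.\<close>

locale nonarch_group =
  fixes G :: "('a \<Rightarrow> 'a) set" and T :: "('a \<Rightarrow> 'a) topology" and U :: "nat \<Rightarrow> ('a \<Rightarrow> 'a) set"
  assumes id_G [simp]: "id \<in> G"
    and comp_G [simp]: "g \<in> G \<Longrightarrow> h \<in> G \<Longrightarrow> g \<circ> h \<in> G"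
    and inv_G [simp]: "g \<in> G \<Longrightarrow> inv g \<in> G"
    and bij_G: "g \<in> G \<Longrightarrow> bij g"
    and U_sub: "U s \<subseteq> G"
    and U_open: "openin T (U s)"
    and U_id: "id \<in> U s"
    and U_comp: "g \<in> U s \<Longrightarrow> h \<in> U s \<Longrightarrow> g \<circ> h \<in> U s"
    and U_inv: "g \<in> U s \<Longrightarrow> inv g \<in> U s"
    and U_basis: "openin T W \<Longrightarrow> id \<in> W \<Longrightarrow> \<exists>s. U s \<subseteq> W"
    and U_conj: "g \<in> G \<Longrightarrow> \<exists>t. \<forall>u\<in>U t. inv g \<circ> u \<circ> g \<in> U s"
begin

lemma U_G: "u \<in> U s \<Longrightarrow> u \<in> G"
  using U_sub by blast

lemma comp_U: "g \<in> G \<Longrightarrow> u \<in> U s \<Longrightarrow> g \<circ> u \<in> G"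
  using U_G by simp

abbreviation L where "L \<equiv> LUC G (\<circ>) inv id T"

definition cst :: "real \<Rightarrow> ('a \<Rightarrow> 'a) \<Rightarrow> real" where
  "cst c g = (if g \<in> G then c else 0)"

definition rtrans :: "('a \<Rightarrow> 'a) \<Rightarrow> (('a \<Rightarrow> 'a) \<Rightarrow> real) \<Rightarrow> ('a \<Rightarrow> 'a) \<Rightarrow> real" where
  "rtrans g f = (\<lambda>y. if y \<in> G then f (y \<circ> g) else 0)"

lemma comp_inv [simp]: "g \<in> G \<Longrightarrow> g \<circ> inv g = id" "g \<in> G \<Longrightarrow> inv g \<circ> g = id"
  using bij_G by (simp_all add: bij_is_surj bij_is_inj surj_iff[symmetric] inj_iff[symmetric])

lemma inv_comp: "g \<in> G \<Longrightarrow> h \<in> G \<Longrightarrow> inv (g \<circ> h) = inv h \<circ> inv g"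
  using bij_G by (simp add: o_inv_distrib)

lemma cancel [simp]: "g \<in> G \<Longrightarrow> inv g \<circ> (g \<circ> h) = h" "g \<in> G \<Longrightarrow> g \<circ> (inv g \<circ> h) = h"
  by (simp_all flip: comp_assoc)

lemma LUC_iff:
  "f \<in> L \<longleftrightarrow> (\<forall>x. x \<notin> G \<longrightarrow> f x = 0) \<and> (\<exists>B. \<forall>x\<in>G. \<bar>f x\<bar> \<le> B) \<and>
     (\<forall>\<epsilon>>0. \<exists>s. \<forall>g\<in>G. \<forall>u\<in>U s. \<bar>f g - f (g \<circ> u)\<bar> < \<epsilon>)"
proof -
  have "(\<exists>W. openin T W \<and> id \<in> W \<and> (\<forall>g\<in>G. \<forall>h\<in>G. inv g \<circ> h \<in> W \<longrightarrow> \<bar>f g - f h\<bar> < \<epsilon>)) \<longleftrightarrow>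
    (\<exists>s. \<forall>g\<in>G. \<forall>u\<in>U s. \<bar>f g - f (g \<circ> u)\<bar> < \<epsilon>)" (is "?l \<longleftrightarrow> ?r") for \<epsilon>
  proof
    assume ?l
    then obtain W where W: "openin T W" "id \<in> W" "\<forall>g\<in>G. \<forall>h\<in>G. inv g \<circ> h \<in> W \<longrightarrow> \<bar>f g - f h\<bar> < \<epsilon>" by blast
    from U_basis[OF W(1,2)] obtain s where s: "U s \<subseteq> W" by blast
    have "\<bar>f g - f (g \<circ> u)\<bar> < \<epsilon>" if "g \<in> G" "u \<in> U s" for g u
    proof -
      have "g \<circ> u \<in> G" "inv g \<circ> (g \<circ> u) \<in> W" using that s comp_U by auto
      then show ?thesis using W(3) that by blast
    qed
    then show ?r by blast
  next
    assume ?r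
    then obtain s where s: "\<forall>g\<in>G. \<forall>u\<in>U s. \<bar>f g - f (g \<circ> u)\<bar> < \<epsilon>" by blast
    have "\<bar>f g - f h\<bar> < \<epsilon>" if "g \<in> G" "h \<in> G" "inv g \<circ> h \<in> U s" for g h
      using s[rule_format, OF that(1,3)] that by simp
    then show ?l using U_open U_id by blast
  qed
  then show ?thesis unfolding LUC_def by simp
qed

lemma LUC_outside: "f \<in> L \<Longrightarrow> x \<notin> G \<Longrightarrow> f x = 0"
  by (simp add: LUC_iff)

lemma LUC_bound: "f \<in> L \<Longrightarrow> \<exists>B. \<forall>x. \<bar>f x\<bar> \<le> B"
proof -
  assume f: "f \<in> L"
  then obtain B where "\<forall>x\<in>G. \<bar>f x\<bar> \<le> B" by (auto simp: LUC_iff)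
  then have "\<bar>f x\<bar> \<le> max B 0" for x using LUC_outside[OF f, of x] by (cases "x \<in> G") (auto simp: max_def)
  then show ?thesis by blast
qed

lemma LUC_unif: "f \<in> L \<Longrightarrow> \<epsilon> > 0 \<Longrightarrow> \<exists>s. \<forall>g\<in>G. \<forall>u\<in>U s. \<bar>f g - f (g \<circ> u)\<bar> < \<epsilon>"
  by (simp add: LUC_iff)

text \<open>The values of \<open>f\<close> stay in a compact interval, where \<open>\<phi>\<close>
  is uniformly continuous. The instances needed are squares, square roots and multiples.\<close>

lemma LUC_compose:
  assumes f: "f \<in> L" and \<phi>: "continuous_on UNIV \<phi>"
  shows "(\<lambda>x. if x \<in> G then \<phi> (f x) else 0) \<in> L"
  unfolding LUC_iff
proof (intro conjI allI impI)
  obtain B where B: "\<And>x. \<bar>f x\<bar> \<le> B" using LUC_bound[OF f] by blast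
  have fB: "f x \<in> {-B..B}" for x using B[of x] by (simp add: abs_le_iff)
  have cont: "continuous_on {-B..B} \<phi>" using \<phi> continuous_on_subset by blast
  then have "compact (\<phi> ` {-B..B})" by (rule compact_continuous_image) simp
  then obtain C where "\<forall>y\<in>\<phi> ` {-B..B}. \<bar>y\<bar> \<le> C"
    using compact_imp_bounded bounded_real by blast
  then show "\<exists>B. \<forall>x\<in>G. \<bar>if x \<in> G then \<phi> (f x) else 0\<bar> \<le> B" using fB by (intro exI[of _ C]) auto
  fix \<epsilon> :: real assume "\<epsilon> > 0"
  moreover have "uniformly_continuous_on {-B..B} \<phi>" using cont by (rule compact_uniformly_continuous) simp
  ultimately obtain d where d: "d > 0" "\<forall>x\<in>{-B..B}. \<forall>x'\<in>{-B..B}. dist x' x < d \<longrightarrow> dist (\<phi> x') (\<phi> x) < \<epsilon>"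
    unfolding uniformly_continuous_on_def by meson
  from LUC_unif[OF f d(1)] obtain s where s: "\<forall>g\<in>G. \<forall>u\<in>U s. \<bar>f g - f (g \<circ> u)\<bar> < d" by blast
  show "\<exists>s. \<forall>g\<in>G. \<forall>u\<in>U s. \<bar>(if g \<in> G then \<phi> (f g) else 0) - (if g \<circ> u \<in> G then \<phi> (f (g \<circ> u)) else 0)\<bar> < \<epsilon>"
  proof (intro exI[of _ s] ballI)
    fix g u assume gu: "g \<in> G" "u \<in> U s"
    then have "g \<circ> u \<in> G" by (rule comp_U)
    moreover have "dist (\<phi> (f g)) (\<phi> (f (g \<circ> u))) < \<epsilon>"
      using d(2)[rule_format, OF fB fB, of g "g \<circ> u"] s gu by (auto simp: dist_real_def)
    ultimately show "\<bar>(if g \<in> G then \<phi> (f g) else 0) - (if g \<circ> u \<in> G then \<phi> (f (g \<circ> u)) else 0)\<bar> < \<epsilon>"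
      using gu by (simp add: dist_real_def)
  qed
qed simp

lemma LUC_add:
  assumes f: "f \<in> L" and h: "h \<in> L"
  shows "(\<lambda>x. f x + h x) \<in> L"
  unfolding LUC_iff
proof (intro conjI allI impI)
  obtain B where B: "\<And>x. \<bar>f x\<bar> \<le> B" using LUC_bound[OF f] by blast
  obtain C where C: "\<And>x. \<bar>h x\<bar> \<le> C" using LUC_bound[OF h] by blast
  show "\<exists>B. \<forall>x\<in>G. \<bar>f x + h x\<bar> \<le> B"
    by (rule exI[of _ "B + C"]) (metis B C abs_triangle_ineq add_mono order_trans)
  fix \<epsilon> :: real assume "\<epsilon> > 0"
  then have e: "\<epsilon>/4 > 0" by simp
  have comp: "\<exists>W. openin T W \<and> id \<in> W \<and> (\<forall>g\<in>G. \<forall>k\<in>G. inv g \<circ> k \<in> W \<longrightarrow> \<bar>f' g - f' k\<bar> < \<epsilon>/4)" if "f' \<in> L" for f'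
    using that e unfolding LUC_def by blast
  from comp[OF f] obtain V where V: "openin T V" "id \<in> V" "\<forall>g\<in>G. \<forall>k\<in>G. inv g \<circ> k \<in> V \<longrightarrow> \<bar>f g - f k\<bar> < \<epsilon>/4" by blast
  from comp[OF h] obtain W where W: "openin T W" "id \<in> W" "\<forall>g\<in>G. \<forall>k\<in>G. inv g \<circ> k \<in> W \<longrightarrow> \<bar>h g - h k\<bar> < \<epsilon>/4" by blast
  \<comment> \<open>The locale does not order the subgroups \<open>U s\<close>, so a common one is
    found inside the intersection of two neighbourhoods.\<close>
  have "openin T (V \<inter> W)" "id \<in> V \<inter> W" using V W by auto
  from U_basis[OF this] obtain s where s: "U s \<subseteq> V \<inter> W" by blast
  show "\<exists>s. \<forall>g\<in>G. \<forall>u\<in>U s. \<bar>f g + h g - (f (g \<circ> u) + h (g \<circ> u))\<bar> < \<epsilon>"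
  proof (intro exI[of _ s] ballI)
    fix g u assume gu: "g \<in> G" "u \<in> U s"
    then have *: "g \<circ> u \<in> G" "inv g \<circ> (g \<circ> u) \<in> V \<inter> W" using comp_U s by auto
    then have "\<bar>f g - f (g \<circ> u)\<bar> < \<epsilon>/4" "\<bar>h g - h (g \<circ> u)\<bar> < \<epsilon>/4" using V(3) W(3) gu(1) by blast+
    then show "\<bar>f g + h g - (f (g \<circ> u) + h (g \<circ> u))\<bar> < \<epsilon>" by linarith
  qed
qed (simp add: LUC_outside[OF f] LUC_outside[OF h])

lemma LUC_cst [simp]: "cst c \<in> L"
  unfolding LUC_iff cst_def using comp_U by (auto intro!: exI[of _ "\<bar>c\<bar>"])

lemma LUC_rtrans [simp]:
  assumes f: "f \<in> L" and g: "g \<in> G"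
  shows "rtrans g f \<in> L"
  unfolding LUC_iff
proof (intro conjI allI impI)
  obtain B where B: "\<And>x. \<bar>f x\<bar> \<le> B" using LUC_bound[OF f] by blast
  then show "\<exists>B. \<forall>x\<in>G. \<bar>rtrans g f x\<bar> \<le> B" by (auto simp: rtrans_def)
  fix \<epsilon> :: real assume "\<epsilon> > 0"
  from LUC_unif[OF f this] obtain s where s: "\<forall>g\<in>G. \<forall>u\<in>U s. \<bar>f g - f (g \<circ> u)\<bar> < \<epsilon>" by blast
  from U_conj[OF g, of s] obtain t where t: "\<forall>u\<in>U t. inv g \<circ> u \<circ> g \<in> U s" by blast
  show "\<exists>s. \<forall>h\<in>G. \<forall>u\<in>U s. \<bar>rtrans g f h - rtrans g f (h \<circ> u)\<bar> < \<epsilon>"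
  proof (intro exI[of _ t] ballI)
    fix h u assume hu: "h \<in> G" "u \<in> U t"
    then have "h \<circ> u \<in> G" by (rule comp_U)
    moreover have "(h \<circ> g) \<circ> (inv g \<circ> u \<circ> g) = (h \<circ> u) \<circ> g" using g by (simp add: comp_assoc)
    moreover have "\<bar>f (h \<circ> g) - f ((h \<circ> g) \<circ> (inv g \<circ> u \<circ> g))\<bar> < \<epsilon>" using s[rule_format, OF comp_G[OF hu(1) g]] t hu(2) by blast
    ultimately show "\<bar>rtrans g f h - rtrans g f (h \<circ> u)\<bar> < \<epsilon>" using hu by (simp add: rtrans_def)
  qed
qed (simp add: rtrans_def)

lemma rtrans_rtrans: "g \<in> G \<Longrightarrow> rtrans g (rtrans h f) = rtrans (g \<circ> h) f"
  by (auto simp: rtrans_def fun_eq_iff comp_assoc)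

section \<open>The Samuel compactification as a compact space of functionals\<close>

abbreviation SG where "SG \<equiv> samuel_space G (\<circ>) inv id T"
abbreviation ST where "ST \<equiv> samuel_top G (\<circ>) inv id T"
abbreviation act where "act \<equiv> samuel_act G (\<circ>) inv id T"
abbreviation pt where "pt \<equiv> samuel_pt G (\<circ>) inv id T"

lemma topspace_ST [simp]: "topspace ST = SG"
  by (auto simp: samuel_top_def samuel_space_def)

lemma act_apply: "f \<in> L \<Longrightarrow> act x g f = x (rtrans g f)"
  by (simp add: samuel_act_def rtrans_def)

lemma pt_apply: "f \<in> L \<Longrightarrow> pt f = f id"
  by (simp add: samuel_pt_def)

lemma act_pt_apply: "f \<in> L \<Longrightarrow> g \<in> G \<Longrightarrow> act pt g f = f g"
  by (simp add: act_apply pt_apply) (simp add: rtrans_def)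

lemma SG_ext: "x \<in> SG \<Longrightarrow> y \<in> SG \<Longrightarrow> (\<And>f. f \<in> L \<Longrightarrow> x f = y f) \<Longrightarrow> x = y"
  unfolding samuel_space_def by (auto intro: PiE_ext)

lemma SG_add: "x \<in> SG \<Longrightarrow> f \<in> L \<Longrightarrow> h \<in> L \<Longrightarrow> x (\<lambda>y. f y + h y) = x f + x h"
  and SG_mult: "x \<in> SG \<Longrightarrow> f \<in> L \<Longrightarrow> h \<in> L \<Longrightarrow> x (\<lambda>y. f y * h y) = x f * x h"
  and SG_scale: "x \<in> SG \<Longrightarrow> f \<in> L \<Longrightarrow> x (\<lambda>y. c * f y) = c * x f"
  and SG_one: "x \<in> SG \<Longrightarrow> x (cst 1) = 1"
  by (auto simp: samuel_space_def cst_def[abs_def])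

lemma SG_cst:
  assumes "x \<in> SG" shows "x (cst c) = c"
proof -
  have "cst c = (\<lambda>y. c * cst 1 y)" by (auto simp: cst_def)
  then show ?thesis using SG_scale[OF assms LUC_cst, of c 1] SG_one[OF assms] by simp
qed

lemma cst_1: "(\<lambda>x. if x \<in> G then 1 else 0) = cst 1"
  by (auto simp: cst_def)

lemma LUC_scale: "f \<in> L \<Longrightarrow> (\<lambda>y. c * f y) \<in> L"
proof -
  assume f: "f \<in> L"
  have "(\<lambda>y. if y \<in> G then c * f y else 0) \<in> L" by (rule LUC_compose[OF f]) (intro continuous_intros)
  moreover have "(\<lambda>y. if y \<in> G then c * f y else 0) = (\<lambda>y. c * f y)" using LUC_outside[OF f] by auto
  ultimately show ?thesis by simp
qed

text \<open>A nonnegative function is the square of its square root, which is again in the algebra,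
  and a multiplicative functional sends squares to squares.\<close>

lemma SG_nonneg:
  assumes x: "x \<in> SG" and f: "f \<in> L" and pos: "\<And>g. g \<in> G \<Longrightarrow> f g \<ge> 0"
  shows "x f \<ge> 0"
proof -
  define h where "h = (\<lambda>y. if y \<in> G then sqrt (f y) else 0)"
  have h: "h \<in> L" unfolding h_def by (rule LUC_compose[OF f]) (intro continuous_intros)
  have "(\<lambda>y. h y * h y) = f" using pos LUC_outside[OF f] by (auto simp: h_def)
  then have "x f = x h * x h" using SG_mult[OF x h h] by simp
  then show ?thesis by simp
qed

lemma SG_le:
  assumes x: "x \<in> SG" and f: "f \<in> L" and h: "h \<in> L" and le: "\<And>g. g \<in> G \<Longrightarrow> \<bar>f g - h g\<bar> \<le> c"
  shows "\<bar>x f - x h\<bar> \<le> c"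
proof -
  have *: "x f - x h \<le> c" if f: "f \<in> L" and h: "h \<in> L" and le: "\<And>g. g \<in> G \<Longrightarrow> f g - h g \<le> c" for f h
  proof -
    let ?d = "\<lambda>y. cst c y + (h y + (-1) * f y)"
    have 1: "(\<lambda>y. (-1) * f y) \<in> L" using LUC_scale[OF f] .
    have 2: "(\<lambda>y. h y + (-1) * f y) \<in> L" using LUC_add[OF h 1] .
    have 3: "?d \<in> L" using LUC_add[OF LUC_cst 2] .
    have "0 \<le> x ?d" by (rule SG_nonneg[OF x 3]) (use le in \<open>force simp: cst_def algebra_simps\<close>)
    also have "x ?d = c + (x h + (-1) * x f)"
      by (simp only: SG_add[OF x LUC_cst 2] SG_add[OF x h 1] SG_scale[OF x f] SG_cst[OF x])
    finally show ?thesis by simp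
  qed
  have "x f - x h \<le> c" by (rule *[OF f h]) (use le in fastforce)
  moreover have "x h - x f \<le> c" by (rule *[OF h f]) (use le in fastforce)
  ultimately show ?thesis by simp
qed

lemma continuous_eval: "f \<in> L \<Longrightarrow> continuous_map ST euclideanreal (\<lambda>x. x f)"
  unfolding samuel_top_def by (intro continuous_map_from_subtopology continuous_map_product_projection)

text \<open>Polarisation reduces products to squares.\<close>

lemma LUC_mult:
  assumes f: "f \<in> L" and h: "h \<in> L"
  shows "(\<lambda>x. f x * h x) \<in> L"
proof -
  have sq: "(\<lambda>x. (k x)\<^sup>2) \<in> L" if k: "k \<in> L" for k
  proof -
    have "(\<lambda>y. if y \<in> G then (k y)\<^sup>2 else 0) \<in> L" by (rule LUC_compose[OF k]) (intro continuous_intros)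
    moreover have "(\<lambda>y. if y \<in> G then (k y)\<^sup>2 else 0) = (\<lambda>y. (k y)\<^sup>2)" using LUC_outside[OF k] by auto
    ultimately show ?thesis by simp
  qed
  have "(\<lambda>x. (1/4) * (f x + h x)\<^sup>2 + (-1/4) * (f x + (-1) * h x)\<^sup>2) \<in> L"
    by (intro LUC_add LUC_scale sq f h)
  also have "(\<lambda>x. (1/4) * (f x + h x)\<^sup>2 + (-1/4) * (f x + (-1) * h x)\<^sup>2) = (\<lambda>x. f x * h x)"
    by (simp add: fun_eq_iff power2_eq_square field_simps)
  finally show ?thesis .
qed

text \<open>By \<open>SG_le\<close> a functional is bounded by the sup norm, so all of them lie in a
  product of compact intervals; the algebraic identities are closed conditions there.\<close>

lemma compact_ST: "compact_space ST"
proof -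
  let ?P = "product_topology (\<lambda>_. euclideanreal) L"
  define b where "b f = (SOME B. \<forall>x. \<bar>f x\<bar> \<le> B)" for f :: "('a \<Rightarrow> 'a) \<Rightarrow> real"
  have b: "\<bar>f g\<bar> \<le> b f" if "f \<in> L" for f g
    using someI_ex[OF LUC_bound[OF that]] unfolding b_def by blast
  let ?K = "PiE L (\<lambda>f. {- b f..b f})"
  have K: "compactin ?P ?K" by (subst compactin_PiE) auto
  have sub: "SG \<subseteq> ?K"
  proof
    fix x assume x: "x \<in> SG"
    have "x f \<in> {- b f..b f}" if f: "f \<in> L" for f
    proof -
      have "\<bar>x f - x (cst 0)\<bar> \<le> b f" using b[OF f] by (intro SG_le[OF x f]) (auto simp: cst_def)
      then show ?thesis using SG_cst[OF x] by (simp add: abs_le_iff)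
    qed
    moreover have "x \<in> extensional L" using x by (auto simp: samuel_space_def PiE_def)
    ultimately show "x \<in> ?K" by (auto simp: PiE_iff)
  qed
  have proj: "continuous_map ?P euclideanreal (\<lambda>x. x f)" if "f \<in> L" for f
    by (rule continuous_map_product_projection[OF that])
  have eq: "closedin ?P {x \<in> topspace ?P. a x = b x}"
    if "continuous_map ?P euclideanreal a" "continuous_map ?P euclideanreal b" for a b
  proof -
    have "continuous_map ?P euclideanreal (\<lambda>x. a x - b x)" by (intro continuous_map_diff that)
    from closedin_continuous_map_preimage[OF this, of "{0}"] show ?thesis by simp
  qed
  define I where "I = (L \<times> L \<times> (UNIV :: real set))"
  let ?A = "\<lambda>(f,h,c). {x \<in> topspace ?P. x (\<lambda>y. f y + h y) = x f + x h} \<inter>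
      {x \<in> topspace ?P. x (\<lambda>y. f y * h y) = x f * x h} \<inter> {x \<in> topspace ?P. x (\<lambda>y. c * f y) = c * x f} \<inter>
      {x \<in> topspace ?P. x (cst 1) = 1}"
  have ne: "I \<noteq> {}" using LUC_cst by (fastforce simp: I_def)
  have clA: "closedin ?P (?A (f, h, c))" if "f \<in> L" "h \<in> L" for f h c
    unfolding prod.case
    by (intro closedin_Int eq proj that LUC_add LUC_mult LUC_scale LUC_cst continuous_map_add
        continuous_map_real_mult continuous_map_real_mult_left) simp
  have "closedin ?P (\<Inter>i\<in>I. ?A i)"
  proof (rule closedin_INT[OF ne])
    fix i assume "i \<in> I"
    then obtain f h c where i: "i = (f, h, c)" "f \<in> L" "h \<in> L" unfolding I_def by (elim SigmaE) simp
    show "closedin ?P (?A i)" unfolding i(1) by (rule clA[OF i(2,3)])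
  qed
  also have "(\<Inter>i\<in>I. ?A i) = SG"
  proof
    show "SG \<subseteq> (\<Inter>i\<in>I. ?A i)"
    proof (intro subsetI INT_I)
      fix x i assume x: "x \<in> SG" and "i \<in> I"
      then obtain f h c where i: "i = (f, h, c)" "f \<in> L" "h \<in> L" unfolding I_def by (elim SigmaE) simp
      have "x \<in> topspace ?P" using x by (simp add: samuel_space_def)
      then show "x \<in> ?A i" unfolding i(1) prod.case
        using SG_add[OF x i(2,3)] SG_mult[OF x i(2,3)] SG_scale[OF x i(2)] SG_one[OF x] by simp
    qed
    show "(\<Inter>i\<in>I. ?A i) \<subseteq> SG"
    proof
      fix x assume x': "x \<in> (\<Inter>i\<in>I. ?A i)"
      have x: "x \<in> ?A (f, h, c)" if "f \<in> L" "h \<in> L" for f h c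
        by (rule INT_D[OF x']) (simp add: I_def that)
      note x = x[unfolded prod.case Int_iff mem_Collect_eq]
      from x[OF LUC_cst LUC_cst] show "x \<in> SG"
        unfolding samuel_space_def cst_1 using x by simp
    qed
  qed
  finally have "closedin ?P SG" .
  then have "compactin ?P SG" by (rule closed_compactin[OF K sub])
  then show ?thesis unfolding samuel_top_def by (rule compact_space_subtopology)
qed

lemma act_SG:
  assumes x: "x \<in> SG" and g: "g \<in> G" shows "act x g \<in> SG"
proof -
  have tr: "rtrans g (\<lambda>x. f x + h x) = (\<lambda>x. rtrans g f x + rtrans g h x)"
    "rtrans g (\<lambda>x. f x * h x) = (\<lambda>x. rtrans g f x * rtrans g h x)"
    "rtrans g (\<lambda>x. c * f x) = (\<lambda>x. c * rtrans g f x)" "rtrans g (cst c) = cst c" for f h c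
    using g by (auto simp: rtrans_def cst_def)
  note L = LUC_rtrans[OF _ g]
  have "act x g \<in> L \<rightarrow>\<^sub>E UNIV" by (simp add: samuel_act_def)
  moreover have "act x g (\<lambda>y. f y + h y) = act x g f + act x g h"
    "act x g (\<lambda>y. f y * h y) = act x g f * act x g h" if "f \<in> L" "h \<in> L" for f h
    using that by (simp_all only: act_apply LUC_add LUC_mult tr SG_add[OF x L L] SG_mult[OF x L L])
  moreover have "act x g (\<lambda>y. c * f y) = c * act x g f" if "f \<in> L" for f c
    using that by (simp only: act_apply LUC_scale tr(3) SG_scale[OF x L])
  moreover have "act x g (cst 1) = 1" by (simp only: act_apply LUC_cst tr SG_one[OF x])
  ultimately show ?thesis unfolding samuel_space_def cst_1 by blast
qed

lemma pt_SG: "pt \<in> SG"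
  by (auto simp: samuel_pt_def samuel_space_def LUC_add LUC_mult LUC_scale LUC_cst[unfolded cst_def[abs_def]])

text \<open>The coefficients of points of a minimal flow have few patterns on all translates of a finite
  set as soon as this holds for one point of the orbit closure and finitely many translates.\<close>
lemma minimal_patterns:
  assumes M: "minimal_subflow ST act G M" and x: "x \<in> M" and f: "f \<in> L" and \<epsilon>: "\<epsilon> > 0"
    and F: "finite F" "F \<subseteq> G"
    and ramsey: "\<And>r c D. (\<And>g. g \<in> G \<Longrightarrow> c g < (r::nat)) \<Longrightarrow> (\<And>g u. g \<in> G \<Longrightarrow> u \<in> U s \<Longrightarrow> c (g \<circ> u) = c g) \<Longrightarrow>
      finite D \<Longrightarrow> D \<subseteq> G \<Longrightarrow>
      \<exists>g\<in>G. card ((\<lambda>h. \<lambda>\<phi>\<in>F. c (g \<circ> h \<circ> \<phi>)) ` D) \<le> t"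
    and s: "\<And>g u. g \<in> G \<Longrightarrow> u \<in> U s \<Longrightarrow> \<bar>f g - f (g \<circ> u)\<bar> \<le> \<epsilon>"
  shows "\<exists>P. finite P \<and> card P \<le> t \<and>
    (\<forall>h\<in>G. \<exists>\<pi>\<in>P. \<forall>\<phi>\<in>F. \<bar>x (rtrans (h \<circ> \<phi>) f) - \<pi> \<phi>\<bar> \<le> 2 * \<epsilon>)"
proof -
  have MS: "M \<subseteq> SG" and cl: "closedin ST M" and inv: "\<And>z g. z \<in> M \<Longrightarrow> g \<in> G \<Longrightarrow> act z g \<in> M"
    and min: "\<And>N. N \<noteq> {} \<Longrightarrow> N \<subseteq> M \<Longrightarrow> closedin ST N \<Longrightarrow> (\<forall>z\<in>N. \<forall>g\<in>G. act z g \<in> N) \<Longrightarrow> N = M"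
    using M by (auto simp: minimal_subflow_def)
  have xS: "x \<in> SG" using x MS by blast
  obtain B where B: "\<And>g. \<bar>f g\<bar> \<le> B" using LUC_bound[OF f] by blast
  define k where "k = \<lfloor>B / \<epsilon>\<rfloor> + 1"
  define a where "a g = x (rtrans g f)" for g
  have aB: "\<bar>a g\<bar> \<le> B" if "g \<in> G" for g
  proof -
    have "\<bar>x (rtrans g f) - x (cst 0)\<bar> \<le> B"
      by (rule SG_le[OF xS LUC_rtrans[OF f that] LUC_cst]) (simp add: rtrans_def cst_def B)
    then show ?thesis by (simp add: a_def SG_cst[OF xS])
  qed
  have au: "\<bar>a g - a (g \<circ> u)\<bar> \<le> \<epsilon>" if gu: "g \<in> G" "u \<in> U s" for g u
    unfolding a_def
  proof (rule SG_le[OF xS LUC_rtrans[OF f gu(1)] LUC_rtrans[OF f comp_U[OF gu]]])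
    fix h assume h: "h \<in> G"
    from s[OF comp_G[OF h gu(1)] gu(2)] h
    show "\<bar>rtrans g f h - rtrans (g \<circ> u) f h\<bar> \<le> \<epsilon>" by (simp add: rtrans_def comp_assoc)
  qed
  define cls where "cls g = (\<lambda>u. g \<circ> u) ` U s" for g :: "'a \<Rightarrow> 'a"
  have cls_eq: "cls (g \<circ> u) = cls g" if gu: "g \<in> G" "u \<in> U s" for g u
  proof -
    have "g \<circ> u \<circ> v \<in> cls g" if "v \<in> U s" for v
      using U_comp[OF gu(2) that] by (auto simp: cls_def comp_assoc)
    moreover have "g \<circ> v \<in> cls (g \<circ> u)" if "v \<in> U s" for v
    proof -
      have "g \<circ> v = (g \<circ> u) \<circ> (inv u \<circ> v)" using U_G[OF gu(2)] by (simp add: comp_assoc)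
      then show ?thesis using U_comp[OF U_inv[OF gu(2)] that] by (auto simp: cls_def)
    qed
    ultimately show ?thesis by (force simp: cls_def)
  qed
  \<comment> \<open>Rounding the coefficient at a fixed representative of the coset makes the
    colouring exactly invariant under \<open>U s\<close>, as the Ramsey hypothesis demands.\<close>
  define rep where "rep g = (SOME y. y \<in> cls g)" for g :: "'a \<Rightarrow> 'a"
  have rep: "\<exists>u\<in>U s. rep g = g \<circ> u" for g
  proof -
    have "g \<circ> id \<in> cls g" using U_id[of s] unfolding cls_def by blast
    then have "rep g \<in> cls g" unfolding rep_def by (rule someI[of "\<lambda>y. y \<in> cls g"])
    then show ?thesis by (auto simp: cls_def)
  qed
  have arep: "\<bar>a g - a (rep g)\<bar> \<le> \<epsilon>" "rep g \<in> G" if "g \<in> G" for g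
    using rep[of g] au[OF that] comp_U[OF that] by auto
  define c where "c g = nat (\<lfloor>a (rep g) / \<epsilon>\<rfloor> + k)" for g
  have c_bounds: "0 \<le> \<lfloor>a (rep g) / \<epsilon>\<rfloor> + k" "\<lfloor>a (rep g) / \<epsilon>\<rfloor> + k < 2 * k" if "g \<in> G" for g
  proof -
    have *: "\<bar>a (rep g) / \<epsilon>\<bar> \<le> B / \<epsilon>" using aB[OF arep(2)[OF that]] \<epsilon> by (simp add: divide_right_mono)
    have "B / \<epsilon> < k" unfolding k_def by linarith
    with * show "0 \<le> \<lfloor>a (rep g) / \<epsilon>\<rfloor> + k" "\<lfloor>a (rep g) / \<epsilon>\<rfloor> + k < 2 * k" by linarith+
  qed
  define r where "r = nat (2 * k)"
  have cr: "c g < r" if "g \<in> G" for g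
    using c_bounds[OF that] by (simp add: c_def r_def)
  have cu: "c (g \<circ> u) = c g" if "g \<in> G" "u \<in> U s" for g u
    using cls_eq[OF that] by (simp add: c_def rep_def)
  \<comment> \<open>One \<open>\<epsilon>\<close> is lost by rounding and one by passing to the
    representative.\<close>
  have ac: "\<bar>a g - \<epsilon> * (real (c g) - k)\<bar> \<le> 2 * \<epsilon>" if "g \<in> G" for g
  proof -
    have "real (c g) - k = \<lfloor>a (rep g) / \<epsilon>\<rfloor>" using c_bounds(1)[OF that] by (simp add: c_def)
    moreover have "\<bar>a (rep g) / \<epsilon> - \<lfloor>a (rep g) / \<epsilon>\<rfloor>\<bar> \<le> 1" by linarith
    ultimately have "\<bar>\<epsilon> * (a (rep g) / \<epsilon> - (real (c g) - k))\<bar> \<le> \<epsilon> * 1"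
      using \<epsilon> unfolding abs_mult by (intro mult_mono) auto
    then have "\<bar>a (rep g) - \<epsilon> * (real (c g) - k)\<bar> \<le> \<epsilon>" using \<epsilon> by (simp add: right_diff_distrib)
    then show ?thesis using arep(1)[OF that] by linarith
  qed
  \<comment> \<open>The candidates for the set of patterns are finite in number. This lets one of
    them serve all finite sets \<open>D\<close> of translates.\<close>
  define PP where "PP = {P. P \<subseteq> (F \<rightarrow>\<^sub>E {..<r}) \<and> card P \<le> t}"
  have fin: "finite (F \<rightarrow>\<^sub>E {..<r})" using F by (intro finite_PiE) auto
  then have finPP: "finite PP" by (simp add: PP_def)
  define N where "N P h = {z \<in> M. \<exists>\<pi>\<in>P. \<forall>\<phi>\<in>F. \<bar>z (rtrans (h \<circ> \<phi>) f) - \<epsilon> * (real (\<pi> \<phi>) - k)\<bar> \<le> 2 * \<epsilon>}" for P h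
  have Ncl: "closedin ST (N P h)" if P: "P \<in> PP" and h: "h \<in> G" for P h
  proof -
    have "finite P" by (rule finite_subset[OF _ fin]) (use P in \<open>auto simp: PP_def\<close>)
    have 1: "closedin ST {z \<in> topspace ST. z (rtrans (h \<circ> \<phi>) f) \<in> cball e d}" if "\<phi> \<in> F" for \<phi> e d
      by (rule closedin_continuous_map_preimage[OF continuous_eval]) (use f h F that in auto)
    have "closedin ST (M \<inter> (\<Union>\<pi>\<in>P. \<Inter>\<phi>\<in>F. {z \<in> topspace ST. z (rtrans (h \<circ> \<phi>) f) \<in> cball (\<epsilon> * (real (\<pi> \<phi>) - k)) (2 * \<epsilon>)}))"
      if "F \<noteq> {}"
      using \<open>finite P\<close> by (intro closedin_Int cl closedin_Union finite_imageI) (auto intro!: closedin_INT[OF that] 1[unfolded topspace_ST mem_cball])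
    moreover have "N P h = M \<inter> (\<Union>\<pi>\<in>P. \<Inter>\<phi>\<in>F. {z \<in> topspace ST. z (rtrans (h \<circ> \<phi>) f) \<in> cball (\<epsilon> * (real (\<pi> \<phi>) - k)) (2 * \<epsilon>)})"
      if "F \<noteq> {}"
      using that MS by (auto simp: N_def dist_real_def abs_minus_commute subset_iff)
    moreover have "N P h = (if P = {} then {} else M)" if "F = {}" using that by (auto simp: N_def)
    ultimately show ?thesis using cl by (cases "F = {}") auto
  qed
  have ex: "\<exists>P\<in>PP. \<exists>z\<in>M. \<forall>h\<in>D. z \<in> N P h" if D: "finite D" "D \<subseteq> G" for D
  proof -
    from ramsey[of c r D, OF cr cu D] obtain g where g: "g \<in> G"
      "card ((\<lambda>h. \<lambda>\<phi>\<in>F. c (g \<circ> h \<circ> \<phi>)) ` D) \<le> t" by blast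
    let ?P = "(\<lambda>h. \<lambda>\<phi>\<in>F. c (g \<circ> h \<circ> \<phi>)) ` D"
    have in_G: "g \<circ> h \<circ> \<phi> \<in> G" if "h \<in> D" "\<phi> \<in> F" for h \<phi> using that D F g(1) by (meson comp_G subsetD)
    have "?P \<in> PP" using g(2) cr in_G by (auto simp: PP_def)
    moreover have "act x g \<in> N ?P h" if h: "h \<in> D" for h
    proof -
      have "\<bar>act x g (rtrans (h \<circ> \<phi>) f) - \<epsilon> * (real ((\<lambda>\<phi>\<in>F. c (g \<circ> h \<circ> \<phi>)) \<phi>) - k)\<bar> \<le> 2 * \<epsilon>" if \<phi>: "\<phi> \<in> F" for \<phi>
      proof -
        have hp: "h \<circ> \<phi> \<in> G" using h \<phi> D F by (meson comp_G subsetD)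
        then have "act x g (rtrans (h \<circ> \<phi>) f) = a (g \<circ> h \<circ> \<phi>)"
          using f g by (simp add: act_apply rtrans_rtrans a_def comp_assoc)
        then show ?thesis using ac[OF in_G[OF h \<phi>]] \<phi> by simp
      qed
      then show ?thesis unfolding N_def using h inv[OF x g(1)] by blast
    qed
    ultimately show ?thesis using inv[OF x g(1)] by blast
  qed
  define good where "good P D \<longleftrightarrow> (\<exists>z\<in>M. \<forall>h\<in>D. z \<in> N P h)" for P D
  have good_mono: "good P D' \<Longrightarrow> D \<subseteq> D' \<Longrightarrow> good P D" for P D D'
    unfolding good_def by blast
  have ex': "\<exists>P\<in>PP. good P D" if "finite D" "D \<subseteq> G" for D
    unfolding good_def by (rule ex[OF that])
  \<comment> \<open>If every candidate failed on some finite set, all of them would fail on the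
    union of these sets, which is still finite.\<close>
  have "\<exists>P\<in>PP. \<forall>D. finite D \<and> D \<subseteq> G \<longrightarrow> good P D"
  proof (rule ccontr)
    assume "\<not> ?thesis"
    then have "\<forall>P\<in>PP. \<exists>D. finite D \<and> D \<subseteq> G \<and> \<not> good P D" by blast
    from bchoice[OF this] obtain D where D: "\<forall>P\<in>PP. finite (D P) \<and> D P \<subseteq> G \<and> \<not> good P (D P)" ..
    have "finite (\<Union>(D ` PP))" "\<Union>(D ` PP) \<subseteq> G" using D finPP by auto
    from ex'[OF this] obtain P where P: "P \<in> PP" "good P (\<Union>(D ` PP))" ..
    from good_mono[OF P(2), of "D P"] P(1) D show False by blast
  qed
  then obtain P where P: "P \<in> PP" and PD: "\<And>D. finite D \<Longrightarrow> D \<subseteq> G \<Longrightarrow> good P D" by blast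
  \<comment> \<open>These are the points of \<open>M\<close> whose patterns on every translate come
    from \<open>P\<close>. Acting by \<open>g\<close> merely replaces the translate by
    \<open>h\<close> with that by \<open>g h\<close>, so the set is invariant; being closed and
    nonempty it is all of \<open>M\<close>.\<close>
  let ?N = "\<Inter>h\<in>G. N P h"
  have "G \<noteq> {}" using id_G by blast
  then have Ncl': "closedin ST ?N" by (rule closedin_INT) (rule Ncl[OF P])
  have Nne: "?N \<noteq> {}"
  proof (rule compact_space_INT_nonempty[OF compact_ST Ncl[OF P]])
    show "\<Inter>(N P ` D) \<noteq> {}" if "finite D" "D \<subseteq> G" "D \<noteq> {}" for D
      using PD[OF that(1,2)] unfolding good_def by blast
  qed
  have NM: "?N \<subseteq> M" using \<open>G \<noteq> {}\<close> by (auto simp: N_def)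
  have Nact: "act z g \<in> ?N" if z: "z \<in> ?N" and g: "g \<in> G" for z g
  proof -
    have zM: "z \<in> M" using z NM by blast
    have "act z g \<in> N P h" if h: "h \<in> G" for h
    proof -
      have "z \<in> N P (g \<circ> h)" using z g h by auto
      then obtain \<pi> where \<pi>: "\<pi> \<in> P" "\<forall>\<phi>\<in>F. \<bar>z (rtrans (g \<circ> h \<circ> \<phi>) f) - \<epsilon> * (real (\<pi> \<phi>) - k)\<bar> \<le> 2 * \<epsilon>"
        by (auto simp: N_def)
      have "act z g (rtrans (h \<circ> \<phi>) f) = z (rtrans (g \<circ> h \<circ> \<phi>) f)" if "\<phi> \<in> F" for \<phi>
        using that F g h f by (subst act_apply) (auto simp: rtrans_rtrans comp_assoc subset_iff)
      then show ?thesis unfolding N_def using \<pi> inv[OF zM g] by auto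
    qed
    then show ?thesis by blast
  qed
  have "?N = M" by (rule min[OF Nne NM Ncl']) (intro ballI Nact)
  with x have "x \<in> ?N" by (simp only:)
  then have xN: "x \<in> N P h" if "h \<in> G" for h using that by (rule INT_D)
  define Q where "Q = (\<lambda>\<pi> \<phi>. \<epsilon> * (real (\<pi> \<phi>) - k)) ` P"
  have finP: "finite P" by (rule finite_subset[OF _ fin]) (use P in \<open>auto simp: PP_def\<close>)
  then have "card Q \<le> card P" unfolding Q_def by (rule card_image_le)
  then have "card Q \<le> t" using P by (simp add: PP_def)
  moreover have "\<forall>h\<in>G. \<exists>\<pi>\<in>Q. \<forall>\<phi>\<in>F. \<bar>x (rtrans (h \<circ> \<phi>) f) - \<pi> \<phi>\<bar> \<le> 2 * \<epsilon>"
  proof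
    fix h assume "h \<in> G"
    from xN[OF this] obtain \<pi> where "\<pi> \<in> P" "\<forall>\<phi>\<in>F. \<bar>x (rtrans (h \<circ> \<phi>) f) - \<epsilon> * (real (\<pi> \<phi>) - k)\<bar> \<le> 2 * \<epsilon>"
      unfolding N_def by blast
    then show "\<exists>\<pi>\<in>Q. \<forall>\<phi>\<in>F. \<bar>x (rtrans (h \<circ> \<phi>) f) - \<pi> \<phi>\<bar> \<le> 2 * \<epsilon>" by (auto simp: Q_def)
  qed
  moreover have "finite Q" using finP by (simp add: Q_def)
  ultimately show ?thesis by blast
qed

end

text \<open>After changing the base by \<open>q < 2 ^ q\<close>, the exponents to compare are
  \<open>q * (n * q^n * k)\<close> and \<open>q^(2n - 4)\<close>; this comes down to
  \<open>n k < q^(n - 5)\<close>.\<close>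

lemma pattern_count_bound:
  fixes q :: nat
  assumes "2 \<le> q"
  shows "\<exists>n\<ge>N. 2 \<le> n \<and> ((q ^ n) ^ (q ^ n)) ^ k < 2 ^ (q ^ (2 * (n - 2)))"
proof -
  have "2 * j + 13 \<le> 16 * 2 ^ j" for j :: nat by (induction j) auto
  then have lin: "2 * j + 13 \<le> 2 ^ (j + 4)" for j :: nat by (simp add: power_add mult.commute)
  define j where "j = N + k"
  \<comment> \<open>Now \<open>n - 5\<close> is twice \<open>j + 4\<close>, so it suffices to bound
    \<open>n\<close> and \<open>k\<close> separately by \<open>2^(j + 4)\<close>.\<close>
  define n where "n = 2 * (j + 4) + 5"
  have "n * k < 2 ^ (n - 5)"
  proof -
    have "n \<le> 2 ^ (j + 4)" using lin[of j] by (simp add: n_def)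
    moreover have "k < 2 ^ (j + 4)" by (rule le_less_trans[OF _ less_exp]) (simp add: j_def)
    ultimately have "n * k < 2 ^ (j + 4) * 2 ^ (j + 4)" by (intro mult_le_less_imp_less) (auto simp: n_def)
    also have "\<dots> = 2 ^ ((j + 4) + (j + 4))" by (rule power_add[symmetric])
    also have "(j + 4) + (j + 4) = n - 5" by (simp add: n_def)
    finally show ?thesis .
  qed
  also have "(2::nat) ^ (n - 5) \<le> q ^ (n - 5)" using assms by (rule power_mono) simp
  finally have "q ^ (n + 1) * (n * k) < q ^ (n + 1) * q ^ (n - 5)" using assms by simp
  also have "\<dots> = q ^ (n + 1 + (n - 5))" by (rule power_add[symmetric])
  also have "n + 1 + (n - 5) = 2 * (n - 2)" by (simp add: n_def)
  finally have *: "q * (n * q ^ n * k) < q ^ (2 * (n - 2))" by (simp add: mult_ac)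
  have "((q ^ n) ^ (q ^ n)) ^ k = q ^ (n * q ^ n * k)" by (simp add: power_mult)
  also have "\<dots> \<le> (2 ^ q) ^ (n * q ^ n * k)" by (intro power_mono) (simp_all add: less_imp_le)
  also have "\<dots> = 2 ^ (q * (n * q ^ n * k))" by (simp add: power_mult)
  also have "(2::nat) ^ (q * (n * q ^ n * k)) < 2 ^ (q ^ (2 * (n - 2)))" using * by simp
  finally show ?thesis by (intro exI[of _ n]) (auto simp: n_def j_def)
qed

text \<open>The elements \<open>\<kappa> B n\<close> move the finite sets \<open>F n\<close> apart for different \<open>B\<close>, so that a set can be
  prescribed on each translate \<open>\<kappa> B n F n\<close> independently.\<close>
locale ramsey_group = nonarch_group +
  fixes F :: "nat \<Rightarrow> ('a \<Rightarrow> 'a) set" and \<kappa> :: "nat \<Rightarrow> nat \<Rightarrow> 'a \<Rightarrow> 'a" and s0 q :: nat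
  assumes F_fin: "finite (F n)" and F_G: "F n \<subseteq> G" and q2: "2 \<le> q" and F_card: "2 \<le> n \<Longrightarrow> q ^ (2 * (n - 2)) \<le> card (F n)"
    and ramsey: "2 \<le> n \<Longrightarrow> s \<le> n \<Longrightarrow> (\<And>g. g \<in> G \<Longrightarrow> c g < (r::nat)) \<Longrightarrow>
      (\<And>g u. g \<in> G \<Longrightarrow> u \<in> U s \<Longrightarrow> c (g \<circ> u) = c g) \<Longrightarrow> finite D \<Longrightarrow> D \<subseteq> G \<Longrightarrow>
      \<exists>g\<in>G. card ((\<lambda>h. \<lambda>\<phi>\<in>F n. c (g \<circ> h \<circ> \<phi>)) ` D) \<le> (q ^ n) ^ (q ^ n)"
    and \<kappa>_G: "2 \<le> n \<Longrightarrow> n \<le> B \<Longrightarrow> \<kappa> B n \<in> G"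
    and \<kappa>_inj: "2 \<le> n \<Longrightarrow> n \<le> B \<Longrightarrow> 2 \<le> n' \<Longrightarrow> n' \<le> B' \<Longrightarrow> \<phi> \<in> F n \<Longrightarrow> \<phi>' \<in> F n' \<Longrightarrow>
      u \<in> U s0 \<Longrightarrow> u' \<in> U s0 \<Longrightarrow> \<kappa> B n \<circ> \<phi> \<circ> u = \<kappa> B' n' \<circ> \<phi>' \<circ> u' \<Longrightarrow> B = B'"
    and F_inj: "2 \<le> n \<Longrightarrow> \<phi> \<in> F n \<Longrightarrow> \<phi>' \<in> F n \<Longrightarrow> u \<in> U s0 \<Longrightarrow> u' \<in> U s0 \<Longrightarrow> \<phi> \<circ> u = \<phi>' \<circ> u' \<Longrightarrow> \<phi> = \<phi>'"
begin

text \<open>Pairing with \<open>n\<close> in the first component gives an index that is at least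
  \<open>n\<close>, as \<open>\<kappa>_G\<close> requires, and that determines both \<open>n\<close>
  and the subset.\<close>

definition code :: "nat \<Rightarrow> ('a \<Rightarrow> 'a) set \<Rightarrow> nat" where
  "code n \<sigma> = prod_encode (n, to_nat_on (SIGMA n:UNIV. Pow (F n)) (n, \<sigma>))"

text \<open>The index of \<open>\<kappa>\<close> names the subset that \<open>S\<close> is to cut
  out of the translate. The factors \<open>u\<close> make \<open>S\<close> a union of cosets of
  \<open>U s0\<close>, whence its indicator is uniformly continuous.\<close>

definition S :: "('a \<Rightarrow> 'a) set" where
  "S = {\<kappa> (code n \<sigma>) n \<circ> \<phi> \<circ> u |n \<sigma> \<phi> u. 2 \<le> n \<and> \<sigma> \<subseteq> F n \<and> \<phi> \<in> \<sigma> \<and> u \<in> U s0}"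

definition indS :: "('a \<Rightarrow> 'a) \<Rightarrow> real" where
  "indS g = (if g \<in> S then 1 else 0)"

lemma le_code: "n \<le> code n \<sigma>"
  by (simp add: code_def le_prod_encode_1)

lemma code_inj: "code n \<sigma> = code n' \<sigma>' \<Longrightarrow> \<sigma> \<subseteq> F n \<Longrightarrow> \<sigma>' \<subseteq> F n' \<Longrightarrow> n = n' \<and> \<sigma> = \<sigma>'"
proof -
  assume eq: "code n \<sigma> = code n' \<sigma>'" and sub: "\<sigma> \<subseteq> F n" "\<sigma>' \<subseteq> F n'"
  have "countable (SIGMA n:UNIV. Pow (F n))"
    using F_fin by (intro countable_SIGMA) (auto intro: countable_finite)
  from inj_on_to_nat_on[OF this] eq sub show ?thesis
    unfolding code_def inj_on_def by auto
qed

lemma S_G: "S \<subseteq> G"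
  unfolding S_def using \<kappa>_G le_code F_G U_G by (auto intro!: comp_G simp: subset_iff)

lemma S_U: "g \<in> S \<Longrightarrow> u \<in> U s0 \<Longrightarrow> g \<circ> u \<in> S"
  unfolding S_def using U_comp by (fastforce simp: comp_assoc)

text \<open>From an element of \<open>S\<close>, \<open>\<kappa>_inj\<close> recovers the code and
  with it \<open>n\<close> and \<open>\<sigma>\<close>; after cancelling \<open>\<kappa>\<close>,
  \<open>F_inj\<close> recovers \<open>\<phi>\<close>.\<close>

lemma S_shatter:
  assumes n: "2 \<le> n" and \<sigma>: "\<sigma> \<subseteq> F n" and \<phi>: "\<phi> \<in> F n"
  shows "\<kappa> (code n \<sigma>) n \<circ> \<phi> \<in> S \<longleftrightarrow> \<phi> \<in> \<sigma>"
proof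
  assume "\<phi> \<in> \<sigma>"
  moreover have "\<kappa> (code n \<sigma>) n \<circ> \<phi> = \<kappa> (code n \<sigma>) n \<circ> \<phi> \<circ> id" by simp
  ultimately show "\<kappa> (code n \<sigma>) n \<circ> \<phi> \<in> S" unfolding S_def using n \<sigma> U_id by blast
next
  assume "\<kappa> (code n \<sigma>) n \<circ> \<phi> \<in> S"
  then obtain n' \<sigma>' \<phi>' u where *: "\<kappa> (code n \<sigma>) n \<circ> \<phi> = \<kappa> (code n' \<sigma>') n' \<circ> \<phi>' \<circ> u"
    "2 \<le> n'" "\<sigma>' \<subseteq> F n'" "\<phi>' \<in> \<sigma>'" "u \<in> U s0" unfolding S_def by blast
  have \<phi>': "\<phi>' \<in> F n'" using * by blast
  have "\<kappa> (code n \<sigma>) n \<circ> \<phi> \<circ> id = \<kappa> (code n' \<sigma>') n' \<circ> \<phi>' \<circ> u" using * by simp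
  from \<kappa>_inj[OF n le_code *(2) le_code \<phi> \<phi>' U_id *(5) this] code_inj[OF _ \<sigma> *(3)]
  have eq: "n' = n" "\<sigma>' = \<sigma>" by auto
  let ?k = "\<kappa> (code n \<sigma>) n"
  have k: "?k \<in> G" using \<kappa>_G[OF n le_code] .
  have "inv ?k \<circ> (?k \<circ> \<phi>) = inv ?k \<circ> (?k \<circ> (\<phi>' \<circ> u))" using *(1) by (simp only: eq comp_assoc)
  then have "\<phi> \<circ> id = \<phi>' \<circ> u" unfolding cancel(1)[OF k] by simp
  from F_inj[OF n \<phi> \<phi>'[unfolded eq] U_id *(5) this] show "\<phi> \<in> \<sigma>" using * eq by simp
qed

lemma indS_LUC: "indS \<in> L"
  unfolding LUC_iff
proof (intro conjI allI impI)
  show "indS x = 0" if "x \<notin> G" for x using that S_G by (auto simp: indS_def)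
  show "\<exists>B. \<forall>x\<in>G. \<bar>indS x\<bar> \<le> B" by (intro exI[of _ 1]) (simp add: indS_def)
  fix \<epsilon> :: real assume "\<epsilon> > 0"
  have "g \<circ> u \<in> S \<longleftrightarrow> g \<in> S" if "g \<in> G" "u \<in> U s0" for g u
    using S_U[of g u] S_U[of "g \<circ> u" "inv u"] U_inv[of u] that U_G by (auto simp: comp_assoc)
  then show "\<exists>s. \<forall>g\<in>G. \<forall>u\<in>U s. \<bar>indS g - indS (g \<circ> u)\<bar> < \<epsilon>"
    using \<open>\<epsilon> > 0\<close> by (intro exI[of _ s0]) (simp add: indS_def)
qed

text \<open>Minimal coefficients cannot separate \<open>S\<close> from its complement: they have too few patterns.\<close>
lemma close_pair:
  assumes M: "minimal_subflow ST act G M" and \<Phi>: "finite \<Phi>" "\<Phi> \<subseteq> M \<times> L" and \<delta>: "\<delta> > 0"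
  shows "\<exists>g\<in>S. \<exists>g'\<in>G - S. \<forall>(x,f)\<in>\<Phi>. \<bar>x (rtrans g f) - x (rtrans g' f)\<bar> \<le> \<delta>"
proof -
  \<comment> \<open>Two coefficients that follow a common pattern up to
    \<open>2 * \<epsilon>\<close> differ by at most \<open>4 * \<epsilon>\<close>.\<close>
  define \<epsilon> where "\<epsilon> = \<delta> / 4"
  have \<epsilon>: "\<epsilon> > 0" using \<delta> by (simp add: \<epsilon>_def)
  have "\<forall>i\<in>\<Phi>. \<exists>s. \<forall>g\<in>G. \<forall>u\<in>U s. \<bar>snd i g - snd i (g \<circ> u)\<bar> < \<epsilon>"
    using \<Phi> LUC_unif[OF _ \<epsilon>] by (auto simp: mem_Times_iff subset_iff)
  then obtain s where s: "\<And>i g u. i \<in> \<Phi> \<Longrightarrow> g \<in> G \<Longrightarrow> u \<in> U (s i) \<Longrightarrow> \<bar>snd i g - snd i (g \<circ> u)\<bar> < \<epsilon>"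
    by metis
  \<comment> \<open>The sum bounds every level \<open>s i\<close>, so the Ramsey hypothesis applies
    to all the functions with the same \<open>n\<close>.\<close>
  obtain n where n: "(\<Sum>i\<in>\<Phi>. s i) \<le> n" "2 \<le> n" "((q ^ n) ^ (q ^ n)) ^ card \<Phi> < 2 ^ (q ^ (2 * (n - 2)))"
    using pattern_count_bound[OF q2] by blast
  let ?t = "(q ^ n) ^ (q ^ n)"
  have "\<exists>P. finite P \<and> card P \<le> ?t \<and>
    (\<forall>h\<in>G. \<exists>\<pi>\<in>P. \<forall>\<phi>\<in>F n. \<bar>fst i (rtrans (h \<circ> \<phi>) (snd i)) - \<pi> \<phi>\<bar> \<le> 2 * \<epsilon>)" if i: "i \<in> \<Phi>" for i
  proof (rule minimal_patterns[OF M _ _ \<epsilon> F_fin F_G, where s = "s i"])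
    have "i \<in> M \<times> L" using i \<Phi> by blast
    then show "fst i \<in> M" "snd i \<in> L" by (auto simp: mem_Times_iff)
    show "\<bar>snd i g - snd i (g \<circ> u)\<bar> \<le> \<epsilon>" if "g \<in> G" "u \<in> U (s i)" for g u
      using s[OF i that] by simp
    have "s i \<le> n" using n(1) member_le_sum[OF i, of s] \<Phi>(1) by simp
    then show "\<exists>g\<in>G. card ((\<lambda>h. \<lambda>\<phi>\<in>F n. c (g \<circ> h \<circ> \<phi>)) ` D) \<le> ?t"
      if "\<And>g. g \<in> G \<Longrightarrow> c g < (r::nat)" "\<And>g u. g \<in> G \<Longrightarrow> u \<in> U (s i) \<Longrightarrow> c (g \<circ> u) = c g" "finite D" "D \<subseteq> G"
      for r c D using that by (intro ramsey[OF n(2)])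
  qed
  then obtain P where P: "\<And>i. i \<in> \<Phi> \<Longrightarrow> finite (P i)" "\<And>i. i \<in> \<Phi> \<Longrightarrow> card (P i) \<le> ?t"
    "\<And>i h. i \<in> \<Phi> \<Longrightarrow> h \<in> G \<Longrightarrow> \<exists>\<pi>\<in>P i. \<forall>\<phi>\<in>F n. \<bar>fst i (rtrans (h \<circ> \<phi>) (snd i)) - \<pi> \<phi>\<bar> \<le> 2 * \<epsilon>"
    by metis
  define h where "h \<sigma> = \<kappa> (code n \<sigma>) n" for \<sigma>
  have hG: "h \<sigma> \<in> G" for \<sigma> unfolding h_def by (rule \<kappa>_G[OF n(2) le_code])
  have "\<forall>\<sigma> i. \<exists>\<pi>. i \<in> \<Phi> \<longrightarrow> \<pi> \<in> P i \<and> (\<forall>\<phi>\<in>F n. \<bar>fst i (rtrans (h \<sigma> \<circ> \<phi>) (snd i)) - \<pi> \<phi>\<bar> \<le> 2 * \<epsilon>)"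
    using P(3)[OF _ hG] by blast
  then obtain \<pi> where \<pi>: "\<And>\<sigma> i. i \<in> \<Phi> \<Longrightarrow> \<pi> \<sigma> i \<in> P i"
    "\<And>\<sigma> i \<phi>. i \<in> \<Phi> \<Longrightarrow> \<phi> \<in> F n \<Longrightarrow> \<bar>fst i (rtrans (h \<sigma> \<circ> \<phi>) (snd i)) - \<pi> \<sigma> i \<phi>\<bar> \<le> 2 * \<epsilon>"
    by metis
  \<comment> \<open>There are more subsets of \<open>F n\<close> than tuples of patterns, so the
    translates belonging to two different subsets share all their patterns.\<close>
  have "\<not> inj_on (\<lambda>\<sigma>. \<lambda>i\<in>\<Phi>. \<pi> \<sigma> i) (Pow (F n))"
  proof
    assume "inj_on (\<lambda>\<sigma>. \<lambda>i\<in>\<Phi>. \<pi> \<sigma> i) (Pow (F n))"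
    then have "card (Pow (F n)) \<le> card (PiE \<Phi> P)"
      using \<pi>(1) P(1) \<Phi>(1) by (intro card_inj_on_le) (auto intro: finite_PiE)
    also have "\<dots> = (\<Prod>i\<in>\<Phi>. card (P i))" using \<Phi>(1) by (simp add: card_PiE)
    also have "\<dots> \<le> (\<Prod>i\<in>\<Phi>. ?t)" using P(2) by (intro prod_mono) auto
    also have "\<dots> = ?t ^ card \<Phi>" by simp
    also have "\<dots> < 2 ^ (q ^ (2 * (n - 2)))" by (rule n(3))
    also have "\<dots> \<le> 2 ^ card (F n)" using F_card[OF n(2)] by simp
    finally show False using F_fin by (simp add: card_Pow)
  qed
  then obtain \<sigma> \<tau> where st: "\<sigma> \<subseteq> F n" "\<tau> \<subseteq> F n" "\<sigma> \<noteq> \<tau>" "(\<lambda>i\<in>\<Phi>. \<pi> \<sigma> i) = (\<lambda>i\<in>\<Phi>. \<pi> \<tau> i)"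
    by (auto simp: inj_on_def)
  have eq: "\<pi> \<sigma> i = \<pi> \<tau> i" if "i \<in> \<Phi>" for i using fun_cong[OF st(4), of i] that by simp
  have close: "\<bar>x (rtrans (h \<sigma> \<circ> \<phi>) f) - x (rtrans (h \<tau> \<circ> \<phi>) f)\<bar> \<le> \<delta>" if "\<phi> \<in> F n" "(x, f) \<in> \<Phi>" for \<phi> x f
    using \<pi>(2)[OF that(2,1), of \<sigma>] \<pi>(2)[OF that(2,1), of \<tau>]
    unfolding eq[OF that(2)] fst_conv snd_conv \<epsilon>_def by linarith
  \<comment> \<open>At an element where the two subsets differ, one translate lies in
    \<open>S\<close> and the other does not, while the patterns give nearly equal
    coefficients.\<close>
  obtain \<phi> where \<phi>: "\<phi> \<in> F n" "\<phi> \<in> \<sigma> \<longleftrightarrow> \<phi> \<notin> \<tau>" using st by blast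
  have in_S: "h \<sigma> \<circ> \<phi> \<in> S \<longleftrightarrow> \<phi> \<in> \<sigma>" "h \<tau> \<circ> \<phi> \<in> S \<longleftrightarrow> \<phi> \<in> \<tau>"
    unfolding h_def using st \<phi> n by (simp_all add: S_shatter)
  have in_G: "h \<sigma> \<circ> \<phi> \<in> G" "h \<tau> \<circ> \<phi> \<in> G" using hG F_G \<phi> by (auto intro!: comp_G simp: subset_iff)
  show ?thesis
  proof (cases "\<phi> \<in> \<sigma>")
    case True
    then have "h \<sigma> \<circ> \<phi> \<in> S" "h \<tau> \<circ> \<phi> \<in> G - S" using \<phi> in_S in_G by auto
    then show ?thesis using close[OF \<phi>(1)] by blast
  next
    case False
    then have "h \<tau> \<circ> \<phi> \<in> S" "h \<sigma> \<circ> \<phi> \<in> G - S" using \<phi> in_S in_G by auto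
    moreover have "\<bar>x (rtrans (h \<tau> \<circ> \<phi>) f) - x (rtrans (h \<sigma> \<circ> \<phi>) f)\<bar> \<le> \<delta>" if "(x, f) \<in> \<Phi>" for x f
      using close[OF \<phi>(1) that] by (simp add: abs_minus_commute)
    ultimately show ?thesis by blast
  qed
qed

text \<open>Equivariance at the base point gives \<open>H (act pt g) x f = x (rtrans g f)\<close>,
  so \<open>H z x f\<close> extends a coefficient continuously from the group to all of
  \<open>S(G)\<close>. Two points with equal coefficients therefore have the same image under
  \<open>H\<close>, against its injectivity.\<close>

theorem not_iso: "S_not_iso_EM G (\<circ>) inv id T"
  unfolding S_not_iso_EM_def Let_def
proof (intro allI impI notI)
  fix M assume M: "minimal_subflow ST act G M"
  let ?X = "subtopology ST M"
  have MS: "M \<subseteq> SG" and Mne: "M \<noteq> {}" using M by (auto simp: minimal_subflow_def)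
  then have top: "topspace ?X = M" by auto
  assume "ambit_iso G ST act pt (env_top ?X act G) (env_act ?X act) (env_pt ?X)"
  then obtain H where H: "homeomorphic_map ST (env_top ?X act G) H" and Hpt: "H pt = env_pt ?X"
    and Hact: "\<And>x g. x \<in> SG \<Longrightarrow> g \<in> G \<Longrightarrow> H (act x g) = env_act ?X act (H x) g"
    by (auto simp: ambit_iso_def)
  have Hg: "H (act pt g) x f = x (rtrans g f)" if "g \<in> G" "x \<in> M" "f \<in> L" for g x f
    using Hact[OF pt_SG that(1)] that by (simp add: Hpt env_act_def env_pt_def top act_apply del: topspace_subtopology)
  have Hcont: "continuous_map ST (product_topology (\<lambda>_. ?X) M) H"
    using homeomorphic_imp_continuous_map[OF H] unfolding env_top_def top by (rule continuous_map_into_fulltopology)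
  have Hev: "continuous_map ST euclideanreal (\<lambda>z. H z x f)" if "x \<in> M" "f \<in> L" for x f
  proof -
    have "continuous_map ST ?X (\<lambda>z. H z x)"
      using continuous_map_compose[OF Hcont continuous_map_product_projection[OF that(1)]] by (simp add: o_def)
    then have "continuous_map ST ST (\<lambda>z. H z x)" by (rule continuous_map_into_fulltopology)
    from continuous_map_compose[OF this continuous_eval[OF that(2)]] show ?thesis by (simp add: o_def)
  qed
  let ?Y = "prod_topology ST ST"
  let ?I = "M \<times> L \<times> {0::real<..}"
  \<comment> \<open>The conditions on \<open>indS\<close> are closed, so they persist in the limit
    and keep the two points distinct; the tolerance \<open>d\<close> is part of the index so that
    all coefficients agree exactly in the intersection.\<close>
  define K where "K = (\<lambda>(x,f,d). {z \<in> topspace ?Y. fst z indS \<in> {1}} \<inter> {z \<in> topspace ?Y. snd z indS \<in> {0}} \<inter>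
    {z \<in> topspace ?Y. H (fst z) x f - H (snd z) x f \<in> {-d..d}})"
  have "\<Inter>(K ` ?I) \<noteq> {}"
  proof (rule compact_space_INT_nonempty)
    show "compact_space ?Y" by (simp add: compact_space_prod_topology compact_ST)
    have f: "continuous_map ?Y euclideanreal (\<lambda>z. a (fst z))" and s: "continuous_map ?Y euclideanreal (\<lambda>z. a (snd z))"
      if "continuous_map ST euclideanreal a" for a :: "((('a \<Rightarrow> 'a) \<Rightarrow> real) \<Rightarrow> real) \<Rightarrow> real"
      using continuous_map_compose[OF continuous_map_fst that] continuous_map_compose[OF continuous_map_snd that]
      by (simp_all add: o_def)
    have "closedin ?Y (K (x, f, d))" if "x \<in> M" "f \<in> L" for x f d
      unfolding K_def prod.case
      by (intro closedin_Int closedin_continuous_map_preimage[OF f[OF continuous_eval[OF indS_LUC]]]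
          closedin_continuous_map_preimage[OF s[OF continuous_eval[OF indS_LUC]]]
          closedin_continuous_map_preimage[OF continuous_map_diff[OF f[OF Hev] s[OF Hev]]] that) auto
    then show "closedin ?Y (K i)" if "i \<in> ?I" for i using that by (cases i) auto
    fix D assume D: "finite D" "D \<subseteq> ?I" "D \<noteq> {}"
    let ?\<Phi> = "(\<lambda>(x,f,d). (x,f)) ` D"
    let ?d = "Min ((\<lambda>(x,f,d). d) ` D)"
    have dpos: "?d > 0" using D by (subst Min_gr_iff) auto
    have "?\<Phi> \<subseteq> M \<times> L" "finite ?\<Phi>" using D by auto
    from close_pair[OF M this(2,1) dpos] obtain g g' where g: "g \<in> S" "g' \<in> G - S" and
      gc: "\<And>x f. (x,f) \<in> ?\<Phi> \<Longrightarrow> \<bar>x (rtrans g f) - x (rtrans g' f)\<bar> \<le> ?d" by blast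
    have gG: "g \<in> G" using g S_G by blast
    have "(act pt g, act pt g') \<in> K (x, f, d)" if i: "(x, f, d) \<in> D" for x f d
    proof -
      have xf: "x \<in> M" "f \<in> L" using i D by auto
      have "\<bar>x (rtrans g f) - x (rtrans g' f)\<bar> \<le> ?d" by (rule gc) (use i in force)
      also have "?d \<le> d" by (rule Min_le) (use D i in force)+
      finally have "\<bar>x (rtrans g f) - x (rtrans g' f)\<bar> \<le> d" .
      then show ?thesis
        using act_SG[OF pt_SG] gG g xf by (simp add: K_def Hg act_pt_apply indS_LUC abs_le_iff) (simp add: indS_def)
    qed
    then show "\<Inter>(K ` D) \<noteq> {}" by fastforce
  qed
  then obtain z where z: "\<And>x f d. x \<in> M \<Longrightarrow> f \<in> L \<Longrightarrow> d > 0 \<Longrightarrow> z \<in> K (x, f, d)" by fastforce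
  obtain a b where ab: "z = (a, b)" by fastforce
  obtain x0 where "x0 \<in> M" using Mne by blast
  from z[OF this LUC_cst zero_less_one] have S: "a \<in> SG" "b \<in> SG" "a indS = 1" "b indS = 0"
    by (auto simp: K_def ab)
  have eq: "H a x f = H b x f" if "x \<in> M" "f \<in> L" for x f
  proof -
    have "\<bar>H a x f - H b x f\<bar> \<le> d" if "d > 0" for d
      using z[OF \<open>x \<in> M\<close> \<open>f \<in> L\<close> that] by (auto simp: K_def ab abs_le_iff)
    then have "\<bar>H a x f - H b x f\<bar> \<le> 0" by (rule dense_ge)
    then show ?thesis by simp
  qed
  have HPi: "H c \<in> PiE M (\<lambda>_. M)" if "c \<in> SG" for c
    using continuous_map_image_subset_topspace[OF Hcont] that MS by (auto simp: image_subset_iff PiE_def Pi_def)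
  have "H a = H b"
  proof (rule PiE_ext[OF HPi HPi])
    fix x assume x: "x \<in> M"
    then have "H a x \<in> SG" "H b x \<in> SG" using HPi S MS by (auto simp: PiE_def Pi_def)
    then show "H a x = H b x" by (rule SG_ext) (rule eq[OF x])
  qed (use S in auto)
  then have "a = b" using homeomorphic_imp_injective_map[OF H] S by (auto simp: inj_on_def)
  then show False using S by simp
qed

end

lemma card_image_factor:
  assumes "finite D" and "\<And>h h'. h \<in> D \<Longrightarrow> h' \<in> D \<Longrightarrow> k h = k h' \<Longrightarrow> p h = p h'"
  shows "card (p ` D) \<le> card (k ` D)"
proof -
  have "p h = p (inv_into D k (k h))" if "h \<in> D" for h
    by (rule assms(2)[OF that]) (use that in \<open>auto intro: inv_into_into simp: f_inv_into_f\<close>)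
  then have "p ` D = (\<lambda>y. p (inv_into D k y)) ` k ` D" by (auto simp: image_image)
  then show ?thesis using assms(1) by (metis card_image_le finite_imageI)
qed

text \<open>Read \<open>v h\<close> as the word describing \<open>h\<close> and \<open>e \<phi>\<close> as the action of \<open>\<phi>\<close> on letters: the colour of
  \<open>g h \<phi>\<close> is a function of the word that \<open>w\<close> substitutes into the word of \<open>h \<phi>\<close>.\<close>
lemma word_patterns:
  fixes v :: "'h \<Rightarrow> 'l list" and e :: "'p \<Rightarrow> 'l \<Rightarrow> 'm" and c :: "'g \<Rightarrow> 'h \<Rightarrow> 'p \<Rightarrow> nat"
  assumes D: "finite D" and A: "finite A"
    and v: "\<And>h. h \<in> D \<Longrightarrow> length (v h) = len" "\<And>h. h \<in> D \<Longrightarrow> set (v h) = A"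
    and e: "\<And>\<phi>. \<phi> \<in> F \<Longrightarrow> e \<phi> ` A = B"
    and c: "\<And>g h \<phi>. g \<in> G \<Longrightarrow> h \<in> D \<Longrightarrow> \<phi> \<in> F \<Longrightarrow> c g h \<phi> < r"
    and \<Gamma>: "\<And>N. \<exists>\<Gamma>. \<forall>w. length w = N \<longrightarrow> set w = {..<len} \<longrightarrow>
       (\<exists>g\<in>G. \<forall>h\<in>D. \<forall>\<phi>\<in>F. c g h \<phi> = \<Gamma> (map (\<lambda>i. e \<phi> (v h ! i)) w))"
    and ne: "F \<noteq> {}"
  shows "\<exists>g\<in>G. card ((\<lambda>h. \<lambda>\<phi>\<in>F. c g h \<phi>) ` D) \<le> card A ^ card A"
proof -
  obtain \<phi> where "\<phi> \<in> F" using ne by blast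
  from e[OF this] have "finite B" using A by auto
  from dual_Ramsey[OF this finite_atMost[of r], of len] obtain N where
    N: "\<forall>\<Gamma> :: 'm list \<Rightarrow> nat. (\<forall>w. \<Gamma> w \<in> {..r}) \<longrightarrow>
    (\<exists>w. length w = N \<and> set w = {..<len} \<and>
      (\<forall>a b. length a = len \<and> length b = len \<and> set a = B \<and> set b = B \<and> first_occ a = first_occ b \<longrightarrow>
        \<Gamma> (map ((!) a) w) = \<Gamma> (map ((!) b) w)))" ..
  from \<Gamma>[of N] obtain \<Gamma> where \<Gamma>: "\<forall>w. length w = N \<longrightarrow> set w = {..<len} \<longrightarrow>
       (\<exists>g\<in>G. \<forall>h\<in>D. \<forall>\<phi>\<in>F. c g h \<phi> = \<Gamma> (map (\<lambda>i. e \<phi> (v h ! i)) w))" ..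
  \<comment> \<open>Bounds on \<open>\<Gamma>\<close> are available only for words that come from
    group elements. Truncation at \<open>r\<close> yields a finite colouring of all words and
    changes none of the relevant values.\<close>
  have "\<forall>w. min (\<Gamma> w) r \<in> {..r}" by simp
  from N[THEN spec, THEN mp, OF this] obtain w where w: "length w = N" "set w = {..<len}" and
    wc: "\<And>a b. length a = len \<Longrightarrow> length b = len \<Longrightarrow> set a = B \<Longrightarrow> set b = B \<Longrightarrow> first_occ a = first_occ b \<Longrightarrow>
        min (\<Gamma> (map ((!) a) w)) r = min (\<Gamma> (map ((!) b) w)) r"
    by blast
  from \<Gamma> w obtain g where g: "g \<in> G" and gc: "\<And>h \<phi>. h \<in> D \<Longrightarrow> \<phi> \<in> F \<Longrightarrow>
      c g h \<phi> = \<Gamma> (map (\<lambda>i. e \<phi> (v h ! i)) w)" by blast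
  have eq: "c g h \<phi> = min (\<Gamma> (map (\<lambda>i. map (e \<phi>) (v h) ! i) w)) r" if "h \<in> D" "\<phi> \<in> F" for h \<phi>
  proof -
    have "map (\<lambda>i. map (e \<phi>) (v h) ! i) w = map (\<lambda>i. e \<phi> (v h ! i)) w" using w(2) v(1)[OF that(1)] by auto
    with gc[OF that] c[OF g that] show ?thesis by (simp only: min.absorb1 less_imp_le)
  qed
  \<comment> \<open>The order of first occurrence in \<open>v h\<close> determines the order after
    every renaming \<open>e \<phi>\<close>, hence the colours for all \<open>\<phi>\<close>
    together.\<close>
  have "card ((\<lambda>h. \<lambda>\<phi>\<in>F. c g h \<phi>) ` D) \<le> card ((\<lambda>h. first_occ (v h)) ` D)"
  proof (rule card_image_factor[OF D])
    fix h h' assume h: "h \<in> D" "h' \<in> D" "first_occ (v h) = first_occ (v h')"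
    have "c g h \<phi> = c g h' \<phi>" if \<phi>: "\<phi> \<in> F" for \<phi>
      unfolding eq[OF h(1) \<phi>] eq[OF h(2) \<phi>]
      using h v e[OF \<phi>] by (intro wc) (simp_all add: first_occ_map[of _ "v h"] first_occ_map[of _ "v h'"])
    then show "(\<lambda>\<phi>\<in>F. c g h \<phi>) = (\<lambda>\<phi>\<in>F. c g h' \<phi>)" by (auto simp: restrict_def)
  qed
  also have "\<dots> \<le> card {xs. set xs \<subseteq> A \<and> length xs = card A}"
    using v(2) A by (intro card_mono finite_lists_length_eq) (auto simp: length_first_occ)
  also have "\<dots> = card A ^ card A" by (rule card_lists_length_eq[OF A])
  finally show ?thesis using g by blast
qed

section \<open>The homeomorphism group of the Cantor space\<close>

type_synonym cmap = "(nat \<Rightarrow> bool) \<Rightarrow> nat \<Rightarrow> bool"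

definition agree :: "nat \<Rightarrow> (nat \<Rightarrow> 'b) \<Rightarrow> (nat \<Rightarrow> 'b) \<Rightarrow> bool" where
  "agree n x y \<longleftrightarrow> (\<forall>i<n. x i = y i)"

lemma agree_refl [simp]: "agree n x x"
  by (simp add: agree_def)

lemma agree_sym: "agree n x y \<Longrightarrow> agree n y x"
  by (simp add: agree_def)

lemma agree_trans: "agree n x y \<Longrightarrow> agree n y z \<Longrightarrow> agree n x z"
  by (simp add: agree_def)

lemma agree_mono: "agree n x y \<Longrightarrow> m \<le> n \<Longrightarrow> agree m x y"
  by (simp add: agree_def)

lemma agree_iff_map: "agree n x y \<longleftrightarrow> map x [0..<n] = map y [0..<n]"
  by (auto simp: agree_def)

text \<open>Uniform continuity in terms of coordinates; by compactness it agrees with continuity,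
  and it provides the levels needed to read maps as finite words.\<close>

definition unif :: "((nat \<Rightarrow> bool) \<Rightarrow> (nat \<Rightarrow> bool)) \<Rightarrow> bool" where
  "unif g \<longleftrightarrow> (\<forall>n. \<exists>L. \<forall>x y. agree L x y \<longrightarrow> agree n (g x) (g y))"

lemma unifD: "unif g \<Longrightarrow> \<exists>L. \<forall>x y. agree L x y \<longrightarrow> agree n (g x) (g y)"
  unfolding unif_def by (erule spec)

lemma topspace_cantor [simp]: "topspace cantor_top = UNIV"
  by (simp add: cantor_top_def)

lemma openin_cantor: "openin cantor_top W \<longleftrightarrow> (\<forall>x\<in>W. \<exists>n. \<forall>y. agree n x y \<longrightarrow> y \<in> W)"
proof
  assume W: "openin cantor_top W"
  show "\<forall>x\<in>W. \<exists>n. \<forall>y. agree n x y \<longrightarrow> y \<in> W"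
  proof
    fix x assume "x \<in> W"
    with W obtain V where V: "finite {i. V i \<noteq> (UNIV :: bool set)}" "x \<in> PiE UNIV V" "PiE UNIV V \<subseteq> W"
      unfolding cantor_top_def openin_product_topology_alt by fastforce
    obtain n where n: "\<forall>i\<in>{i. V i \<noteq> UNIV}. i < n" using V(1) finite_nat_set_iff_bounded by blast
    have "y \<in> W" if "agree n x y" for y
    proof -
      have "y i \<in> V i" for i
      proof (cases "V i = UNIV")
        case False
        with n that have "y i = x i" by (auto simp: agree_def)
        then show ?thesis using V(2) by (auto simp: PiE_iff)
      qed simp
      then show ?thesis using V(3) by (auto simp: PiE_iff)
    qed
    then show "\<exists>n. \<forall>y. agree n x y \<longrightarrow> y \<in> W" by blast
  qed
next
  assume W: "\<forall>x\<in>W. \<exists>n. \<forall>y. agree n x y \<longrightarrow> y \<in> W"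
  show "openin cantor_top W"
    unfolding cantor_top_def openin_product_topology_alt
  proof (intro conjI ballI)
    fix x assume "x \<in> W"
    with W obtain n where n: "\<forall>y. agree n x y \<longrightarrow> y \<in> W" by blast
    let ?V = "\<lambda>i. if i < n then {x i} else UNIV"
    have "{i. ?V i \<noteq> UNIV} \<subseteq> {..<n}" by auto
    then have "finite {i. ?V i \<noteq> UNIV}" by (rule finite_subset) simp
    moreover have "PiE UNIV ?V \<subseteq> W"
    proof
      fix y assume "y \<in> PiE UNIV ?V"
      then have y: "y i \<in> ?V i" for i by (simp add: PiE_iff)
      have "x i = y i" if "i < n" for i using y[of i] that by simp
      then show "y \<in> W" using n by (simp add: agree_def)
    qed
    moreover have "x \<in> PiE UNIV ?V" by (simp add: PiE_iff)
    ultimately show "\<exists>V. finite {i \<in> UNIV. V i \<noteq> topspace (discrete_topology UNIV)} \<and>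
      (\<forall>i\<in>UNIV. openin (discrete_topology UNIV) (V i)) \<and> x \<in> PiE UNIV V \<and> PiE UNIV V \<subseteq> W"
      by (intro exI[of _ ?V]) simp
  qed
qed

lemma openin_cantorD: "openin cantor_top W \<Longrightarrow> x \<in> W \<Longrightarrow> \<exists>n. \<forall>y. agree n x y \<longrightarrow> y \<in> W"
  unfolding openin_cantor by (erule bspec)

lemma openin_cylinder: "openin cantor_top {y. agree n x y}"
  unfolding openin_cantor by (auto intro: agree_trans)

lemma compact_cantor: "compact_space cantor_top"
  by (simp add: cantor_top_def compact_space_product_topology compact_space_discrete_topology)

text \<open>A Lebesgue number argument: the sum of the levels in a finite subcover is a common
  level, by monotonicity of \<open>P\<close>.\<close>

lemma cantor_uniform:
  assumes K: "compactin cantor_top K" and ex: "\<And>x. x \<in> K \<Longrightarrow> \<exists>n. \<forall>y. agree n x y \<longrightarrow> P n y"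
    and mono: "\<And>m n y. P m y \<Longrightarrow> m \<le> n \<Longrightarrow> P n y"
  shows "\<exists>n. \<forall>y\<in>K. P n y"
proof -
  from ex obtain n where n: "\<And>x y. x \<in> K \<Longrightarrow> agree (n x) x y \<Longrightarrow> P (n x) y" by metis
  let ?C = "\<lambda>x. {y. agree (n x) x y}"
  have "\<forall>W\<in>?C ` K. openin cantor_top W" using openin_cylinder by blast
  moreover have "K \<subseteq> \<Union>(?C ` K)" by auto
  ultimately obtain \<F> where fin: "finite \<F>" "\<F> \<subseteq> ?C ` K" and cov: "K \<subseteq> \<Union>\<F>"
    using K unfolding compactin_def by meson
  from finite_subset_image[OF fin] obtain D where D': "D \<subseteq> K" "finite D" "\<F> = ?C ` D" by blast
  note D = D'(2,1) cov[unfolded D'(3)]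
  have "P (\<Sum>x\<in>D. n x) y" if yK: "y \<in> K" for y
  proof -
    obtain x where x: "x \<in> D" "agree (n x) x y" using D(3) yK by auto
    have "n x \<le> (\<Sum>x\<in>D. n x)" using x D by (intro member_le_sum) auto
    then show ?thesis using mono[OF n[OF _ x(2)]] x(1) D(2) by blast
  qed
  then show ?thesis by blast
qed

lemma continuous_imp_unif:
  assumes "continuous_map cantor_top cantor_top g" shows "unif g"
  unfolding unif_def
proof
  fix n
  have "\<exists>L. \<forall>y\<in>UNIV. \<forall>z. agree L y z \<longrightarrow> agree n (g y) (g z)"
  proof (rule cantor_uniform)
    show "compactin cantor_top UNIV" using compact_cantor by (simp add: compact_space_def)
    fix x
    have "openin cantor_top {y \<in> topspace cantor_top. g y \<in> {y. agree n (g x) y}}"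
      by (rule openin_continuous_map_preimage[OF assms openin_cylinder])
    from openin_cantorD[OF this, of x] obtain L where L: "\<forall>y. agree L x y \<longrightarrow> agree n (g x) (g y)" by auto
    have "agree n (g y) (g z)" if "agree L x y" "agree L y z" for y z
      using L that agree_trans agree_sym by meson
    then show "\<exists>L. \<forall>y. agree L x y \<longrightarrow> (\<forall>z. agree L y z \<longrightarrow> agree n (g y) (g z))" by blast
  qed (use agree_mono in blast)
  then show "\<exists>L. \<forall>x y. agree L x y \<longrightarrow> agree n (g x) (g y)" by blast
qed

lemma unif_imp_continuous:
  assumes "unif g" shows "continuous_map cantor_top cantor_top g"
  unfolding continuous_map_def
proof (intro conjI allI impI)
  fix W assume W: "openin cantor_top W"
  show "openin cantor_top {x \<in> topspace cantor_top. g x \<in> W}"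
    unfolding openin_cantor
  proof (intro ballI)
    fix x assume "x \<in> {x \<in> topspace cantor_top. g x \<in> W}"
    then obtain n where n: "\<forall>y. agree n (g x) y \<longrightarrow> y \<in> W" using W by (auto simp: openin_cantor)
    obtain L where "\<forall>x y. agree L x y \<longrightarrow> agree n (g x) (g y)" using unifD[OF assms] ..
    then show "\<exists>n. \<forall>y. agree n x y \<longrightarrow> y \<in> {x \<in> topspace cantor_top. g x \<in> W}"
      using n by (intro exI[of _ L]) simp
  qed
qed auto

lemma homeo_cantorI:
  assumes "unif g" "unif g'" "\<And>x. g (g' x) = x" "\<And>x. g' (g x) = x"
  shows "g \<in> homeo_cantor"
proof -
  have "homeomorphic_maps cantor_top cantor_top g g'"
    using assms by (simp add: homeomorphic_maps_def unif_imp_continuous)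
  then show ?thesis unfolding homeo_cantor_def homeomorphic_map_maps by blast
qed

lemma homeo_cantorD:
  assumes "g \<in> homeo_cantor" shows "bij g" "unif g" "unif (inv g)"
proof -
  obtain g' where g': "homeomorphic_maps cantor_top cantor_top g g'"
    using assms unfolding homeo_cantor_def homeomorphic_map_maps by blast
  then have *: "\<And>x. g (g' x) = x" "\<And>x. g' (g x) = x" by (auto simp: homeomorphic_maps_def)
  then show "bij g" by (metis bijI')
  have "inv g = g'" using * by (intro inv_unique_comp) auto
  then show "unif g" "unif (inv g)"
    using g' by (auto simp: homeomorphic_maps_def intro: continuous_imp_unif)
qed

lemma homeo_cantor_iff: "g \<in> homeo_cantor \<longleftrightarrow> bij g \<and> unif g \<and> unif (inv g)"
proof
  assume "bij g \<and> unif g \<and> unif (inv g)"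
  then show "g \<in> homeo_cantor"
    by (intro homeo_cantorI[of g "inv g"]) (auto simp: bij_is_inj bij_is_surj surj_f_inv_f)
qed (use homeo_cantorD in blast)

lemma unif_comp: "unif f \<Longrightarrow> unif g \<Longrightarrow> unif (f \<circ> g)"
  unfolding unif_def by (metis comp_apply)

lemma homeo_cantor_comp: "g \<in> homeo_cantor \<Longrightarrow> h \<in> homeo_cantor \<Longrightarrow> g \<circ> h \<in> homeo_cantor"
  unfolding homeo_cantor_iff by (simp add: bij_comp unif_comp o_inv_distrib)

lemma homeo_cantor_inv: "g \<in> homeo_cantor \<Longrightarrow> inv g \<in> homeo_cantor"
  unfolding homeo_cantor_iff by (simp add: bij_imp_bij_inv inv_inv_eq)

lemma homeo_cantor_id: "id \<in> homeo_cantor"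
  by (intro homeo_cantorI[of id id]) (auto simp: unif_def)

text \<open>The homeomorphisms that preserve every cylinder of level \<open>s\<close>.\<close>

definition UC :: "nat \<Rightarrow> cmap set" where
  "UC s = {g \<in> homeo_cantor. \<forall>x. agree s (g x) x}"

lemma UC_sub: "UC s \<subseteq> homeo_cantor"
  by (auto simp: UC_def)

lemma UC_id: "id \<in> UC s"
  by (simp add: UC_def homeo_cantor_id)

text \<open>There are finitely many cylinders of level \<open>s\<close>, and each is compact and
  open, so mapping it into itself is a subbasic condition.\<close>

lemma UC_open: "openin homeo_cantor_top (UC s)"
proof -
  let ?C = "\<lambda>e :: bool list. {x :: nat \<Rightarrow> bool. map x [0..<s] = e}"
  let ?B = "\<lambda>e. {f :: (nat \<Rightarrow> bool) \<Rightarrow> (nat \<Rightarrow> bool). f ` ?C e \<subseteq> ?C e}"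
  let ?E = "{e :: bool list. set e \<subseteq> UNIV \<and> length e = s}"
  have op: "openin cantor_top (?C e)" for e
    unfolding openin_cantor by (intro ballI exI[of _ s]) (auto simp: agree_def)
  have "openin cantor_top (- ?C e)" for e
    unfolding openin_cantor by (intro ballI exI[of _ s]) (auto simp: agree_def)
  then have "closedin cantor_top (?C e)" for e by (simp add: closedin_def Compl_eq_Diff_UNIV)
  then have "compactin cantor_top (?C e)" for e using closedin_compact_space compact_cantor by blast
  then have "openin (compact_open cantor_top cantor_top) (?B e)" for e
    unfolding compact_open_def using op by (intro topology_generated_by_Basis) blast
  moreover have "finite ?E" by (rule finite_lists_length_eq) simp
  moreover have "\<exists>e :: bool list. length e = s" by (rule Ex_list_of_length)
  ultimately have "openin (compact_open cantor_top cantor_top) (\<Inter>e\<in>?E. ?B e)"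
    by (intro openin_Inter) auto
  moreover have "UC s = (\<Inter>e\<in>?E. ?B e) \<inter> homeo_cantor"
  proof -
    have "(\<forall>x. agree s (g x) x) \<longleftrightarrow> g \<in> (\<Inter>e\<in>?E. ?B e)" for g :: cmap
    proof
      assume "\<forall>x. agree s (g x) x"
      then have "map (g x) [0..<s] = map x [0..<s]" for x unfolding agree_iff_map ..
      then show "g \<in> (\<Inter>e\<in>?E. ?B e)" by (intro INT_I CollectI subsetI) (elim imageE CollectE, simp only:)
    next
      assume g: "g \<in> (\<Inter>e\<in>?E. ?B e)"
      show "\<forall>x. agree s (g x) x"
      proof
        fix x
        have "g \<in> ?B (map x [0..<s])" by (rule INT_D[OF g]) simp
        then have "g x \<in> ?C (map x [0..<s])" by blast
        then show "agree s (g x) x" unfolding agree_iff_map by (rule CollectD)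
      qed
    qed
    then show ?thesis unfolding UC_def by blast
  qed
  ultimately show ?thesis unfolding homeo_cantor_top_def openin_subtopology by blast
qed

text \<open>A compact \<open>K\<close> inside an open \<open>V\<close> has a uniform margin: for
  some \<open>n\<close> every point that shares \<open>n\<close> coordinates with a point of
  \<open>K\<close> lies in \<open>V\<close>. The rest is induction over the generation of the
  topology.\<close>

lemma UC_basis:
  assumes "openin homeo_cantor_top W" "id \<in> W"
  shows "\<exists>s. UC s \<subseteq> W"
proof -
  obtain W' where W': "openin (compact_open cantor_top cantor_top) W'" "W = W' \<inter> homeo_cantor"
    using assms(1) unfolding homeo_cantor_top_def openin_subtopology by blast
  have "generate_topology_on {{f. f ` K \<subseteq> V} | K V. compactin cantor_top K \<and> openin cantor_top V} W'"
    using W'(1) unfolding compact_open_def openin_topology_generated_by_iff .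
  then have "id \<in> W' \<longrightarrow> (\<exists>s. UC s \<subseteq> W')"
  proof induction
    case (Int a b)
    have mono: "UC n \<subseteq> UC m" if "m \<le> n" for m n using that by (auto simp: UC_def intro: agree_mono)
    show ?case
    proof
      assume "id \<in> a \<inter> b"
      with Int obtain m n where "UC m \<subseteq> a" "UC n \<subseteq> b" by blast
      then have "UC (max m n) \<subseteq> a \<inter> b" using mono[of m "max m n"] mono[of n "max m n"] by auto
      then show "\<exists>s. UC s \<subseteq> a \<inter> b" by blast
    qed
  next
    case (Basis B)
    then obtain K V where B: "B = {f. f ` K \<subseteq> V}" "compactin cantor_top K" "openin cantor_top V" by blast
    show ?case
    proof
      assume "id \<in> B"
      then have KV: "K \<subseteq> V" by (auto simp: B)
      have "\<exists>n. \<forall>y\<in>K. \<forall>z. agree n y z \<longrightarrow> z \<in> V"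
      proof (rule cantor_uniform[OF B(2)])
        fix x assume "x \<in> K"
        with KV have "x \<in> V" by blast
        from openin_cantorD[OF B(3) this] obtain n where n: "\<forall>y. agree n x y \<longrightarrow> y \<in> V" ..
        have "z \<in> V" if "agree n x y" "agree n y z" for y z using n that agree_trans by blast
        then show "\<exists>n. \<forall>y. agree n x y \<longrightarrow> (\<forall>z. agree n y z \<longrightarrow> z \<in> V)" by blast
      qed (use agree_mono in blast)
      then obtain n where "\<forall>y\<in>K. \<forall>z. agree n y z \<longrightarrow> z \<in> V" by blast
      then have "UC n \<subseteq> B" by (auto simp: UC_def B intro: agree_sym)
      then show "\<exists>s. UC s \<subseteq> B" by blast
    qed
  qed blast+
  then obtain s where "UC s \<subseteq> W'" using assms(2) W' by blast
  then have "UC s \<subseteq> W" using W' by (auto simp: UC_def)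
  then show ?thesis ..
qed

lemma UC_conj:
  assumes g: "g \<in> homeo_cantor" shows "\<exists>t. \<forall>u\<in>UC t. inv g \<circ> u \<circ> g \<in> UC s"
proof -
  from unifD[OF homeo_cantorD(3)[OF g]] obtain L
    where L: "\<forall>x y. agree L x y \<longrightarrow> agree s (inv g x) (inv g y)" ..
  have "inv g \<circ> u \<circ> g \<in> UC s" if "u \<in> UC L" for u
  proof -
    have u: "u \<in> homeo_cantor" "\<And>x. agree L (u x) x" using that by (auto simp: UC_def)
    have "inv g (g x) = x" for x using homeo_cantorD(1)[OF g] by (simp add: bij_is_inj)
    then have "agree s ((inv g \<circ> u \<circ> g) x) x" for x using L[rule_format, of "u (g x)" "g x"] u(2) by simp
    then show ?thesis using g u(1) by (simp add: UC_def homeo_cantor_comp homeo_cantor_inv)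
  qed
  then show ?thesis by blast
qed

interpretation cantor: nonarch_group homeo_cantor homeo_cantor_top UC
proof
  show "inv g \<in> UC s" if "g \<in> UC s" for g s
  proof -
    have g: "g \<in> homeo_cantor" "\<And>x. agree s (g x) x" using that by (auto simp: UC_def)
    have "g (inv g x) = x" for x using homeo_cantorD(1)[OF g(1)] by (simp add: bij_is_surj surj_f_inv_f)
    then have "agree s (inv g x) x" for x using g(2)[of "inv g x"] by (simp add: agree_sym)
    then show ?thesis using g by (simp add: UC_def homeo_cantor_inv)
  qed
  show "g \<circ> h \<in> UC s" if "g \<in> UC s" "h \<in> UC s" for g h s
    using that by (auto simp: UC_def homeo_cantor_comp intro: agree_trans)
qed (simp_all add: homeo_cantor_id homeo_cantor_comp homeo_cantor_inv homeo_cantorD(1) UC_open UC_basis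
    UC_conj UC_sub UC_id del: id_apply)

section \<open>Complete prefix codes and prefix replacement\<close>

definition pre :: "bool list \<Rightarrow> (nat \<Rightarrow> bool) \<Rightarrow> bool" where
  "pre e x \<longleftrightarrow> (\<forall>j<length e. x j = e ! j)"

definition app :: "bool list \<Rightarrow> (nat \<Rightarrow> bool) \<Rightarrow> nat \<Rightarrow> bool" where
  "app e x = (\<lambda>j. if j < length e then e ! j else x (j - length e))"

definition dropn :: "nat \<Rightarrow> (nat \<Rightarrow> bool) \<Rightarrow> nat \<Rightarrow> bool" where
  "dropn n x = (\<lambda>j. x (j + n))"

lemma pre_app [simp]: "pre e (app e x)"
  by (simp add: pre_def app_def)

lemma dropn_app [simp]: "dropn (length e) (app e x) = x"
  by (simp add: dropn_def app_def fun_eq_iff)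

lemma app_dropn: "pre e x \<Longrightarrow> app e (dropn (length e) x) = x"
  by (auto simp: pre_def dropn_def app_def fun_eq_iff)

lemma pre_append: "pre (a @ b) x \<longleftrightarrow> pre a x \<and> pre b (dropn (length a) x)"
proof
  assume *: "pre (a @ b) x"
  have "x j = a ! j" if "j < length a" for j using * that by (auto simp: pre_def nth_append)
  moreover have "x (j + length a) = b ! j" if "j < length b" for j
    using *[unfolded pre_def, rule_format, of "j + length a"] that by (auto simp: nth_append)
  ultimately show "pre a x \<and> pre b (dropn (length a) x)" by (simp add: pre_def dropn_def)
next
  assume *: "pre a x \<and> pre b (dropn (length a) x)"
  show "pre (a @ b) x" unfolding pre_def
  proof (intro allI impI)
    fix j assume j: "j < length (a @ b)"
    show "x j = (a @ b) ! j"
    proof (cases "j < length a")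
      case False
      then have "j = (j - length a) + length a" by simp
      then have "x j = dropn (length a) x (j - length a)" by (simp add: dropn_def)
      then show ?thesis using * j False by (simp add: pre_def nth_append)
    qed (use * in \<open>auto simp: pre_def nth_append\<close>)
  qed
qed

definition complete_code :: "nat \<Rightarrow> (nat \<Rightarrow> bool list) \<Rightarrow> bool" where
  "complete_code N p \<longleftrightarrow> (\<forall>x. \<exists>!i. i < N \<and> pre (p i) x)"

text \<open>Between complete codes these are the elements of Thompson's group V.\<close>

definition prefix_map :: "nat \<Rightarrow> (nat \<Rightarrow> bool list) \<Rightarrow> (nat \<Rightarrow> bool list) \<Rightarrow> (nat \<Rightarrow> bool) \<Rightarrow> nat \<Rightarrow> bool" where
  "prefix_map N p q x = (let i = (THE i. i < N \<and> pre (p i) x) in app (q i) (dropn (length (p i)) x))"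

lemma prefix_map_eq:
  assumes "complete_code N p" "i < N" "pre (p i) x"
  shows "prefix_map N p q x = app (q i) (dropn (length (p i)) x)"
proof -
  have "(THE i. i < N \<and> pre (p i) x) = i"
    using assms unfolding complete_code_def by (intro the1_equality) blast+
  then show ?thesis by (simp add: prefix_map_def)
qed

lemma complete_codeE:
  assumes "complete_code N p" obtains i where "i < N" "pre (p i) x"
  using assms unfolding complete_code_def by blast

lemma prefix_map_inverse:
  assumes p: "complete_code N p" and q: "complete_code N q"
  shows "prefix_map N q p (prefix_map N p q x) = x"
proof -
  obtain i where i: "i < N" "pre (p i) x" using p by (rule complete_codeE)
  show ?thesis using i by (simp add: prefix_map_eq[OF p i] prefix_map_eq[OF q i(1)] app_dropn)
qed

lemma unif_prefix_map:
  assumes p: "complete_code N p" shows "unif (prefix_map N p q)"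
  unfolding unif_def
proof
  fix n
  let ?L = "n + (\<Sum>i<N. length (p i))"
  have "agree n (prefix_map N p q x) (prefix_map N p q y)" if xy: "agree ?L x y" for x y
  proof -
    obtain i where i: "i < N" "pre (p i) x" using p by (rule complete_codeE)
    have len: "length (p i) \<le> (\<Sum>i<N. length (p i))" by (rule member_le_sum) (use i in auto)
    have "pre (p i) y" using i xy len by (simp add: pre_def agree_def)
    then show ?thesis using xy len
      by (auto simp: prefix_map_eq[OF p i] prefix_map_eq[OF p i(1)] agree_def app_def dropn_def)
  qed
  then show "\<exists>L. \<forall>x y. agree L x y \<longrightarrow> agree n (prefix_map N p q x) (prefix_map N p q y)" by blast
qed

lemma prefix_map_homeo:
  assumes "complete_code N p" "complete_code N q"
  shows "prefix_map N p q \<in> homeo_cantor"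
  using assms by (intro homeo_cantorI[of _ "prefix_map N q p"]) (simp_all add: prefix_map_inverse unif_prefix_map)

text \<open>The code 0, 10, 110, ..., closed by a word of ones only: a simple complete code of every
  positive size.\<close>

fun comb :: "nat \<Rightarrow> nat \<Rightarrow> bool list" where
  "comb (Suc (Suc n)) 0 = [False]"
| "comb (Suc (Suc n)) (Suc i) = True # comb (Suc n) i"
| "comb _ _ = []"

lemma pre_Nil [simp]: "pre [] x"
  by (simp add: pre_def)

lemma pre_Cons: "pre (a # b) x \<longleftrightarrow> x 0 = a \<and> pre b (dropn 1 x)"
  using pre_append[of "[a]" b x] by (simp add: pre_def)

lemma comb_complete: "complete_code (Suc n) (comb (Suc n))"
proof (induction n)
  case 0
  then show ?case by (auto simp: complete_code_def)
next
  case (Suc n)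
  show ?case unfolding complete_code_def
  proof
    fix x :: "nat \<Rightarrow> bool"
    show "\<exists>!i. i < Suc (Suc n) \<and> pre (comb (Suc (Suc n)) i) x"
    proof (cases "x 0")
      case False
      show ?thesis
      proof (rule ex1I[of _ 0])
        show "i = 0" if "i < Suc (Suc n) \<and> pre (comb (Suc (Suc n)) i) x" for i
          using that False by (cases i) (auto simp: pre_Cons)
      qed (use False in \<open>auto simp: pre_Cons\<close>)
    next
      case True
      obtain i where i: "i < Suc n" "pre (comb (Suc n) i) (dropn 1 x)"
        and uniq: "\<And>j. j < Suc n \<Longrightarrow> pre (comb (Suc n) j) (dropn 1 x) \<Longrightarrow> j = i"
        using Suc unfolding complete_code_def by blast
      show ?thesis
      proof (rule ex1I[of _ "Suc i"])
        show "j = Suc i" if "j < Suc (Suc n) \<and> pre (comb (Suc (Suc n)) j) x" for j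
          using that True uniq by (cases j) (auto simp: pre_Cons)
      qed (use True i in \<open>auto simp: pre_Cons\<close>)
    qed
  qed
qed

text \<open>Every cylinder \<open>E ! j\<close> of level \<open>L\<close> is cut into as many pieces as \<open>j\<close> has occurrences in \<open>w\<close>.\<close>
lemma refine_code:
  assumes E: "distinct E" "set E = {e. length e = L}" and w: "set w = {..<length E}"
  shows "\<exists>b. complete_code (length w) (\<lambda>i. E ! (w ! i) @ b i)"
proof -
  let ?I = "\<lambda>j. {i. i < length w \<and> w ! i = j}"
  have "\<exists>\<rho>. bij_betw \<rho> (?I j) {0..<card (?I j)}" for j
    by (rule ex_bij_betw_finite_nat) simp
  then obtain \<rho> where \<rho>: "\<And>j. bij_betw (\<rho> j) (?I j) {0..<card (?I j)}" by metis
  \<comment> \<open>The occurrences of a letter are numbered by \<open>\<rho>\<close>, and each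
    extends the cylinder of that letter by the comb word of its number.\<close>
  define b where "b i = comb (card (?I (w ! i))) (\<rho> (w ! i) i)" for i
  have "\<exists>!i. i < length w \<and> pre (E ! (w ! i) @ b i) x" for x
  proof -
    let ?e = "map x [0..<L]"
    have "?e \<in> set E" using E by simp
    then obtain j where j: "j < length E" "E ! j = ?e" unfolding in_set_conv_nth by blast
    have pre_iff: "pre (E ! k) x \<longleftrightarrow> k = j" if k: "k < length E" for k
    proof -
      have len: "length (E ! k) = L" using nth_mem[OF k] E by simp
      have "pre (E ! k) x \<longleftrightarrow> E ! k = ?e" using len by (auto simp: pre_def list_eq_iff_nth_eq)
      also have "\<dots> \<longleftrightarrow> k = j" using j k E(1) nth_eq_iff_index_eq by metis
      finally show ?thesis .
    qed
    have "j \<in> set w" using j w by simp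
    then obtain i0 where "i0 \<in> ?I j" by (auto simp: in_set_conv_nth)
    then have "card (?I j) \<noteq> 0" by auto
    then obtain c where c: "card (?I j) = Suc c" using not0_implies_Suc by blast
    let ?y = "dropn L x"
    obtain r where r: "r < Suc c" "pre (comb (Suc c) r) ?y"
      and uniq: "\<And>r'. r' < Suc c \<Longrightarrow> pre (comb (Suc c) r') ?y \<Longrightarrow> r' = r"
      using comb_complete[of c] unfolding complete_code_def by blast
    have "r \<in> \<rho> j ` ?I j" using \<rho>[of j] r(1) unfolding bij_betw_def c by simp
    then obtain i where i: "i < length w" "w ! i = j" "\<rho> j i = r" by blast
    have lenj: "length (E ! j) = L" using j(2) by simp
    show ?thesis
    proof (rule ex1I[of _ i])
      have "pre (E ! j) x" by (rule pre_iff[OF j(1), THEN iffD2]) simp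
      moreover have "b i = comb (Suc c) r" by (simp only: b_def i(2,3) c)
      ultimately show "i < length w \<and> pre (E ! (w ! i) @ b i) x"
        unfolding pre_append i(2) lenj using i(1) r(2) by simp
    next
      fix i' assume i': "i' < length w \<and> pre (E ! (w ! i') @ b i') x"
      have "w ! i' < length E" using i' w nth_mem by blast
      then have wj: "w ! i' = j" using pre_iff i' by (simp add: pre_append)
      then have i'I: "i' \<in> ?I j" using i' by simp
      have "b i' = comb (Suc c) (\<rho> j i')" by (simp only: b_def wj c)
      then have "pre (comb (Suc c) (\<rho> j i')) ?y" using i' unfolding pre_append wj lenj by simp
      moreover have "\<rho> j i' < Suc c" using \<rho>[of j] i'I unfolding bij_betw_def c by force
      ultimately have eq: "\<rho> j i' = \<rho> j i" unfolding i(3) by (intro uniq)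
      have "inj_on (\<rho> j) (?I j)" using \<rho>[of j] by (rule bij_betw_imp_inj_on)
      from inj_onD[OF this eq i'I] show "i' = i" using i(1,2) by simp
    qed
  qed
  then show ?thesis unfolding complete_code_def by blast
qed

section \<open>Block exchanges and flips of the Cantor space\<close>

definition swapb :: "nat \<Rightarrow> nat \<Rightarrow> nat \<Rightarrow> nat" where
  "swapb B n i = (if i < n then B + i else if B \<le> i \<and> i < B + n then i - B else i)"

lemma swapb_swapb: "n \<le> B \<Longrightarrow> swapb B n (swapb B n i) = i"
  by (auto simp: swapb_def)

definition kapC :: "nat \<Rightarrow> nat \<Rightarrow> (nat \<Rightarrow> bool) \<Rightarrow> nat \<Rightarrow> bool" where
  "kapC B n x = (\<lambda>i. x (swapb B n i))"

lemma kapC_kapC: "n \<le> B \<Longrightarrow> kapC B n (kapC B n x) = x"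
  by (simp add: kapC_def swapb_swapb)

lemma kapC_homeo: assumes "n \<le> B" shows "kapC B n \<in> homeo_cantor"
proof -
  have "unif (kapC B n)" unfolding unif_def
  proof
    fix m
    have "swapb B n i < m + B + n" if "i < m" for i using that by (auto simp: swapb_def)
    then have "agree m (kapC B n x) (kapC B n y)" if "agree (m + B + n) x y" for x y
      using that by (simp add: agree_def kapC_def)
    then show "\<exists>L. \<forall>x y. agree L x y \<longrightarrow> agree m (kapC B n x) (kapC B n y)" by blast
  qed
  then show ?thesis by (intro homeo_cantorI[of _ "kapC B n"]) (simp_all add: kapC_kapC assms)
qed

text \<open>A flip permutes the cylinders of level \<open>n\<close>, and so renames the letters of
  words read on \<open>n\<close> coordinates. Being an involution it spares a separate treatment of
  inverses.\<close>

definition flip :: "nat \<Rightarrow> bool list set \<Rightarrow> (nat \<Rightarrow> bool) \<Rightarrow> nat \<Rightarrow> bool" where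
  "flip n J x = x(0 := (x 0 \<noteq> (map x [1..<n] \<in> J)))"

lemma map_flip: "map (flip n J x) [1..<m] = map x [1..<m]"
  by (simp add: flip_def)

lemma flip_flip: "flip n J (flip n J x) = x"
proof -
  have "flip n J (flip n J x) = (flip n J x)(0 := (flip n J x 0 \<noteq> (map x [1..<n] \<in> J)))"
    unfolding flip_def[of n J "flip n J x"] map_flip ..
  then show ?thesis by (auto simp: flip_def fun_eq_iff)
qed

lemma flip_agree: assumes "n \<le> m" "agree m x y" shows "agree m (flip n J x) (flip n J y)"
proof -
  have *: "map x [1..<n] = map y [1..<n]" using assms by (auto simp: agree_def)
  show ?thesis using assms(2) unfolding flip_def * by (auto simp: agree_def)
qed

lemma flip_homeo: "flip n J \<in> homeo_cantor"
proof -
  have "unif (flip n J)" unfolding unif_def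
  proof
    fix m
    have "agree m (flip n J x) (flip n J y)" if "agree (max m n) x y" for x y
      using flip_agree[of n "max m n" x y J] that agree_mono[of "max m n" "flip n J x" "flip n J y" m] by simp
    then show "\<exists>L. \<forall>x y. agree L x y \<longrightarrow> agree m (flip n J x) (flip n J y)" by blast
  qed
  then show ?thesis by (intro homeo_cantorI[of _ "flip n J"]) (simp_all add: flip_flip)
qed

lemma inv_flip: "inv (flip n J) = flip n J"
  by (rule inv_unique_comp) (simp_all add: fun_eq_iff flip_flip)

lemma inv_kapC: "n \<le> B \<Longrightarrow> inv (kapC B n) = kapC B n"
  by (rule inv_unique_comp) (simp_all add: fun_eq_iff kapC_kapC)

lemma UC_inv_0: assumes "u \<in> UC 1" shows "(inv u y) 0 = y 0"
  using cantor.U_inv[OF assms] by (simp add: UC_def agree_def)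

definition FC :: "nat \<Rightarrow> cmap set" where
  "FC n = flip n ` Pow {xs. length xs = n - 1}"

lemma finite_bool_lists: "finite {xs :: bool list. length xs = n}" and
  card_bool_lists: "card {xs :: bool list. length xs = n} = 2 ^ n"
  using finite_lists_length_eq[of "UNIV :: bool set" n] card_lists_length_eq[of "UNIV :: bool set" n] by simp_all

lemma flip_inj:
  assumes eq: "\<And>y. y 0 = (map y [1..<n] \<in> J) \<longleftrightarrow> y 0 = (map y [1..<n] \<in> J')"
    and J: "J \<subseteq> {xs. length xs = n - 1}" "J' \<subseteq> {xs. length xs = n - 1}"
  shows "J = J'"
proof -
  have "e \<in> J \<longleftrightarrow> e \<in> J'" if e: "length e = n - 1" for e
  proof -
    let ?y = "\<lambda>i. e ! (i - 1)"
    have "map ?y [1..<n] = e" using e by (auto simp: list_eq_iff_nth_eq)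
    then show ?thesis using eq[of ?y] by auto
  qed
  then show ?thesis using J by blast
qed

text \<open>Elements of \<open>UC 1\<close> preserve coordinate 0, so coordinate 0 of the inverse is
  an invariant of the coset; for a flip it reveals \<open>J\<close>.\<close>

lemma FC_inj:
  assumes "\<phi> \<in> FC n" "\<phi>' \<in> FC n" "u \<in> UC 1" "u' \<in> UC 1" "\<phi> \<circ> u = \<phi>' \<circ> u'"
  shows "\<phi> = \<phi>'"
proof -
  obtain J where J: "\<phi> = flip n J" "J \<subseteq> {xs. length xs = n - 1}" using assms by (auto simp: FC_def)
  obtain J' where J': "\<phi>' = flip n J'" "J' \<subseteq> {xs. length xs = n - 1}" using assms by (auto simp: FC_def)
  have 1: "(inv (flip n K \<circ> v) y) 0 \<longleftrightarrow> (y 0 \<noteq> (map y [1..<n] \<in> K))" if "v \<in> UC 1" for K v y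
    using cantor.inv_comp[OF flip_homeo cantor.U_G[OF that]] UC_inv_0[OF that] by (simp add: inv_flip) (simp add: flip_def)
  have "J = J'"
    using 1[OF assms(3), of J] 1[OF assms(4), of J'] assms(5) J J' by (intro flip_inj) auto
  then show ?thesis using J J' by simp
qed

text \<open>The same invariant now reads coordinates from \<open>B\<close> onwards only, and
  changing coordinate \<open>B\<close> alone always changes it. So \<open>B\<close> is the least
  coordinate on which it depends.\<close>

lemma kapC_inj_aux:
  assumes n: "2 \<le> n" "n \<le> B" "2 \<le> n'" "n' \<le> B'" and u: "u \<in> UC 1" "u' \<in> UC 1"
    and eq: "kapC B n \<circ> flip n J \<circ> u = kapC B' n' \<circ> flip n' J' \<circ> u'"
  shows "\<not> B < B'"
proof
  assume "B < B'"
  have 1: "(inv (kapC C m \<circ> flip m K \<circ> v) y) 0 \<longleftrightarrow> (y C \<noteq> (map (\<lambda>i. y (C + i)) [1..<m] \<in> K))"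
    if v: "v \<in> UC 1" and m: "2 \<le> m" "m \<le> C" for C m K v y
  proof -
    have "inv (kapC C m \<circ> flip m K \<circ> v) = inv v \<circ> (flip m K \<circ> kapC C m)"
      using cantor.inv_comp[OF homeo_cantor_comp[OF kapC_homeo[OF m(2)] flip_homeo] cantor.U_G[OF v], of m K]
        cantor.inv_comp[OF kapC_homeo[OF m(2)] flip_homeo, of m K] by (simp add: inv_flip inv_kapC m)
    then have "(inv (kapC C m \<circ> flip m K \<circ> v) y) 0 = flip m K (kapC C m y) 0"
      using UC_inv_0[OF v] by simp
    also have "\<dots> \<longleftrightarrow> (y C \<noteq> (map (\<lambda>i. y (C + i)) [1..<m] \<in> K))"
    proof -
      have *: "map (kapC C m y) [1..<m] = map (\<lambda>i. y (C + i)) [1..<m]" by (simp add: kapC_def swapb_def)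
      have "kapC C m y 0 = y C" using m by (simp add: kapC_def swapb_def)
      moreover have "flip m K (kapC C m y) 0 \<longleftrightarrow> (kapC C m y 0 \<noteq> (map (kapC C m y) [1..<m] \<in> K))"
        by (simp add: flip_def)
      ultimately show ?thesis unfolding * by (simp only:)
    qed
    finally show ?thesis .
  qed
  define d0 where "d0 y = (inv (kapC B n \<circ> flip n J \<circ> u) y) 0" for y
  \<comment> \<open>The zero point and the point that is true at \<open>B\<close> only: the element
    with index \<open>B\<close> distinguishes them, one with a larger index cannot.\<close>
  let ?y = "\<lambda>i :: nat. False"
  let ?z = "\<lambda>i. i = B"
  have B: "map (\<lambda>i. B + i = B) [1..<n] = map (\<lambda>i. False) [1..<n]" by simp
  have "d0 ?y \<noteq> d0 ?z" unfolding d0_def 1[OF u(1) n(1,2)] B by simp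
  moreover have B': "map (\<lambda>i. B' + i = B) [1..<n'] = map (\<lambda>i. False) [1..<n']" using \<open>B < B'\<close> by simp
  have "d0 ?y = d0 ?z" unfolding d0_def eq 1[OF u(2) n(3,4)] B' using \<open>B < B'\<close> by simp
  ultimately show False by simp
qed

section \<open>Words of homeomorphisms and their Ramsey property\<close>

definition ext :: "bool list \<Rightarrow> nat \<Rightarrow> bool" where
  "ext e i = (i < length e \<and> e ! i)"

lemma map_ext: "length e = n \<Longrightarrow> map (ext e) [0..<n] = e"
  by (auto simp: ext_def list_eq_iff_nth_eq)

lemma agree_ext: "length e = n \<Longrightarrow> agree n x (ext e) \<longleftrightarrow> map x [0..<n] = e"
  unfolding agree_iff_map by (simp add: map_ext)

text \<open>The coset of \<open>g\<close> modulo \<open>UC s\<close> is determined by the first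
  \<open>s\<close> coordinates of \<open>inv g\<close>. The inverse of \<open>g h \<phi>\<close>
  applies \<open>inv g\<close> first: this selects a cylinder according to \<open>w\<close>, then
  \<open>inv h\<close> supplies a letter of \<open>n\<close> bits, and the involution
  \<open>\<phi>\<close> turns it into a letter of \<open>s\<close> bits.\<close>

lemma cantor_ramsey:
  assumes n: "2 \<le> n" "s \<le> n" and c: "\<And>g. g \<in> homeo_cantor \<Longrightarrow> c g < (r::nat)"
    "\<And>g u. g \<in> homeo_cantor \<Longrightarrow> u \<in> UC s \<Longrightarrow> c (g \<circ> u) = c g"
    and D: "finite D" "D \<subseteq> homeo_cantor"
  shows "\<exists>g\<in>homeo_cantor. card ((\<lambda>h. \<lambda>\<phi>\<in>FC n. c (g \<circ> h \<circ> \<phi>)) ` D) \<le> (2 ^ n) ^ (2 ^ n)"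
proof -
  let ?A = "{xs :: bool list. length xs = n}"
  have FC: "\<phi> \<in> homeo_cantor" "inv \<phi> = \<phi>" "\<And>x y. agree n x y \<Longrightarrow> agree n (\<phi> x) (\<phi> y)" if "\<phi> \<in> FC n" for \<phi>
    using that by (auto simp: FC_def flip_homeo inv_flip intro: flip_agree)
  have "\<forall>h\<in>D. \<exists>L. \<forall>x y. agree L x y \<longrightarrow> agree n (inv h x) (inv h y)"
    using unifD homeo_cantorD(3) D by blast
  from bchoice[OF this] obtain l where l: "\<forall>h\<in>D. \<forall>x y. agree (l h) x y \<longrightarrow> agree n (inv h x) (inv h y)" ..
  \<comment> \<open>A common level: for all \<open>h\<close> in \<open>D\<close> the first
    \<open>n\<close> coordinates of \<open>inv h\<close> are constant on cylinders of level
    \<open>L\<close>.\<close>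
  define L where "L = (\<Sum>h\<in>D. l h)"
  have inv_h: "agree n (inv h x) (inv h y)" if h: "h \<in> D" and xy: "agree L x y" for h x y
  proof -
    have "l h \<le> L" unfolding L_def using h D by (intro member_le_sum) auto
    then show ?thesis using l h agree_mono[OF xy] by blast
  qed
  obtain E where E: "set E = {e :: bool list. length e = L}" "distinct E"
    using finite_distinct_list[OF finite_bool_lists] by blast
  define v where "v h = map (\<lambda>e. map (inv h (ext e)) [0..<n]) E" for h :: cmap
  define f where "f \<phi> xs = map (\<phi> (ext xs)) [0..<s]" for \<phi> :: cmap and xs
  have E_ne: "length E \<noteq> 0"
  proof
    assume "length E = 0"
    then have "replicate L True \<notin> set E" by simp
    then show False using E by simp
  qed
  have "\<exists>g\<in>homeo_cantor. card ((\<lambda>h. \<lambda>\<phi>\<in>FC n. c (g \<circ> h \<circ> \<phi>)) ` D) \<le> card ?A ^ card ?A"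
  proof (rule word_patterns[where c = "\<lambda>g h \<phi>. c (g \<circ> h \<circ> \<phi>)" and D = D and F = "FC n" and A = ?A and r = r
        and v = v and e = f and len = "length E" and B = "{xs. length xs = s}"])
    show "finite D" "finite ?A" by (rule D finite_bool_lists)+
    show "length (v h) = length E" for h by (simp add: v_def)
    show "FC n \<noteq> {}" by (auto simp: FC_def)
    show "c (g \<circ> h \<circ> \<phi>) < r" if "g \<in> homeo_cantor" "h \<in> D" "\<phi> \<in> FC n" for g h \<phi>
      using that D FC(1) by (intro c homeo_cantor_comp) auto
    show "set (v h) = ?A" if h: "h \<in> D" for h
    proof
      show "?A \<subseteq> set (v h)"
      proof
        fix xs assume xs: "xs \<in> ?A"
        let ?y = "h (ext xs)"
        let ?e = "map ?y [0..<L]"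
        have "bij h" using h D homeo_cantorD(1) by blast
        then have "inv h ?y = ext xs" by (simp add: bij_is_inj)
        moreover have "agree L ?y (ext ?e)" by (simp add: agree_ext)
        ultimately have "agree n (ext xs) (inv h (ext ?e))" using inv_h[OF h] by metis
        then have "map (inv h (ext ?e)) [0..<n] = xs" using xs by (simp add: agree_iff_map map_ext del: map_eq_conv)
        moreover have "?e \<in> set E" using E by simp
        ultimately show "xs \<in> set (v h)" unfolding v_def set_map by (metis imageI)
      qed
      show "set (v h) \<subseteq> ?A" by (auto simp: v_def)
    qed
    show "f \<phi> ` ?A = {xs. length xs = s}" if \<phi>: "\<phi> \<in> FC n" for \<phi>
    proof
      show "{xs. length xs = s} \<subseteq> f \<phi> ` ?A"
      proof
        fix ys :: "bool list" assume ys: "ys \<in> {xs. length xs = s}"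
        let ?xs = "map (\<phi> (ext ys)) [0..<n]"
        have "\<phi> (\<phi> (ext ys)) = ext ys"
          using FC(1,2)[OF \<phi>] homeo_cantorD(1) by (metis bij_is_surj surj_f_inv_f)
        moreover have "agree n (\<phi> (ext ys)) (ext ?xs)" by (simp add: agree_ext)
        ultimately have "agree n (ext ys) (\<phi> (ext ?xs))" using FC(3)[OF \<phi>] by metis
        then have "agree s (\<phi> (ext ?xs)) (ext ys)" using n by (auto intro: agree_mono agree_sym)
        then have "f \<phi> ?xs = ys" using ys by (simp add: f_def agree_ext del: map_eq_conv)
        then show "ys \<in> f \<phi> ` ?A" by (intro image_eqI[of _ _ ?xs]) auto
      qed
      show "f \<phi> ` ?A \<subseteq> {xs. length xs = s}" by (auto simp: f_def)
    qed
    fix N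
    \<comment> \<open>Says that \<open>a\<close> is the word of \<open>g\<close> over the comb code.
      All such \<open>g\<close> lie in one coset, so the colour of an arbitrary one is a function of
      \<open>a\<close>.\<close>
    define Q where "Q a g \<longleftrightarrow> g \<in> homeo_cantor \<and> (\<forall>i<N. \<forall>x. pre (comb N i) x \<longrightarrow> map (inv g x) [0..<s] = a ! i)"
      for a :: "bool list list" and g
    show "\<exists>\<Gamma>. \<forall>w. length w = N \<longrightarrow> set w = {..<length E} \<longrightarrow>
      (\<exists>g\<in>homeo_cantor. \<forall>h\<in>D. \<forall>\<phi>\<in>FC n. c (g \<circ> h \<circ> \<phi>) = \<Gamma> (map (\<lambda>i. f \<phi> (v h ! i)) w))"
    proof (intro exI[of _ "\<lambda>a. c (SOME g. Q a g)"] allI impI)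
      fix w assume w: "length w = N" "set w = {..<length E}"
      have "N \<noteq> 0"
      proof
        assume "N = 0"
        then have "set w = {}" using w(1) by simp
        then have "{..<length E} = {}" using w(2) by (simp only:)
        then show False using E_ne by (simp add: lessThan_empty_iff)
      qed
      then have combN: "complete_code N (comb N)" using comb_complete[of "N - 1"] by simp
      obtain b where b: "complete_code N (\<lambda>i. E ! (w ! i) @ b i)"
        using refine_code[OF E(2,1) w(2)] w(1) by blast
      \<comment> \<open>Its inverse carries the \<open>i\<close>-th comb cylinder into the cylinder
        \<open>E ! (w ! i)\<close>, so multiplying by \<open>g\<close> from the left is substitution
        along \<open>w\<close>.\<close>
      define g where "g = prefix_map N (\<lambda>i. E ! (w ! i) @ b i) (comb N)"
      have g: "g \<in> homeo_cantor" unfolding g_def by (rule prefix_map_homeo[OF b combN])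
      have inv_g: "inv g = prefix_map N (comb N) (\<lambda>i. E ! (w ! i) @ b i)"
        unfolding g_def by (rule inv_unique_comp)
          (simp_all add: fun_eq_iff prefix_map_inverse[OF combN b] prefix_map_inverse[OF b combN])
      have wE: "w ! i < length E" if "i < N" for i using that w nth_mem by blast
      have lenE: "length (E ! (w ! i)) = L" if "i < N" for i using nth_mem[OF wE[OF that]] E(1) by simp
      have gx: "agree L (inv g x) (ext (E ! (w ! i)))" if i: "i < N" and x: "pre (comb N i) x" for i x
      proof -
        have "pre (E ! (w ! i)) (inv g x)"
          unfolding inv_g prefix_map_eq[OF combN i x] using pre_app pre_append by blast
        then show ?thesis using lenE[OF i] by (simp add: pre_def agree_def ext_def)
      qed
      have Q_unique: "c g1 = c g2" if "Q a g1" "Q a g2" for a g1 g2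
      proof -
        have G: "g1 \<in> homeo_cantor" "g2 \<in> homeo_cantor" using that by (auto simp: Q_def)
        have "agree s (inv g1 (g2 x)) x" for x
        proof -
          obtain i where i: "i < N" "pre (comb N i) (g2 x)" using combN by (rule complete_codeE)
          have "agree s (inv g1 (g2 x)) (inv g2 (g2 x))"
            using that i by (simp add: Q_def agree_iff_map del: map_eq_conv)
          then show ?thesis using homeo_cantorD(1)[OF G(2)] by (simp add: bij_is_inj)
        qed
        then have "inv g1 \<circ> g2 \<in> UC s" using G by (simp add: UC_def homeo_cantor_comp homeo_cantor_inv)
        from c(2)[OF G(1) this] show ?thesis unfolding cantor.cancel(2)[OF G(1)] by (rule sym)
      qed
      show "\<exists>g\<in>homeo_cantor. \<forall>h\<in>D. \<forall>\<phi>\<in>FC n. c (g \<circ> h \<circ> \<phi>) = c (SOME g. Q (map (\<lambda>i. f \<phi> (v h ! i)) w) g)"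
      proof (intro bexI[OF _ g] ballI)
        fix h \<phi> assume h: "h \<in> D" and \<phi>: "\<phi> \<in> FC n"
        let ?a = "map (\<lambda>i. f \<phi> (v h ! i)) w"
        have hG: "h \<in> homeo_cantor" using h D by blast
        have G: "g \<circ> h \<circ> \<phi> \<in> homeo_cantor" using g hG FC(1)[OF \<phi>] by (simp add: homeo_cantor_comp)
        have "map (inv (g \<circ> h \<circ> \<phi>) x) [0..<s] = ?a ! i" if i: "i < N" and x: "pre (comb N i) x" for i x
        proof -
          have "inv (g \<circ> h \<circ> \<phi>) x = \<phi> (inv h (inv g x))"
            using cantor.inv_comp[OF homeo_cantor_comp[OF g hG] FC(1)[OF \<phi>]] cantor.inv_comp[OF g hG] FC(2)[OF \<phi>] by simp
          moreover have "agree n (inv h (inv g x)) (ext (v h ! (w ! i)))"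
          proof -
            have "agree n (inv h (inv g x)) (inv h (ext (E ! (w ! i))))" by (rule inv_h[OF h gx[OF i x]])
            moreover have "agree n (inv h (ext (E ! (w ! i)))) (ext (v h ! (w ! i)))"
              using wE[OF i] by (simp add: v_def agree_ext)
            ultimately show ?thesis by (rule agree_trans)
          qed
          ultimately have "agree n (inv (g \<circ> h \<circ> \<phi>) x) (\<phi> (ext (v h ! (w ! i))))" using FC(3)[OF \<phi>] by simp
          then have "agree s (inv (g \<circ> h \<circ> \<phi>) x) (\<phi> (ext (v h ! (w ! i))))" using n(2) by (rule agree_mono)
          then show ?thesis using i w(1) by (simp add: agree_iff_map f_def del: map_eq_conv)
        qed
        then have Q: "Q ?a (g \<circ> h \<circ> \<phi>)" using G by (simp add: Q_def)
        then have "Q ?a (SOME g. Q ?a g)" by (rule someI[of "Q ?a"])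
        from Q_unique[OF Q this] show "c (g \<circ> h \<circ> \<phi>) = c (SOME g. Q ?a g)" .
      qed
    qed
  qed
  then show ?thesis by (simp add: card_bool_lists)
qed

text \<open>There are \<open>2 ^ (2 ^ (n - 1))\<close> flips, far more than the lower bound, which
  is shared with the linear groups.\<close>

lemma FC_card: assumes "2 \<le> n" shows "2 ^ (2 * (n - 2)) \<le> card (FC n)"
proof -
  have "inj_on (flip n) (Pow {xs. length xs = n - 1})"
  proof (rule inj_onI)
    fix J J' assume J: "J \<in> Pow {xs. length xs = n - 1}" "J' \<in> Pow {xs. length xs = n - 1}" "flip n J = flip n J'"
    have "y 0 = (map y [1..<n] \<in> J) \<longleftrightarrow> y 0 = (map y [1..<n] \<in> J')" for y
      using fun_cong[OF fun_cong[OF J(3)], of y 0] by (auto simp: flip_def)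
    then show "J = J'" using J(1,2) by (intro flip_inj) auto
  qed
  then have "card (FC n) = 2 ^ (2 ^ (n - 1))"
    unfolding FC_def by (simp add: card_image card_Pow finite_bool_lists card_bool_lists)
  moreover have "2 * m \<le> 2 ^ (m + 1)" for m :: nat
    using less_exp[of m] by simp
  from this[of "n - 2"] have "2 * (n - 2) \<le> 2 ^ (n - 1)" using assms by (simp add: Suc_diff_Suc numeral_2_eq_2)
  ultimately show ?thesis by simp
qed

interpretation cantor: ramsey_group homeo_cantor homeo_cantor_top UC FC kapC 1 2
proof
  show "finite (FC n)" for n by (simp add: FC_def finite_bool_lists)
  show "FC n \<subseteq> homeo_cantor" for n by (auto simp: FC_def flip_homeo)
  show "\<exists>g\<in>homeo_cantor. card ((\<lambda>h. \<lambda>\<phi>\<in>FC n. c (g \<circ> h \<circ> \<phi>)) ` D) \<le> (2 ^ n) ^ 2 ^ n"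
    if "2 \<le> n" "s \<le> n" "\<And>g. g \<in> homeo_cantor \<Longrightarrow> c g < r"
      "\<And>g u. g \<in> homeo_cantor \<Longrightarrow> u \<in> UC s \<Longrightarrow> c (g \<circ> u) = c g" "finite D" "D \<subseteq> homeo_cantor"
    for n s c D and r :: nat by (rule cantor_ramsey[OF that])
  show "B = B'" if as: "2 \<le> n" "n \<le> B" "2 \<le> n'" "n' \<le> B'" "\<phi> \<in> FC n" "\<phi>' \<in> FC n'" "u \<in> UC 1" "u' \<in> UC 1"
    "kapC B n \<circ> \<phi> \<circ> u = kapC B' n' \<circ> \<phi>' \<circ> u'" for n B n' B' \<phi> \<phi>' u u'
  proof -
    obtain J J' where J: "\<phi> = flip n J" "\<phi>' = flip n' J'" using as by (auto simp: FC_def)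
    have "\<not> B < B'" using as unfolding J by (intro kapC_inj_aux[of n B n' B' u u' J J']) auto
    moreover have "\<not> B' < B" using as unfolding J by (intro kapC_inj_aux[of n' B' n B u' u J' J]) auto
    ultimately show ?thesis by simp
  qed
qed (auto intro: FC_card FC_inj kapC_homeo)

section \<open>The automorphism group of the vector space\<close>

type_synonym 'k vmap = "(nat \<Rightarrow> 'k) \<Rightarrow> nat \<Rightarrow> 'k"

definition ev :: "nat \<Rightarrow> nat \<Rightarrow> 'k::{field,finite}" where
  "ev j = (\<lambda>i. if i = j then 1 else 0)"

definition supp :: "nat \<Rightarrow> (nat \<Rightarrow> 'k::{field,finite}) \<Rightarrow> bool" where
  "supp n v \<longleftrightarrow> (\<forall>i\<ge>n. v i = 0)"

lemma supp_mono: "supp m v \<Longrightarrow> m \<le> n \<Longrightarrow> supp n v"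
  by (simp add: supp_def)

lemma suppD: "supp n v \<Longrightarrow> n \<le> i \<Longrightarrow> v i = 0"
  by (simp add: supp_def)

lemma supp_ev: "j < n \<Longrightarrow> supp n (ev j)"
  by (simp add: supp_def ev_def)

lemma Vspace_iff: "v \<in> Vspace \<longleftrightarrow> (\<exists>n. supp n v)"
proof
  assume "v \<in> Vspace"
  then have "finite {n. v n \<noteq> 0}" by (simp add: Vspace_def)
  then obtain n where "\<forall>i\<in>{n. v n \<noteq> 0}. i < n" using finite_nat_set_iff_bounded by blast
  then have "supp n v" by (auto simp: supp_def)
  then show "\<exists>n. supp n v" ..
next
  assume "\<exists>n. supp n v"
  then obtain n where "supp n v" ..
  then have "{i. v i \<noteq> 0} \<subseteq> {..<n}" by (auto simp: supp_def not_le[symmetric])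
  then show "v \<in> Vspace" unfolding Vspace_def using finite_subset by blast
qed

lemma supp_Vspace: "supp n v \<Longrightarrow> v \<in> Vspace"
  by (auto simp: Vspace_iff)

lemma Vspace_suppE: assumes "v \<in> Vspace" obtains n where "supp n v"
  using assms by (auto simp: Vspace_iff)

lemma ev_Vspace [simp]: "ev j \<in> Vspace"
  by (rule supp_Vspace[OF supp_ev[OF lessI]])

lemma Vspace_comb: assumes "u \<in> Vspace" "v \<in> Vspace" shows "(\<lambda>n. a * u n + b * v n) \<in> Vspace"
proof -
  obtain m n where "supp m u" "supp n v" using assms by (auto simp: Vspace_iff)
  then have "supp (max m n) (\<lambda>n. a * u n + b * v n)" by (simp add: supp_def)
  then show ?thesis by (rule supp_Vspace)
qed

lemma GLV_V: "f \<in> GLV \<Longrightarrow> v \<in> Vspace \<Longrightarrow> f v \<in> Vspace"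
  by (auto simp: GLV_def bij_betw_def)

lemma GLV_lin: "f \<in> GLV \<Longrightarrow> u \<in> Vspace \<Longrightarrow> v \<in> Vspace \<Longrightarrow>
    f (\<lambda>n. a * u n + b * v n) = (\<lambda>n. a * f u n + b * f v n)"
  by (simp add: GLV_def)

lemma GLV_out: "f \<in> GLV \<Longrightarrow> v \<notin> Vspace \<Longrightarrow> f v = v"
  by (simp add: GLV_def)

lemma GLV_expand:
  assumes f: "f \<in> GLV"
  shows "supp n v \<Longrightarrow> f v i = (\<Sum>j<n. v j * f (ev j) i)"
proof (induction n arbitrary: v)
  case 0
  then have "v = (\<lambda>n. 0 * ev 0 n + 0 * ev 0 n)" by (auto simp: supp_def)
  then have "f v = (\<lambda>n. 0 * f (ev 0) n + 0 * f (ev 0) n)" by (simp only: GLV_lin[OF f] ev_Vspace)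
  then show ?case by simp
next
  case (Suc n)
  let ?v = "v(n := 0)"
  have v: "supp n ?v" using Suc.prems by (simp add: supp_def)
  have "v = (\<lambda>i. 1 * ?v i + v n * ev n i)" by (auto simp: ev_def)
  then have "f v = (\<lambda>i. 1 * f ?v i + v n * f (ev n) i)"
    using GLV_lin[OF f supp_Vspace[OF v] ev_Vspace, of 1 "v n" n] by (simp only:)
  then have "f v i = f ?v i + v n * f (ev n) i" by simp
  also have "f ?v i = (\<Sum>j<n. ?v j * f (ev j) i)" by (rule Suc.IH[OF v])
  also have "\<dots> = (\<Sum>j<n. v j * f (ev j) i)" by (intro sum.cong) auto
  finally show ?case by simp
qed

text \<open>Since elements are the identity outside \<open>Vspace\<close>, they are bijections of
  the whole type, and \<open>inv\<close> is the inverse of the group.\<close>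

lemma GLV_bij: assumes "f \<in> GLV" shows "bij f"
proof -
  have 1: "bij_betw f Vspace Vspace" using assms by (simp add: GLV_def)
  have "bij_betw f (- Vspace) (- Vspace)"
    using assms by (subst bij_betw_cong[of _ _ id]) (auto simp: GLV_def)
  from bij_betw_combine[OF 1 this] show ?thesis by simp
qed

lemma GLVI:
  assumes "\<And>v. v \<in> Vspace \<Longrightarrow> f v \<in> Vspace" "\<And>v. v \<in> Vspace \<Longrightarrow> g v \<in> Vspace"
    "\<And>v. v \<in> Vspace \<Longrightarrow> g (f v) = v" "\<And>v. v \<in> Vspace \<Longrightarrow> f (g v) = v"
    "\<And>v. v \<notin> Vspace \<Longrightarrow> f v = v"
    "\<And>u v a b i. u \<in> Vspace \<Longrightarrow> v \<in> Vspace \<Longrightarrow> f (\<lambda>n. a * u n + b * v n) i = a * f u i + b * f v i"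
  shows "f \<in> GLV"
proof -
  have "bij_betw f Vspace Vspace" by (rule bij_betw_byWitness[of _ g]) (use assms in auto)
  then show ?thesis using assms(5,6) by (auto simp: GLV_def fun_eq_iff)
qed

lemma GLV_inv: assumes f: "f \<in> GLV" shows "inv f \<in> GLV"
proof -
  have inv: "inv f (f v) = v" "f (inv f v) = v" for v
    using GLV_bij[OF f] by (simp_all add: bij_is_inj bij_is_surj surj_f_inv_f)
  have V: "inv f v \<in> Vspace" if "v \<in> Vspace" for v
    using GLV_out[OF f, of "inv f v"] inv that by metis
  show ?thesis
  proof (rule GLVI[of _ f])
    show "inv f v = v" if "v \<notin> Vspace" for v using GLV_out[OF f that] inv by metis
    fix u v :: "nat \<Rightarrow> 'a" and a b i assume "u \<in> Vspace" "v \<in> Vspace"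
    then have "f (\<lambda>n. a * inv f u n + b * inv f v n) = (\<lambda>n. a * u n + b * v n)"
      using GLV_lin[OF f V V] by (simp add: inv)
    with inv(1)[of "\<lambda>n. a * inv f u n + b * inv f v n"]
    have "inv f (\<lambda>n. a * u n + b * v n) = (\<lambda>n. a * inv f u n + b * inv f v n)" by (simp only:)
    then show "inv f (\<lambda>n. a * u n + b * v n) i = a * inv f u i + b * inv f v i" by simp
  qed (use V GLV_V[OF f] inv in auto)
qed

lemma GLV_comp: assumes f: "f \<in> GLV" and g: "g \<in> GLV" shows "f \<circ> g \<in> GLV"
proof -
  have inv: "inv f (f v) = v" "f (inv f v) = v" "inv g (g v) = v" "g (inv g v) = v" for v
    using GLV_bij[OF f] GLV_bij[OF g] by (simp_all add: bij_is_inj bij_is_surj surj_f_inv_f)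
  show ?thesis
    by (rule GLVI[of _ "inv g \<circ> inv f"])
      (simp_all add: GLV_V[OF f] GLV_V[OF g] GLV_V[OF GLV_inv[OF f]] GLV_V[OF GLV_inv[OF g]]
        GLV_lin[OF f] GLV_lin[OF g] GLV_out[OF f] GLV_out[OF g] inv)
qed

lemma GLV_id: "id \<in> GLV"
  by (rule GLVI[of _ id]) auto

text \<open>The pointwise stabiliser of the first \<open>s\<close> unit vectors, hence of their
  span.\<close>

definition UG :: "nat \<Rightarrow> ('k::{field,finite}) vmap set" where
  "UG s = {g \<in> GLV. \<forall>j<s. g (ev j) = ev j}"

lemma UG_sub: "UG s \<subseteq> GLV"
  by (auto simp: UG_def)

lemma UG_id: "id \<in> UG s"
  by (simp add: UG_def GLV_id)

lemma UG_fix: assumes u: "u \<in> UG t" and x: "supp t x" shows "u x = x"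
proof
  fix i
  have "u \<in> GLV" using u UG_sub by blast
  from GLV_expand[OF this x, of i] have "u x i = (\<Sum>j<t. x j * u (ev j) i)" .
  also have "\<dots> = (\<Sum>j<t. x j * id (ev j) i)" using u by (simp add: UG_def)
  also have "\<dots> = id x i" using GLV_expand[OF GLV_id x, of i] by simp
  finally show "u x i = x i" by simp
qed

lemma UG_open: "openin GLV_top (UG s :: ('k::{field,finite}) vmap set)"
proof -
  let ?P = "product_topology (\<lambda>_. discrete_topology UNIV) UNIV :: ((nat \<Rightarrow> 'k) \<Rightarrow> (nat \<Rightarrow> 'k)) topology"
  have top: "topspace ?P = UNIV" by simp
  have "openin ?P {g. \<forall>j<s. g (ev j) = ev j}"
  proof (induction s)
    case 0
    show ?case using openin_topspace[of ?P] unfolding top by simp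
  next
    case (Suc s)
    have "openin ?P {g \<in> topspace ?P. g (ev s) \<in> {ev s}}"
      by (rule openin_continuous_map_preimage[OF continuous_map_product_projection]) auto
    from openin_Int[OF Suc this] show ?case
      unfolding top by (simp add: less_Suc_eq all_conj_distrib imp_disjL Collect_conj_eq)
  qed
  moreover have "UG s = {g. \<forall>j<s. g (ev j) = ev j} \<inter> GLV" by (auto simp: UG_def)
  ultimately show ?thesis unfolding GLV_top_def openin_subtopology by blast
qed

text \<open>A basic neighbourhood restricts finitely many arguments. Those in \<open>Vspace\<close>
  lie in the span of finitely many unit vectors, and those outside are fixed by the
  normalisation.\<close>

lemma UG_basis:
  fixes W :: "('k::{field,finite}) vmap set"
  assumes "openin GLV_top W" "id \<in> W"
  shows "\<exists>s. UG s \<subseteq> W"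
proof -
  let ?P = "product_topology (\<lambda>_. discrete_topology UNIV) UNIV :: ((nat \<Rightarrow> 'k) \<Rightarrow> (nat \<Rightarrow> 'k)) topology"
  obtain W' where W': "openin ?P W'" "W = W' \<inter> GLV"
    using assms(1) unfolding GLV_top_def openin_subtopology by blast
  have "id \<in> W'" using W' assms(2) by blast
  with W'(1) obtain V where V: "finite {x. V x \<noteq> (UNIV :: (nat \<Rightarrow> 'k) set)}" "id \<in> PiE UNIV V" "PiE UNIV V \<subseteq> W'"
    unfolding openin_product_topology_alt by fastforce
  let ?X = "{x. V x \<noteq> UNIV} \<inter> Vspace"
  have "\<forall>x\<in>?X. \<exists>n. supp n x" by (auto simp: Vspace_iff)
  from bchoice[OF this] obtain m where m: "\<forall>x\<in>?X. supp (m x) x" ..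
  have fin: "finite ?X" using V(1) by simp
  have "UG (\<Sum>x\<in>?X. m x) \<subseteq> W"
  proof
    fix g :: "'k vmap" assume g: "g \<in> UG (\<Sum>x\<in>?X. m x)"
    then have gG: "g \<in> GLV" using UG_sub by blast
    have "g x \<in> V x" for x
    proof (cases "V x = UNIV")
      case False
      have "g x = x"
      proof (cases "x \<in> Vspace")
        case True
        with False have x: "x \<in> ?X" by blast
        have "m x \<le> (\<Sum>x\<in>?X. m x)" by (rule member_le_sum[OF x _ fin]) simp
        then show ?thesis using UG_fix[OF g] m x supp_mono by blast
      qed (rule GLV_out[OF gG])
      moreover have "id x \<in> V x" using V(2) by (auto simp: PiE_iff)
      ultimately show ?thesis by simp
    qed simp
    then have "g \<in> PiE UNIV V" by (simp add: PiE_iff)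
    then show "g \<in> W" using V(3) W'(2) gG by blast
  qed
  then show ?thesis ..
qed

lemma GLV_supp_ex:
  assumes "finite D" "D \<subseteq> GLV" shows "\<exists>L. \<forall>h\<in>D. \<forall>j<n. supp L (h (ev j))"
proof -
  let ?I = "D \<times> {..<n}"
  have "\<forall>i\<in>?I. \<exists>m. supp m (fst i (ev (snd i)))" using assms GLV_V Vspace_iff ev_Vspace by fastforce
  from bchoice[OF this] obtain m where m: "\<forall>i\<in>?I. supp (m i) (fst i (ev (snd i)))" ..
  have "supp (\<Sum>i\<in>?I. m i) (h (ev j))" if "h \<in> D" "j < n" for h j
  proof -
    have i: "(h, j) \<in> ?I" using that by simp
    have "m (h, j) \<le> (\<Sum>i\<in>?I. m i)" by (rule member_le_sum[OF i]) (use assms in auto)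
    then show ?thesis using m i supp_mono by fastforce
  qed
  then show ?thesis by blast
qed

lemma UG_conj:
  assumes g: "g \<in> GLV" shows "\<exists>t. \<forall>u\<in>UG t. inv g \<circ> u \<circ> g \<in> UG s"
proof -
  obtain t where t: "\<forall>j<s. supp t (g (ev j))" using GLV_supp_ex[of "{g}" s] g by auto
  have "inv g \<circ> u \<circ> g \<in> UG s" if u: "u \<in> UG t" for u
  proof -
    have "(inv g \<circ> u \<circ> g) (ev j) = ev j" if "j < s" for j
      using UG_fix[OF u] t that GLV_bij[OF g] by (simp add: bij_is_inj)
    moreover have "u \<in> GLV" using u UG_sub by blast
    ultimately show ?thesis using g by (simp add: UG_def GLV_comp GLV_inv)
  qed
  then show ?thesis by blast
qed

lemma GLV_nonarch: "nonarch_group (GLV :: ('k::{field,finite}) vmap set) GLV_top UG"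
proof
  show "inv g \<in> UG s" if "g \<in> UG s" for g :: "'k vmap" and s
  proof -
    have g: "g \<in> GLV" "\<And>j. j < s \<Longrightarrow> g (ev j) = ev j" using that by (auto simp: UG_def)
    have "inv g (ev j) = ev j" if "j < s" for j
      using g(2)[OF that] GLV_bij[OF g(1)] by (metis bij_is_inj inv_f_f)
    then show ?thesis using g by (simp add: UG_def GLV_inv)
  qed
  show "g \<circ> h \<in> UG s" if "g \<in> UG s" "h \<in> UG s" for g h :: "'k vmap" and s
    using that by (auto simp: UG_def GLV_comp)
qed (simp_all add: GLV_id GLV_comp GLV_inv GLV_bij UG_open UG_basis UG_conj UG_sub UG_id del: id_apply)

section \<open>Coordinate exchanges and shears of the vector space\<close>

definition kapG :: "nat \<Rightarrow> nat \<Rightarrow> (nat \<Rightarrow> 'k::{field,finite}) \<Rightarrow> nat \<Rightarrow> 'k" where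
  "kapG B n v = (if v \<in> Vspace then (\<lambda>i. v (swapb B n i)) else v)"

lemma kapG_GLV: assumes "n \<le> B" shows "kapG B n \<in> GLV"
proof -
  have V: "kapG B n v \<in> Vspace" if v: "v \<in> Vspace" for v :: "nat \<Rightarrow> 'a"
  proof -
    obtain m where m: "supp m v" using v by (rule Vspace_suppE)
    have "supp (m + B + n) (kapG B n v)" using m v by (auto simp: supp_def kapG_def swapb_def)
    then show ?thesis by (rule supp_Vspace)
  qed
  have inv: "kapG B n (kapG B n v) = v" if v: "v \<in> Vspace" for v :: "nat \<Rightarrow> 'a"
    unfolding kapG_def[of B n "kapG B n v"] using V[OF v] v by (simp add: kapG_def swapb_swapb assms)
  show ?thesis
    by (rule GLVI[of _ "kapG B n"]) (auto simp: V inv, auto simp: kapG_def Vspace_comb)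
qed

definition Sn :: "nat \<Rightarrow> (nat \<Rightarrow> 'k::{field,finite}) set" where
  "Sn n = {a. \<forall>i. i \<notin> {2..<n} \<longrightarrow> a i = 0}"

text \<open>Adds \<open>a\<close> to the first unit vector and \<open>b\<close> to the second and
  fixes all others, so its matrix on the first \<open>n\<close> coordinates acts on letters of
  length \<open>n\<close>.\<close>

definition shear :: "(nat \<Rightarrow> 'k::{field,finite}) \<Rightarrow> (nat \<Rightarrow> 'k) \<Rightarrow> (nat \<Rightarrow> 'k) \<Rightarrow> nat \<Rightarrow> 'k" where
  "shear a b v = (if v \<in> Vspace then (\<lambda>i. v i + v 0 * a i + v 1 * b i) else v)"

definition FG :: "nat \<Rightarrow> ('k::{field,finite}) vmap set" where
  "FG n = (\<lambda>(a, b). shear a b) ` (Sn n \<times> Sn n)"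

lemma Sn_0: "a \<in> Sn n \<Longrightarrow> a 0 = 0 \<and> a 1 = 0 \<and> a (Suc 0) = 0"
  by (simp add: Sn_def)

lemma shear_V: assumes "a \<in> Sn n" "b \<in> Sn n" "v \<in> Vspace" shows "shear a b v \<in> Vspace"
proof -
  obtain m where m: "supp m v" using assms(3) by (rule Vspace_suppE)
  have "supp (m + n) (shear a b v)" using m assms by (auto simp: supp_def shear_def Sn_def)
  then show ?thesis by (rule supp_Vspace)
qed

text \<open>Vectors in \<open>Sn n\<close> vanish at 0 and 1, so a shear leaves these two
  coordinates alone and is undone by the shear with negated vectors.\<close>

lemma shear_GLV: assumes a: "a \<in> Sn n" and b: "b \<in> Sn n" shows "shear a b \<in> GLV"
proof -
  let ?a = "\<lambda>i. - a i" and ?b = "\<lambda>i. - b i"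
  have neg: "?a \<in> Sn n" "?b \<in> Sn n" using a b by (auto simp: Sn_def)
  have inv: "shear a' b' (shear c d v) = v"
    if "a' \<in> Sn n" "b' \<in> Sn n" "c \<in> Sn n" "d \<in> Sn n" "v \<in> Vspace" "\<And>i. a' i = - c i" "\<And>i. b' i = - d i"
    for a' b' c d :: "nat \<Rightarrow> 'a" and v
  proof -
    have "shear c d v \<in> Vspace" using that by (intro shear_V)
    then have "shear a' b' (shear c d v) i = shear c d v i + shear c d v 0 * a' i + shear c d v 1 * b' i" for i
      by (simp add: shear_def[of a'])
    also have "\<dots> i = v i" for i using that Sn_0[OF that(3)] Sn_0[OF that(4)] by (simp add: shear_def)
    finally show ?thesis by (simp add: fun_eq_iff)
  qed
  show ?thesis
    by (rule GLVI[of _ "shear ?a ?b"])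
      (auto simp: shear_V[OF a b] shear_V[OF neg] intro!: inv a b neg,
       auto simp: shear_def Vspace_comb algebra_simps)
qed

lemma shear_ev: "a \<in> Sn n \<Longrightarrow> b \<in> Sn n \<Longrightarrow> shear a b (ev 0) = (\<lambda>i. ev 0 i + a i)"
  "a \<in> Sn n \<Longrightarrow> b \<in> Sn n \<Longrightarrow> shear a b (ev 1) = (\<lambda>i. ev 1 i + b i)"
  "2 \<le> j \<Longrightarrow> shear a b (ev j) = ev j"
  by (auto simp: shear_def fun_eq_iff, auto simp: ev_def)

lemma shear_inj:
  assumes "a \<in> Sn n" "b \<in> Sn n" "a' \<in> Sn n" "b' \<in> Sn n" "shear a b (ev 0) = shear a' b' (ev 0)"
    "shear a b (ev 1) = shear a' b' (ev 1)"
  shows "a = a' \<and> b = b'"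
proof -
  have "ev 0 i + a i = ev 0 i + a' i" "ev 1 i + b i = ev 1 i + b' i" for i
    using fun_cong[OF assms(5), of i] fun_cong[OF assms(6), of i]
    by (simp_all only: shear_ev(1,2)[OF assms(1,2)] shear_ev(1,2)[OF assms(3,4)])
  then show ?thesis by (simp add: fun_eq_iff)
qed

lemma finite_Sn: "finite (Sn n :: (nat \<Rightarrow> 'k::{field,finite}) set)"
  and card_Sn: "card (Sn n :: (nat \<Rightarrow> 'k::{field,finite}) set) = CARD('k) ^ (n - 2)"
proof -
  let ?R = "\<lambda>a :: nat \<Rightarrow> 'k. restrict a {2..<n}"
  have "bij_betw ?R (Sn n) ({2..<n} \<rightarrow>\<^sub>E UNIV)"
    by (rule bij_betw_byWitness[of _ "\<lambda>a i. if i \<in> {2..<n} then a i else 0"])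
      (auto simp: Sn_def fun_eq_iff PiE_iff extensional_def)
  then show "finite (Sn n :: (nat \<Rightarrow> 'k) set)" "card (Sn n :: (nat \<Rightarrow> 'k) set) = CARD('k) ^ (n - 2)"
    using bij_betw_finite bij_betw_same_card by (fastforce simp: card_PiE finite_PiE)+
qed

lemma FG_card: "card (FG n :: ('k::{field,finite}) vmap set) = CARD('k) ^ (2 * (n - 2))"
proof -
  have "inj_on (\<lambda>(a, b). shear a b) (Sn n \<times> Sn n :: ((nat \<Rightarrow> 'k) \<times> (nat \<Rightarrow> 'k)) set)"
  proof (rule inj_onI)
    fix x y :: "(nat \<Rightarrow> 'k) \<times> (nat \<Rightarrow> 'k)"
    assume xy: "x \<in> Sn n \<times> Sn n" "y \<in> Sn n \<times> Sn n" "(\<lambda>(a, b). shear a b) x = (\<lambda>(a, b). shear a b) y"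
    obtain a b a' b' where x: "x = (a, b)" and y: "y = (a', b')" by fastforce
    show "x = y" using shear_inj[of a n b a' b'] xy unfolding x y by simp
  qed
  then show ?thesis
    unfolding FG_def by (simp add: card_image card_cartesian_product card_Sn mult_2 power_add)
qed

section \<open>Matrix rows as words and their Ramsey property\<close>

lemma dual_surj:
  fixes h :: "(nat \<Rightarrow> 'k::{field,finite}) \<Rightarrow> nat \<Rightarrow> 'k"
  assumes h: "h \<in> GLV" and L: "\<And>j. j < n \<Longrightarrow> supp L (h (ev j))" and xs: "length xs = n"
  shows "\<exists>e. length e = L \<and> (\<forall>i<n. (\<Sum>t<L. e ! t * h (ev i) t) = xs ! i)"
proof (intro exI conjI allI impI)
  \<comment> \<open>This is the functional with coefficients \<open>xs\<close>, pulled back along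
    \<open>inv h\<close>.\<close>
  let ?e = "map (\<lambda>t. \<Sum>j<n. xs ! j * inv h (ev t) j) [0..<L]"
  show "length ?e = L" by simp
  fix i assume i: "i < n"
  have "(\<Sum>t<L. ?e ! t * h (ev i) t) = (\<Sum>t<L. \<Sum>j<n. xs ! j * (h (ev i) t * inv h (ev t) j))"
    by (simp add: sum_distrib_left mult_ac)
  also have "\<dots> = (\<Sum>j<n. xs ! j * (\<Sum>t<L. h (ev i) t * inv h (ev t) j))"
    by (subst sum.swap) (simp add: sum_distrib_left)
  also have "\<dots> = (\<Sum>j<n. xs ! j * inv h (h (ev i)) j)"
    by (simp add: GLV_expand[OF GLV_inv[OF h] L[OF i]])
  also have "\<dots> = (\<Sum>j<n. xs ! j * ev i j)" using GLV_bij[OF h] by (simp add: bij_is_inj)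
  also have "\<dots> = xs ! i" using i by (simp add: ev_def if_distrib cong: if_cong)
  finally show "(\<Sum>t<L. ?e ! t * h (ev i) t) = xs ! i" .
qed

lemma GLV_supp_image:
  assumes h: "h \<in> GLV" and x: "supp n x" and L: "\<And>j. j < n \<Longrightarrow> supp L (h (ev j))"
  shows "supp L (h x)"
  unfolding supp_def
proof (intro allI impI)
  fix i assume "L \<le> i"
  then have "h (ev j) i = 0" if "j < n" for j using suppD[OF L[OF that]] by simp
  then show "h x i = 0" unfolding GLV_expand[OF h x] by simp
qed

text \<open>A matrix whose rows contain all unit vectors is injective with a coordinate projection as left
  inverse, which makes its extension to an automorphism explicit.\<close>
lemma matrix_extension:
  fixes M :: "nat \<Rightarrow> nat \<Rightarrow> 'k::{field,finite}"
  assumes p: "\<And>t. t < L \<Longrightarrow> p t < N" and Mp: "\<And>t t'. t < L \<Longrightarrow> t' < L \<Longrightarrow> M (p t) t' = (if t' = t then 1 else 0)"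
  shows "\<exists>g\<in>GLV. \<forall>x. supp L x \<longrightarrow>
    (\<forall>i. g x i = (if L \<le> i \<and> i < L + N then \<Sum>t<L. M (i - L) t * x t else 0))"
proof -
  have p_inj: "inj_on p {..<L}"
  proof (rule inj_onI)
    fix t t' assume t: "t \<in> {..<L}" "t' \<in> {..<L}" "p t = p t'"
    then have "M (p t) t = M (p t') t" by simp
    then show "t = t'" using t Mp[of t t] Mp[of t' t] by (auto split: if_splits)
  qed
  \<comment> \<open>The output of the matrix is stored from coordinate \<open>L\<close> on, disjoint
    from its input. The row \<open>p t\<close> repeats the input coordinate \<open>t\<close>, so the
    coordinates in \<open>I\<close> carry a copy of the input.\<close>
  define I where "I = (\<lambda>t. L + p t) ` {..<L}"
  define ip where "ip j = inv_into {..<L} p (j - L)" for j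
  have ip: "ip (L + p t) = t" if "t < L" for t using that p_inj by (simp add: ip_def)
  have I_in: "L + p t \<in> I" if "t < L" for t using that by (auto simp: I_def)
  have I_out: "j \<notin> I" if "j < L \<or> L + N \<le> j" for j using that p by (force simp: I_def)
  have IE: "\<exists>t<L. j = L + p t" if "j \<in> I" for j using that by (auto simp: I_def)
  define S where "S v j = (\<Sum>t<L. M (j - L) t * v t)" for v :: "nat \<Rightarrow> 'k" and j
  have S_p: "S v (L + p t) = v t" if "t < L" for v t
  proof -
    have "S v (L + p t) = (\<Sum>t'<L. (if t' = t then v t' else 0))"
      unfolding S_def by (intro sum.cong) (auto simp: Mp that)
    then show ?thesis using that by simp
  qed
  \<comment> \<open>As the input is recoverable from \<open>I\<close>, the first \<open>L\<close>
    output coordinates are free to hold the old contents of \<open>I\<close>. They vanish when the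
    vector is supported below \<open>L\<close>.\<close>
  define g where "g v = (if v \<in> Vspace then (\<lambda>j. if j < L then v (L + p j) else if j < L + N then
      S v j + (if j \<in> I then 0 else v j) else v j) else v)" for v
  define g' where "g' y = (if y \<in> Vspace then (\<lambda>j. if j < L then y (L + p j) else if j \<in> I then y (ip j)
      else if j < L + N then y j - S (\<lambda>t. y (L + p t)) j else y j) else y)" for y
  have gV: "g v \<in> Vspace" and g'V: "g' v \<in> Vspace" if v: "v \<in> Vspace" for v
  proof -
    obtain m where m: "supp m v" using v by (rule Vspace_suppE)
    have "supp (m + L + N) (g v)" using m v by (auto simp: supp_def g_def)
    then show "g v \<in> Vspace" by (rule supp_Vspace)
    have "supp (m + L + N) (g' v)" using m v I_out by (auto simp: supp_def g'_def)
    then show "g' v \<in> Vspace" by (rule supp_Vspace)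
  qed
  have gp: "g v (L + p t) = v t" if "v \<in> Vspace" "t < L" for v t
    using that p[OF that(2)] I_in by (simp add: g_def S_p)
  have S_cong: "S v j = S w j" if "\<And>t. t < L \<Longrightarrow> v t = w t" for v w j
    unfolding S_def using that by (intro sum.cong) auto
  have inv1: "g' (g v) = v" if v: "v \<in> Vspace" for v
  proof
    fix j
    have "g' (g v) j = (if j < L then g v (L + p j) else if j \<in> I then g v (ip j)
      else if j < L + N then g v j - S (\<lambda>t. g v (L + p t)) j else g v j)"
      using gV[OF v] by (simp add: g'_def)
    also have "S (\<lambda>t. g v (L + p t)) j = S v j" by (rule S_cong) (rule gp[OF v])
    also have "(if j < L then g v (L + p j) else if j \<in> I then g v (ip j)
      else if j < L + N then g v j - S v j else g v j) = v j"
    proof (cases "j \<in> I")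
      case True
      then obtain t where t: "t < L" "j = L + p t" using IE by blast
      then show ?thesis using True v by (simp add: ip g_def)
    qed (use v gp[OF v] in \<open>auto simp: g_def\<close>)
    finally show "g' (g v) j = v j" .
  qed
  have inv2: "g (g' y) = y" if y: "y \<in> Vspace" for y
  proof
    fix j
    have g't: "g' y t = y (L + p t)" "g' y (L + p t) = y t" if "t < L" for t
      using that y I_in by (simp_all add: g'_def ip)
    have "g (g' y) j = (if j < L then g' y (L + p j) else if j < L + N then
      S (g' y) j + (if j \<in> I then 0 else g' y j) else g' y j)"
      using g'V[OF y] by (simp add: g_def)
    also have "S (g' y) j = S (\<lambda>t. y (L + p t)) j" by (rule S_cong) (rule g't)
    also have "(if j < L then g' y (L + p j) else if j < L + N then
      S (\<lambda>t. y (L + p t)) j + (if j \<in> I then 0 else g' y j) else g' y j) = y j"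
    proof (cases "j \<in> I")
      case True
      then obtain t where t: "t < L" "j = L + p t" using IE by blast
      then show ?thesis using True p[OF t(1)] by (simp add: S_p)
    next
      case False
      show ?thesis
      proof (cases "j < L")
        case False
        then show ?thesis using \<open>j \<notin> I\<close> y by (simp add: g'_def)
      qed (simp add: g't)
    qed
    finally show "g (g' y) j = y j" .
  qed
  have S_lin: "S (\<lambda>n. a * u n + b * v n) j = a * S u j + b * S v j" for a b u v j
    unfolding S_def sum_distrib_left by (simp add: sum.distrib[symmetric] algebra_simps)
  have "g \<in> GLV"
  proof (rule GLVI[OF gV g'V inv1 inv2])
    show "g v = v" if "v \<notin> Vspace" for v using that by (simp add: g_def)
    show "g (\<lambda>n. a * u n + b * v n) i = a * g u i + b * g v i" if "u \<in> Vspace" "v \<in> Vspace" for u v a b i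
      using that Vspace_comb[OF that, of a b] by (simp add: g_def S_lin algebra_simps)
  qed
  moreover have "g x i = (if L \<le> i \<and> i < L + N then \<Sum>t<L. M (i - L) t * x t else 0)" if x: "supp L x" for x i
    using supp_Vspace[OF x] suppD[OF x] by (simp add: g_def S_def)
  ultimately show ?thesis by blast
qed

lemma FG_GLV: "\<phi> \<in> FG n \<Longrightarrow> \<phi> \<in> GLV"
  by (auto simp: FG_def shear_GLV)

lemma FG_supp: assumes "\<phi> \<in> FG n" "j < n" shows "supp n (\<phi> (ev j))"
proof -
  obtain a b where "\<phi> = shear a b" "a \<in> Sn n" "b \<in> Sn n" using assms(1) by (auto simp: FG_def)
  then show ?thesis using assms(2) by (auto simp: shear_def supp_def Sn_def ev_def)
qed

lemma finite_lists_UNIV: "finite {xs :: 'k::finite list. length xs = n}"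
  and card_lists_UNIV: "card {xs :: 'k::finite list. length xs = n} = CARD('k) ^ n"
  using finite_lists_length_eq[of "UNIV :: 'k set" n] card_lists_length_eq[of "UNIV :: 'k set" n] by simp_all

text \<open>The coset of \<open>g\<close> modulo \<open>UG s\<close> is determined by the images of
  the first \<open>s\<close> unit vectors, hence by a matrix, whose rows are the letters. The word
  of \<open>h\<close> evaluates every functional on \<open>L\<close> coordinates at the images under
  \<open>h\<close> of the first \<open>n\<close> unit vectors, and \<open>\<phi>\<close> acts on
  such a row by matrix multiplication from the right.\<close>

lemma GLV_ramsey:
  fixes c :: "('k::{field,finite}) vmap \<Rightarrow> nat"
  assumes n: "2 \<le> n" "s \<le> n" and c: "\<And>g. g \<in> GLV \<Longrightarrow> c g < r"
    "\<And>g u. g \<in> GLV \<Longrightarrow> u \<in> UG s \<Longrightarrow> c (g \<circ> u) = c g"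
    and D: "finite D" "D \<subseteq> GLV"
  shows "\<exists>g\<in>GLV. card ((\<lambda>h. \<lambda>\<phi>\<in>FG n. c (g \<circ> h \<circ> \<phi>)) ` D) \<le> (CARD('k) ^ n) ^ (CARD('k) ^ n)"
proof -
  let ?A = "{xs :: 'k list. length xs = n}"
  obtain L where L: "\<And>h j. h \<in> D \<Longrightarrow> j < n \<Longrightarrow> supp L (h (ev j))" using GLV_supp_ex[OF D, of n] by blast
  obtain E where E: "set E = {e :: 'k list. length e = L}" "distinct E"
    using finite_distinct_list[OF finite_lists_UNIV] by blast
  define dot where "dot e x = (\<Sum>t<L. e ! t * x t)" for e :: "'k list" and x :: "nat \<Rightarrow> 'k"
  define v where "v h = map (\<lambda>e. map (\<lambda>j. dot e (h (ev j))) [0..<n]) E" for h :: "'k vmap"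
  define f where "f \<phi> xs = map (\<lambda>j. \<Sum>l<n. xs ! l * \<phi> (ev j) l) [0..<s]"
    for \<phi> :: "'k vmap" and xs :: "'k list"
  have "\<exists>g\<in>GLV. card ((\<lambda>h. \<lambda>\<phi>\<in>FG n. c (g \<circ> h \<circ> \<phi>)) ` D) \<le> card ?A ^ card ?A"
  proof (rule word_patterns[where c = "\<lambda>g h \<phi>. c (g \<circ> h \<circ> \<phi>)" and D = D and F = "FG n" and A = ?A and r = r
        and v = v and e = f and len = "length E" and B = "{xs. length xs = s}"])
    show "finite D" "finite ?A" by (rule D finite_lists_UNIV)+
    show "length (v h) = length E" for h by (simp add: v_def)
    have "(\<lambda>i. 0) \<in> (Sn n :: (nat \<Rightarrow> 'k) set)" by (simp add: Sn_def)
    then have "(Sn n :: (nat \<Rightarrow> 'k) set) \<noteq> {}" by blast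
    then show "(FG n :: 'k vmap set) \<noteq> {}" by (simp add: FG_def)
    show "c (g \<circ> h \<circ> \<phi>) < r" if "g \<in> GLV" "h \<in> D" "\<phi> \<in> FG n" for g h \<phi>
      using that D FG_GLV by (intro c GLV_comp) auto
    show "set (v h) = ?A" if h: "h \<in> D" for h
    proof
      have hG: "h \<in> GLV" using h D by blast
      show "?A \<subseteq> set (v h)"
      proof
        fix xs assume "xs \<in> ?A"
        then have xs: "length xs = n" by simp
        from dual_surj[OF hG L[OF h] xs] obtain e where
          "length e = L \<and> (\<forall>i<n. (\<Sum>t<L. e ! t * h (ev i) t) = xs ! i)" ..
        then have e: "length e = L" "\<And>i. i < n \<Longrightarrow> dot e (h (ev i)) = xs ! i" unfolding dot_def by blast+
        have "xs = map (\<lambda>j. dot e (h (ev j))) [0..<n]" using xs e(2) by (simp add: list_eq_iff_nth_eq)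
        moreover have "e \<in> set E" using E e(1) by simp
        ultimately show "xs \<in> set (v h)" unfolding v_def set_map by (rule image_eqI)
      qed
      show "set (v h) \<subseteq> ?A" by (auto simp: v_def)
    qed
    show "f \<phi> ` ?A = {xs. length xs = s}" if \<phi>: "\<phi> \<in> FG n" for \<phi>
    proof
      show "{xs. length xs = s} \<subseteq> f \<phi> ` ?A"
      proof
        fix ys :: "'k list" assume "ys \<in> {xs. length xs = s}"
        then have ys: "length ys = s" by simp
        have "supp n (\<phi> (ev j))" if "j < s" for j by (rule FG_supp[OF \<phi>]) (use that n in simp)
        from dual_surj[OF FG_GLV[OF \<phi>] this ys] obtain e where
          e: "length e = n \<and> (\<forall>i<s. (\<Sum>t<n. e ! t * \<phi> (ev i) t) = ys ! i)" ..
        then have "ys = f \<phi> e" using ys by (simp add: f_def list_eq_iff_nth_eq)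
        moreover have "e \<in> ?A" using e by simp
        ultimately show "ys \<in> f \<phi> ` ?A" by (rule image_eqI)
      qed
      show "f \<phi> ` ?A \<subseteq> {xs. length xs = s}" by (auto simp: f_def)
    qed
    fix N
    \<comment> \<open>The rows sit at coordinates \<open>L\<close> to \<open>L + N - 1\<close>,
      where \<open>matrix_extension\<close> puts them. Elements with the same \<open>a\<close> agree
      on the first \<open>s\<close> unit vectors and so lie in one coset.\<close>
    define Q where "Q a g \<longleftrightarrow> g \<in> GLV \<and>
      (\<forall>j<s. \<forall>i. g (ev j) i = (if L \<le> i \<and> i < L + N then a ! (i - L) ! j else 0))"
      for a :: "'k list list" and g
    show "\<exists>\<Gamma>. \<forall>w. length w = N \<longrightarrow> set w = {..<length E} \<longrightarrow>
      (\<exists>g\<in>GLV. \<forall>h\<in>D. \<forall>\<phi>\<in>FG n. c (g \<circ> h \<circ> \<phi>) = \<Gamma> (map (\<lambda>i. f \<phi> (v h ! i)) w))"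
    proof (intro exI[of _ "\<lambda>a. c (SOME g. Q a g)"] allI impI)
      fix w assume w: "length w = N" "set w = {..<length E}"
      have wE: "w ! i < length E" if "i < N" for i using that w nth_mem by blast
      define M where "M i t = E ! (w ! i) ! t" for i t
      \<comment> \<open>Since \<open>w\<close> is onto, every functional occurs as a row, in
        particular every coordinate functional; this supplies the unit rows for
        \<open>matrix_extension\<close>.\<close>
      have "\<exists>i<N. \<forall>t'<L. M i t' = (if t' = t then 1 else 0)" for t
      proof -
        let ?e = "map (\<lambda>t'. if t' = t then 1 else 0 :: 'k) [0..<L]"
        have "?e \<in> set E" using E by simp
        then obtain k where k: "k < length E" "E ! k = ?e" unfolding in_set_conv_nth by blast
        then have "k \<in> set w" using w by simp
        then obtain i where "i < N" "w ! i = k" using w(1) unfolding in_set_conv_nth by blast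
        then show ?thesis using k(2) by (intro exI[of _ i]) (simp add: M_def)
      qed
      then obtain p where p: "\<And>t. p t < N" "\<And>t t'. t' < L \<Longrightarrow> M (p t) t' = (if t' = t then 1 else 0)" by metis
      have "\<exists>g\<in>GLV. \<forall>x. supp L x \<longrightarrow>
        (\<forall>i. g x i = (if L \<le> i \<and> i < L + N then \<Sum>t<L. M (i - L) t * x t else 0))"
        by (rule matrix_extension[of L p]) (use p in auto)
      then obtain g where g: "g \<in> GLV" and gx: "\<And>x i. supp L x \<Longrightarrow>
        g x i = (if L \<le> i \<and> i < L + N then \<Sum>t<L. M (i - L) t * x t else 0)"
        by auto
      have Q_unique: "c g1 = c g2" if "Q a g1" "Q a g2" for a g1 g2
      proof -
        have G: "g1 \<in> GLV" "g2 \<in> GLV" using that by (auto simp: Q_def)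
        have ev: "g2 (ev j) = g1 (ev j)" if "j < s" for j
          using \<open>Q a g1\<close> \<open>Q a g2\<close> that by (auto simp: Q_def fun_eq_iff)
        have inv: "inv g1 (g1 x) = x" "g1 (inv g1 x) = x" for x
          using GLV_bij[OF G(1)] by (simp_all add: bij_is_inj bij_is_surj surj_f_inv_f)
        have "inv g1 \<circ> g2 \<in> UG s" using G by (simp add: UG_def GLV_comp GLV_inv ev inv)
        moreover have eq: "g1 \<circ> (inv g1 \<circ> g2) = g2" by (rule ext) (simp add: inv)
        ultimately show ?thesis using c(2)[OF G(1), of "inv g1 \<circ> g2"] by (simp only: eq)
      qed
      show "\<exists>g\<in>GLV. \<forall>h\<in>D. \<forall>\<phi>\<in>FG n. c (g \<circ> h \<circ> \<phi>) = c (SOME g. Q (map (\<lambda>i. f \<phi> (v h ! i)) w) g)"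
      proof (intro bexI[OF _ g] ballI)
        fix h \<phi> :: "'k vmap" assume h: "h \<in> D" and \<phi>: "\<phi> \<in> FG n"
        let ?a = "map (\<lambda>i. f \<phi> (v h ! i)) w"
        have hG: "h \<in> GLV" using h D by blast
        have G: "g \<circ> h \<circ> \<phi> \<in> GLV" using g hG FG_GLV[OF \<phi>] by (simp add: GLV_comp)
        have "(g \<circ> h \<circ> \<phi>) (ev j) i = (if L \<le> i \<and> i < L + N then ?a ! (i - L) ! j else 0)" if j: "j < s" for i j
        proof -
          have jn: "j < n" using j n by simp
          let ?x = "h (\<phi> (ev j))"
          have x: "supp L ?x" by (rule GLV_supp_image[OF hG FG_supp[OF \<phi> jn] L[OF h]])
          have "(\<Sum>t<L. M k t * ?x t) = ?a ! k ! j" if k: "k < N" for k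
          proof -
            let ?e = "E ! (w ! k)"
            have "(\<Sum>t<L. M k t * ?x t) = (\<Sum>t<L. \<Sum>l<n. \<phi> (ev j) l * (?e ! t * h (ev l) t))"
              unfolding GLV_expand[OF hG FG_supp[OF \<phi> jn]] by (simp add: M_def sum_distrib_left mult_ac)
            also have "\<dots> = (\<Sum>l<n. dot ?e (h (ev l)) * \<phi> (ev j) l)"
              unfolding dot_def by (subst sum.swap) (simp add: sum_distrib_left mult_ac)
            also have "\<dots> = ?a ! k ! j"
              using k w(1) wE[OF k] j by (simp add: f_def v_def)
            finally show ?thesis .
          qed
          then show ?thesis using gx[OF x, of i] by auto
        qed
        then have Q: "Q ?a (g \<circ> h \<circ> \<phi>)" using G by (simp add: Q_def)
        then have "Q ?a (SOME g. Q ?a g)" by (rule someI[of "Q ?a"])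
        from Q_unique[OF Q this] show "c (g \<circ> h \<circ> \<phi>) = c (SOME g. Q ?a g)" .
      qed
    qed
  qed
  then show ?thesis by (simp add: card_lists_UNIV)
qed

lemma UG_ev: "u \<in> UG 2 \<Longrightarrow> u (ev 0) = ev 0 \<and> u (ev 1) = ev 1"
  by (simp add: UG_def)

text \<open>The image of \<open>ev 0\<close> is an invariant of the coset modulo
  \<open>UG 2\<close>, and the least index of a nonzero coordinate of it recovers
  \<open>B\<close>.\<close>

lemma kapG_shear_min:
  assumes n: "2 \<le> n" "n \<le> B" and a: "a \<in> Sn n" "b \<in> Sn n" and u: "u \<in> UG 2"
  shows "(kapG B n \<circ> shear a b \<circ> u) (ev 0) B \<noteq> 0" "i < B \<Longrightarrow> (kapG B n \<circ> shear a b \<circ> u) (ev 0) i = 0"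
proof -
  have "shear a b (ev 0) \<in> Vspace" by (rule shear_V[OF a ev_Vspace])
  then have *: "(kapG B n \<circ> shear a b \<circ> u) (ev 0) i = ev 0 (swapb B n i) + a (swapb B n i)" for i
    using UG_ev[OF u] shear_ev(1)[OF a] by (simp add: kapG_def)
  show "(kapG B n \<circ> shear a b \<circ> u) (ev 0) B \<noteq> 0" using n a unfolding * by (simp add: swapb_def ev_def Sn_def)
  show "(kapG B n \<circ> shear a b \<circ> u) (ev 0) i = 0" if "i < B"
    using n a that unfolding * by (auto simp: swapb_def ev_def Sn_def)
qed

lemma CARD_field: "2 \<le> CARD('k::{field,finite})"
proof -
  have "card {0, 1 :: 'k} \<le> CARD('k)" by (intro card_mono) auto
  then show ?thesis by simp
qed

text \<open>The level \<open>s0 = 2\<close> comes from the shears: \<open>UG 2\<close> fixes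
  \<open>ev 0\<close> and \<open>ev 1\<close>, and the images of these two vectors determine a
  shear.\<close>

lemma GLV_ramsey_group:
  "ramsey_group (GLV :: ('k::{field,finite}) vmap set) GLV_top UG FG kapG 2 CARD('k)"
proof (intro ramsey_group.intro[OF GLV_nonarch] ramsey_group_axioms.intro)
  show "finite (FG n :: 'k vmap set)" for n by (simp add: FG_def finite_Sn)
  show "FG n \<subseteq> (GLV :: 'k vmap set)" for n using FG_GLV by blast
  show "2 \<le> CARD('k)" by (rule CARD_field)
  show "CARD('k) ^ (2 * (n - 2)) \<le> card (FG n :: 'k vmap set)" for n by (simp add: FG_card)
  show "\<exists>g\<in>GLV. card ((\<lambda>h. \<lambda>\<phi>\<in>FG n. c (g \<circ> h \<circ> \<phi>)) ` D) \<le> (CARD('k) ^ n) ^ (CARD('k) ^ n)"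
    if "2 \<le> n" "s \<le> n" "\<And>g. g \<in> GLV \<Longrightarrow> c g < r"
      "\<And>g u. g \<in> GLV \<Longrightarrow> u \<in> UG s \<Longrightarrow> c (g \<circ> u) = c g" "finite D" "D \<subseteq> GLV"
    for n s D and r :: nat and c :: "'k vmap \<Rightarrow> nat" by (rule GLV_ramsey[OF that])
  show "kapG B n \<in> GLV" if "n \<le> B" for B n using that by (rule kapG_GLV)
  show "B = B'" if as: "2 \<le> n" "n \<le> B" "2 \<le> n'" "n' \<le> B'" "\<phi> \<in> FG n" "\<phi>' \<in> FG n'" "u \<in> UG 2" "u' \<in> UG 2"
    "kapG B n \<circ> \<phi> \<circ> u = kapG B' n' \<circ> \<phi>' \<circ> u'" for n B n' B' and \<phi> \<phi>' u u' :: "'k vmap"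
  proof -
    obtain a b where ab: "\<phi> = shear a b" "a \<in> Sn n" "b \<in> Sn n" using as(5) by (auto simp: FG_def)
    obtain a' b' where ab': "\<phi>' = shear a' b'" "a' \<in> Sn n'" "b' \<in> Sn n'" using as(6) by (auto simp: FG_def)
    note m = kapG_shear_min[OF as(1,2) ab(2,3) as(7), folded ab(1)]
    note m' = kapG_shear_min[OF as(3,4) ab'(2,3) as(8), folded ab'(1), folded as(9)]
    show "B = B'"
    proof (rule linorder_cases[of B B'])
      assume "B < B'" then show ?thesis using m(1) m'(2) by blast
    next
      assume "B' < B" then show ?thesis using m'(1) m(2) by blast
    qed
  qed
  show "\<phi> = \<phi>'" if as: "\<phi> \<in> FG n" "\<phi>' \<in> FG n" "u \<in> UG 2" "u' \<in> UG 2" "\<phi> \<circ> u = \<phi>' \<circ> u'"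
    for n and \<phi> \<phi>' u u' :: "'k vmap"
  proof -
    obtain a b where ab: "\<phi> = shear a b" "a \<in> Sn n" "b \<in> Sn n" using as(1) by (auto simp: FG_def)
    obtain a' b' where ab': "\<phi>' = shear a' b'" "a' \<in> Sn n" "b' \<in> Sn n" using as(2) by (auto simp: FG_def)
    have "\<phi> (ev 0) = \<phi>' (ev 0)" "\<phi> (ev 1) = \<phi>' (ev 1)"
      using fun_cong[OF as(5), of "ev 0"] fun_cong[OF as(5), of "ev 1"] UG_ev[OF as(3)] UG_ev[OF as(4)] by simp_all
    then show ?thesis using shear_inj[OF ab(2,3) ab'(2,3)] ab(1) ab'(1) by blast
  qed
qed

theorem mainTheorem13:
  shows "S_not_iso_EM homeo_cantor (\<circ>) inv id homeo_cantor_top \<and>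
         S_not_iso_EM (GLV :: ((nat \<Rightarrow> 'k::{field,finite}) \<Rightarrow> (nat \<Rightarrow> 'k)) set)
                      (\<circ>) inv id GLV_top"
  using cantor.not_iso ramsey_group.not_iso[OF GLV_ramsey_group] by blast

end
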